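(* Let $\mathbb{G}\subset\mathbb{C}^n$ be a generic real subspace of complex dimension $m\le n$. Let $c_n:=\dfrac{4^{n}(n!)^2}{(2n-1)!}$, and set $\sigma_{n,m}:=2\log(1+8(n+m))+8(n+m)$ if $0\le m\le n-1$ and $\sigma_{n,n}:=\log(1+c_n)+c_n/2$. Then for any function $u\in\mathcal{L}(\mathbb{C}^n)$, one has $u|_{\mathbb{G}}\in\mathrm{BMO}(\mathbb{G})$ and $$\|u\|_{\mathrm{BMO}(\mathbb{G})}\le\sigma_{n,m}.$$ In particular, for any polynomial $P\in\mathbb{C}[z]$ (in $z=(z_1,\dots,z_n)$) with $\deg(P)=d\ge 1$, $$\bigl\|\log|P|\bigr\|_{\mathrm{BMO}(\mathbb{G})}\le\sigma_{n,m}\cdot d.$$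
   Context: $\mathcal{L}(\mathbb{C}^n)$ is the Lelong class: the set of plurisubharmonic functions $u$ on $\mathbb{C}^n$ (not identically $-\infty$) with $\sup_{z\in\mathbb{C}^n}\{u(z)-\log^+|z|\}<+\infty$. A real linear subspace $\mathbb{G}\subset\mathbb{C}^n$ is generic if $\mathbb{G}+J\mathbb{G}=\mathbb{C}^n$, where $J$ is the complex structure (multiplication by $i$). Its complex dimension is $m:=\dim_{\mathbb{C}}(\mathbb{G}\cap J\mathbb{G})$, so $\dim_{\mathbb{R}}\mathbb{G}=n+m$ (and $\mathbb{G}=\mathbb{C}^n$ if $m=n$). $\mathbb{G}$ carries the induced Euclidean structure and Lebesgue measure. BMO: for a real Euclidean space $\mathbb{G}$ of dimension $k\ge1$ with Lebesgue measure $\lambda_k$, and a locally integrable $f:\mathbb{G}\to\overline{\mathbb{R}}$, put $f_B:=\frac{1}{\lambda_k(B)}\int_B f\,d\lambda_k$ for a Euclidean ball $B\subset\mathbb{G}$, and $\|f\|_{\mathrm{BMO}(\mathbb{G})}:=\sup_B\frac{1}{\lambda_k(B)}\int_B|f-f_B|\,d\lambda_k$, the supremum being over all Euclidean balls $B\subset\mathbb{G}$. Then $f\in\mathrm{BMO}(\mathbb{G})$ iff $\|f\|_{\mathrm{BMO}(\mathbb{G})}<+\infty$. For a function on $\mathbb{C}^n$, $\|\cdot\|_{\mathrm{BMO}(\mathbb{G})}$ refers to its restriction to $\mathbb{G}$. *)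

theory Defs
  imports "HOL-Analysis.Analysis" "HOL-Library.Poly_Mapping"
begin

subsection \<open>Plurisubharmonic functions and the Lelong class\<close>

definition usc :: "('a::topological_space \<Rightarrow> ereal) \<Rightarrow> bool" where
  "usc f \<longleftrightarrow> (\<forall>a. open {x. f x < a})"

text \<open>Integral of an extended real function as positive part minus negative part
  (\<^term>\<open>e2ennreal\<close> maps negative arguments to 0). It is only used below for functions
  bounded above on a finite measure space, so that no difference of infinities occurs.\<close>

definition ereal_integral :: "'a measure \<Rightarrow> ('a \<Rightarrow> ereal) \<Rightarrow> ereal" where
  "ereal_integral M f =
     enn2ereal (\<integral>\<^sup>+x. e2ennreal (f x) \<partial>M) - enn2ereal (\<integral>\<^sup>+x. e2ennreal (- f x) \<partial>M)"

definition circle_mean :: "(complex \<Rightarrow> ereal) \<Rightarrow> complex \<Rightarrow> real \<Rightarrow> ereal" where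
  "circle_mean v a r =
     ereal_integral (uniform_measure lborel {0..2 * pi}) (\<lambda>t. v (a + of_real r * cis t))"

text \<open>The constant \<open>-\<infinity>\<close> is admitted here and in \<open>psh\<close>; it is excluded in \<open>lelong\<close>.\<close>

definition subharmonic :: "(complex \<Rightarrow> ereal) \<Rightarrow> bool" where
  "subharmonic v \<longleftrightarrow> usc v \<and> (\<forall>z. v z < \<infinity>) \<and> (\<forall>a. \<forall>r>0. v a \<le> circle_mean v a r)"

definition psh :: "(complex ^ 'n \<Rightarrow> ereal) \<Rightarrow> bool" where
  "psh u \<longleftrightarrow> usc u \<and> (\<forall>z. u z < \<infinity>) \<and> (\<forall>a b. subharmonic (\<lambda>\<zeta>. u (a + \<zeta> *s b)))"

definition lelong :: "(complex ^ 'n \<Rightarrow> ereal) set" where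
  "lelong = {u. psh u \<and> (\<exists>z. u z \<noteq> -\<infinity>) \<and>
     (SUP z. u z - ereal (ln (max 1 (norm z)))) < \<infinity>}"

subsection \<open>Generic real subspaces\<close>

definition J :: "complex ^ 'n \<Rightarrow> complex ^ 'n" where
  "J z = \<i> *s z"

definition generic_subspace :: "(complex ^ 'n) set \<Rightarrow> bool" where
  "generic_subspace G \<longleftrightarrow> subspace G \<and> {x + J y | x y. x \<in> G \<and> y \<in> G} = UNIV"

text \<open>\<^term>\<open>vec.dim\<close> is the dimension over the field of scalars of \<open>*s\<close>, here the complex
  numbers, in contrast to the real dimension \<^term>\<open>dim\<close>.\<close>

definition complex_dim :: "(complex ^ 'n) set \<Rightarrow> nat" where
  "complex_dim G = vec.dim (G \<inter> J ` G)"

subsection \<open>Lebesgue measure on a real subspace\<close>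

definition orthonormal_basis :: "'a::euclidean_space set \<Rightarrow> 'a set \<Rightarrow> bool" where
  "orthonormal_basis G B \<longleftrightarrow>
     B \<subseteq> G \<and> pairwise orthogonal B \<and> (\<forall>b\<in>B. norm b = 1) \<and> independent B \<and> span B = G"

text \<open>Lebesgue measure of the Euclidean space \<open>G\<close>, of dimension \<^term>\<open>dim G\<close>: the image of
  the product Lebesgue measure under the coordinates of an orthonormal basis, in analogy with
  \<^term>\<open>lborel\<close>, and completed. By rotation invariance the choice of the basis is
  immaterial. This is not \<^term>\<open>lebesgue_on G\<close>, which vanishes on proper subspaces.\<close>

definition subspace_lborel :: "'a::euclidean_space set \<Rightarrow> 'a measure" where
  "subspace_lborel G =
     (let B = (SOME B. orthonormal_basis G B)
      in distr (\<Pi>\<^sub>M b\<in>B. lborel) (restrict_space borel G) (\<lambda>f. \<Sum>b\<in>B. f b *\<^sub>R b))"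

definition subspace_lebesgue :: "'a::euclidean_space set \<Rightarrow> 'a measure" where
  "subspace_lebesgue G = completion (subspace_lborel G)"

lemma orthonormal_basis_some:
  assumes "subspace G"
  shows "orthonormal_basis G (SOME B. orthonormal_basis G B)"
  by (rule someI_ex)
    (metis assms orthonormal_basis_subspace orthonormal_basis_def)

lemma subspace_coords_measurable:
  assumes "orthonormal_basis G B"
  shows "(\<lambda>f. \<Sum>b\<in>B. f b *\<^sub>R b) \<in> measurable (\<Pi>\<^sub>M b\<in>B. lborel) (restrict_space borel G)"
proof (rule measurable_restrict_space2)
  show "(\<lambda>f. \<Sum>b\<in>B. f b *\<^sub>R b) \<in> space (\<Pi>\<^sub>M b\<in>B. lborel) \<rightarrow> G"
    using assms by (auto simp: orthonormal_basis_def intro: span_sum span_scale span_base)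
  show "(\<lambda>f. \<Sum>b\<in>B. f b *\<^sub>R b) \<in> borel_measurable (\<Pi>\<^sub>M b\<in>B. lborel)"
    by measurable
qed

lemma space_subspace_lebesgue [simp]: "space (subspace_lebesgue G) = G"
  by (simp add: subspace_lebesgue_def subspace_lborel_def Let_def space_restrict_space)

subsection \<open>Bounded mean oscillation\<close>

text \<open>Functions are defined on the ambient space, but only their values on \<open>G\<close> matter.
  Finiteness of the integral of \<open>\<bar>f\<bar>\<close> makes a locally integrable \<open>f\<close> finite almost
  everywhere, so that \<^term>\<open>real_of_ereal\<close> (which maps \<open>\<plusminus>\<infinity>\<close> to 0) alters it on a null set
  only.\<close>

definition locally_integrable :: "'a::euclidean_space set \<Rightarrow> ('a \<Rightarrow> ereal) \<Rightarrow> bool" where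
  "locally_integrable G f \<longleftrightarrow>
     f \<in> borel_measurable (subspace_lebesgue G) \<and>
     (\<forall>K. compact K \<and> K \<subseteq> G \<longrightarrow> (\<integral>\<^sup>+x\<in>K. e2ennreal \<bar>f x\<bar> \<partial>subspace_lebesgue G) < \<infinity>)"

definition average :: "'a::euclidean_space set \<Rightarrow> ('a \<Rightarrow> ereal) \<Rightarrow> 'a set \<Rightarrow> real" where
  "average G f B =
     (LINT x:B|subspace_lebesgue G. real_of_ereal (f x)) / measure (subspace_lebesgue G) B"

definition mean_oscillation :: "'a::euclidean_space set \<Rightarrow> ('a \<Rightarrow> ereal) \<Rightarrow> 'a set \<Rightarrow> ennreal" where
  "mean_oscillation G f B =
     (\<integral>\<^sup>+x\<in>B. e2ennreal \<bar>f x - ereal (average G f B)\<bar> \<partial>subspace_lebesgue G)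
       / emeasure (subspace_lebesgue G) B"

text \<open>The Euclidean balls of \<open>G\<close> are the sets \<^term>\<open>ball c r \<inter> G\<close> with centre \<open>c\<close> in \<open>G\<close>.
  The value is meaningful for locally integrable \<open>f\<close>.\<close>

definition bmo_norm :: "'a::euclidean_space set \<Rightarrow> ('a \<Rightarrow> ereal) \<Rightarrow> ennreal" where
  "bmo_norm G f = (SUP (c, r) \<in> G \<times> {0<..}. mean_oscillation G f (ball c r \<inter> G))"

definition bmo :: "'a::euclidean_space set \<Rightarrow> ('a \<Rightarrow> ereal) set" where
  "bmo G = {f. locally_integrable G f \<and> bmo_norm G f < \<infinity>}"

subsection \<open>Polynomials in several complex variables\<close>

text \<open>A polynomial in the variables \<open>z $ i\<close> is a finitely supported family of coefficients
  indexed by multi-indices.\<close>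

type_synonym 'n cpoly = "('n \<Rightarrow>\<^sub>0 nat) \<Rightarrow>\<^sub>0 complex"

definition poly_eval :: "('n::finite) cpoly \<Rightarrow> complex ^ 'n \<Rightarrow> complex" where
  "poly_eval P z =
     (\<Sum>\<alpha>\<in>Poly_Mapping.keys P.
        Poly_Mapping.lookup P \<alpha> * (\<Prod>i\<in>UNIV. (z $ i) ^ Poly_Mapping.lookup \<alpha> i))"

definition total_degree :: "('n::finite) cpoly \<Rightarrow> nat" where
  "total_degree P =
     Max (insert 0 ((\<lambda>\<alpha>. \<Sum>i\<in>UNIV. Poly_Mapping.lookup \<alpha> i) ` Poly_Mapping.keys P))"

definition log_abs_poly :: "('n::finite) cpoly \<Rightarrow> complex ^ 'n \<Rightarrow> ereal" where
  "log_abs_poly P z =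
     (if poly_eval P z = 0 then -\<infinity> else ereal (ln (norm (poly_eval P z))))"

subsection \<open>The constants\<close>

definition c_const :: "nat \<Rightarrow> real" where
  "c_const n = 4 ^ n * (fact n)\<^sup>2 / fact (2 * n - 1)"

text \<open>Meaningful for \<open>m \<le> n\<close> and \<open>n \<ge> 1\<close>.\<close>

definition sigma :: "nat \<Rightarrow> nat \<Rightarrow> real" where
  "sigma n m =
     (if m = n then ln (1 + c_const n) + c_const n / 2
      else 2 * ln (1 + 8 * real (n + m)) + 8 * real (n + m))"

end

(*
  Let B be a ball of radius r in G and x0 a maximum point of u on its closure, M = u x0. On a line
  through x0 (a real line, or a complex line if G is everything) the set K of points of modulus at
  most R where u < M - s is small: compare u with the logarithmic potential h of the uniform measure
  on K. Away from K the function h is harmonic, at infinity it grows like the logarithm, and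
  h >= ln rho - 1/k everywhere, where k is the dimension of the line and rho the radius of the ball
  of the same volume as K. The maximum principle for u - h then gives
  M <= (M - s) + h(x0) - (ln rho - 1/k), where h(x0) <= ln R, so the relative size of K is at most
  exp (1 - k s). Integrating in polar coordinates around x0 over the ball of radius 2 r, which
  contains B, and then over s, bounds the mean of M - u over B, and the mean oscillation is at most
  twice that mean. Here k = 1 suffices for a general G, while k = 2 is available for the whole space.
  The estimate is invariant under u -> u + c and scales with the growth rate of u, so that it applies
  to log |P| with d = deg P.
*)

theory Submission
  imports Defs
    "HOL-Complex_Analysis.Cauchy_Integral_Formula"
    "HOL-Real_Asymp.Real_Asymp"
    "HOL-Computational_Algebra.Fundamental_Theorem_Algebra"
begin

subsection \<open>Integration and upper semicontinuity\<close>

text \<open>Over a ball of radius rho in dimension k the mean of ln (rho / |w|) is 1/k, and no set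
  of the same volume has a larger mean. This is the source of 1/k in the bound for h, and of the
  factor e in the estimate of K. Genericity makes M finite: if u were -infinity on a ball of G, it
  would be so on every complex line whose real points lie in G, and these lines fill the space. The
  case m = n calls for k = 2. For n = 1, complex lines give 2 + ln 4, just below sigma_{1,1} = 2 +
  ln 5, while real lines would give 2 (2 + ln 8). The price is that multiplication by a complex
  scalar zeta must be known to scale the measure by |zeta|^N. Coordinates in an arbitrary
  orthonormal basis do not show this, hence the detour through the uniqueness of translation
  invariant measures.\<close>

lemma emeasure_lborel_atLeast: "emeasure lborel {a::real..} = \<infinity>"
proof (rule ccontr)
  assume "\<not> ?thesis"
  then obtain c where c: "emeasure lborel {a..} = ennreal c" "0 \<le> c"
    by (cases "emeasure lborel {a..}") auto
  have "ennreal (c + 1) = emeasure lborel {a..a + (c + 1)}" using c by simp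
  also have "\<dots> \<le> ennreal c" unfolding c(1)[symmetric] by (intro emeasure_mono) auto
  finally show False using c(2) by (simp add: ennreal_le_iff)
qed

text \<open>Tonelli for the region under the graph. Points where \<open>f\<close> is infinite lie in
  every superlevel set and so are counted; negative values contribute nothing because the levels
  start at 0.\<close>

lemma nn_integral_layer_cake:
  fixes f :: "'a \<Rightarrow> ereal"
  assumes "sigma_finite_measure M" and [measurable]: "f \<in> borel_measurable M"
  shows "(\<integral>\<^sup>+x. e2ennreal (f x) \<partial>M) =
    (\<integral>\<^sup>+s. indicator {0..} s * emeasure M {x\<in>space M. ereal s < f x} \<partial>lborel)"
proof -
  interpret sigma_finite_measure M by fact
  interpret pair_sigma_finite M "lborel :: real measure" ..
  have *: "e2ennreal y = (\<integral>\<^sup>+s. indicator {s. 0 \<le> s \<and> ereal s < y} s \<partial>lborel)" for y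
  proof (cases y)
    case (real r)
    then have "{s. 0 \<le> s \<and> ereal s < y} = {0..<r}" by auto
    then show ?thesis using real
      by (cases "0 \<le> r") (auto simp: e2ennreal_neg ennreal_neg)
  next
    case PInf
    then have "{s. 0 \<le> s \<and> ereal s < y} = {0..}" by auto
    then show ?thesis using PInf by (simp add: emeasure_lborel_atLeast)
  qed (auto simp: e2ennreal_neg)
  have "(\<integral>\<^sup>+x. e2ennreal (f x) \<partial>M) = (\<integral>\<^sup>+x. (\<integral>\<^sup>+s. indicator {s. 0 \<le> s \<and> ereal s < f x} s \<partial>lborel) \<partial>M)"
    using * by simp
  also have "\<dots> = (\<integral>\<^sup>+s. (\<integral>\<^sup>+x. indicator {s. 0 \<le> s \<and> ereal s < f x} s \<partial>M) \<partial>lborel)"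
    by (rule Fubini'[symmetric]) (simp add: indicator_def)
  also have "\<dots> = (\<integral>\<^sup>+s. indicator {0..} s * emeasure M {x\<in>space M. ereal s < f x} \<partial>lborel)"
  proof (rule nn_integral_cong)
    fix s :: real
    have "(\<integral>\<^sup>+x. indicator {s. 0 \<le> s \<and> ereal s < f x} s \<partial>M)
        = (\<integral>\<^sup>+x. indicator {0..} s * indicator {x\<in>space M. ereal s < f x} x \<partial>M)"
      by (rule nn_integral_cong) (auto simp: indicator_def)
    also have "\<dots> = indicator {0..} s * emeasure M {x\<in>space M. ereal s < f x}"
      by (subst nn_integral_cmult) auto
    finally show "(\<integral>\<^sup>+x. indicator {s. 0 \<le> s \<and> ereal s < f x} s \<partial>M) = indicator {0..} s * emeasure M {x\<in>space M. ereal s < f x}" .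
  qed
  finally show ?thesis .
qed

text \<open>Without a maximum, the sets where \<open>f\<close> is below one of its own values would
  cover \<open>X\<close>; a finite subcover fails at the largest of the finitely many values.
  Openness is relative to \<open>X\<close> because the difference with a potential is semicontinuous
  only off a compact set.\<close>

lemma compact_attains_usc:
  fixes f :: "'a::topological_space \<Rightarrow> 'b::linorder"
  assumes "compact X" "X \<noteq> {}"
    and usc: "\<And>a. \<exists>U. open U \<and> {x\<in>X. f x < a} = X \<inter> U"
  shows "\<exists>x\<in>X. \<forall>y\<in>X. f y \<le> f x"
proof (rule ccontr)
  assume "\<not> ?thesis"
  then have nm: "\<And>x. x \<in> X \<Longrightarrow> \<exists>y\<in>X. f x < f y" by (meson not_le)
  obtain U where U: "\<And>a. open (U a)" "\<And>a. {x\<in>X. f x < a} = X \<inter> U a" using usc by metis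
  have "X \<subseteq> (\<Union>y\<in>X. U (f y))" using nm U(2) by blast
  then obtain F where F: "F \<subseteq> X" "finite F" "X \<subseteq> (\<Union>y\<in>F. U (f y))"
    using compactE_image[OF \<open>compact X\<close>, of X "\<lambda>y. U (f y)"] U(1) by metis
  have "F \<noteq> {}" using F(3) \<open>X \<noteq> {}\<close> by auto
  then have "Max (f ` F) \<in> f ` F" using F(2) by (intro Max_in) auto
  then obtain z where z: "z \<in> F" "f z = Max (f ` F)" by auto
  then obtain y where "y \<in> F" "z \<in> U (f y)" using F by blast
  then have "f z < f y" using U(2) z(1) F(1) by blast
  then show False using z(2) F(2) \<open>y \<in> F\<close> by (metis Max_ge finite_imageI image_eqI not_le)
qed

lemma usc_borel_measurable:
  assumes "usc f" shows "f \<in> borel_measurable borel"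
  by (rule borel_measurableI_less) (use assms in \<open>auto simp: usc_def\<close>)

lemma usc_compose:
  assumes "usc u" "continuous_on UNIV g"
  shows "usc (\<lambda>x. u (g x))"
  unfolding usc_def
proof
  fix a
  have "open (g -` {x. u x < a})"
    using assms by (intro open_vimage) (auto simp: usc_def)
  then show "open {x. u (g x) < a}" by (simp add: vimage_def)
qed

text \<open>For finite \<open>a\<close>, the inequality \<open>v x < a + p x\<close> holds iff some
  real \<open>q\<close> fits in between, which splits it into two open conditions, one on
  \<open>v\<close> and one on \<open>p\<close>.\<close>

lemma usc_minus_continuous:
  fixes p :: "'a::topological_space \<Rightarrow> real"
  assumes "usc v" "continuous_on W p" "open W"
  shows "open {x\<in>W. v x - ereal (p x) < a}"
proof -
  have eq: "{x\<in>W. v x - ereal (p x) < a} = (\<Union>q. {x. v x < ereal q} \<inter> {x\<in>W. ereal q - a < ereal (p x)})"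
    if "a \<noteq> \<infinity>" "a \<noteq> -\<infinity>"
  proof (intro equalityI subsetI)
    fix x assume "x \<in> {x\<in>W. v x - ereal (p x) < a}"
    then have "v x < a + ereal (p x)" "x \<in> W" using that by (cases a; cases "v x"; auto)+
    then obtain q where "v x < ereal q" "ereal q < a + ereal (p x)"
      using ereal_dense2 by blast
    then show "x \<in> (\<Union>q. {x. v x < ereal q} \<inter> {x\<in>W. ereal q - a < ereal (p x)})"
      using \<open>x \<in> W\<close> that by (cases a) auto
  next
    fix x assume "x \<in> (\<Union>q. {x. v x < ereal q} \<inter> {x\<in>W. ereal q - a < ereal (p x)})"
    then obtain q where "v x < ereal q" "ereal q - a < ereal (p x)" "x \<in> W" by auto
    then show "x \<in> {x\<in>W. v x - ereal (p x) < a}"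
      using that by (cases a; cases "v x"; auto)
  qed
  consider "a = \<infinity>" | "a = -\<infinity>" | "a \<noteq> \<infinity>" "a \<noteq> -\<infinity>" by blast
  then show ?thesis
  proof cases
    case 1
    have "v x - ereal (p x) < \<infinity> \<longleftrightarrow> v x < \<infinity>" for x by (cases "v x") auto
    then have "{x\<in>W. v x - ereal (p x) < a} = W \<inter> {x. v x < \<infinity>}" using 1 by auto
    moreover have "open {x. v x < \<infinity>}" using assms(1) unfolding usc_def by blast
    ultimately show ?thesis using assms(3) by (simp only: open_Int)
  next
    case 3
    obtain b where b: "a = ereal b" using 3 by (cases a) auto
    have "open {x\<in>W. ereal q - a < ereal (p x)}" for q
    proof -
      have "{x\<in>W. ereal q - a < ereal (p x)} = W \<inter> p -` {q - b<..}" using b by auto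
      then show ?thesis using continuous_open_preimage[OF assms(2,3), of "{q - b<..}"] by simp
    qed
    then show ?thesis unfolding eq[OF 3]
      using assms(1) by (intro open_UN open_Int ballI) (auto simp: usc_def)
  qed auto
qed

section \<open>The uniform measure on the circle and extended integrals\<close>

definition circ :: "real measure" where "circ = uniform_measure lborel {0..2*pi}"

lemma sets_circ [measurable_cong, simp]: "sets circ = sets borel" "space circ = UNIV"
  by (auto simp: circ_def)

lemma emeasure_circ: "emeasure circ UNIV = 1"
  unfolding circ_def by (simp add: divide_ennreal)

lemma finite_measure_circ: "finite_measure circ"
  by (rule finite_measureI) (simp add: emeasure_circ)

lemma ereal_integral_mono:
  assumes "\<And>x. x \<in> space M \<Longrightarrow> f x \<le> g x"
  shows "ereal_integral M f \<le> ereal_integral M g"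
  unfolding ereal_integral_def
  using assms
  by (intro ereal_minus_mono) (auto intro!: nn_integral_mono e2ennreal_mono simp: less_eq_ennreal.rep_eq[symmetric])

lemma ereal_integral_real:
  assumes "integrable M f"
  shows "ereal_integral M (\<lambda>x. ereal (f x)) = ereal (integral\<^sup>L M f)"
proof -
  have fin: "(\<integral>\<^sup>+x. ennreal (f x) \<partial>M) \<noteq> \<infinity>" "(\<integral>\<^sup>+x. ennreal (- f x) \<partial>M) \<noteq> \<infinity>"
    using assms real_integrable_def by blast+
  have e: "enn2ereal x = ereal (enn2real x)" if "x \<noteq> \<infinity>" for x
    using that by (cases x) (auto simp: enn2ereal_ennreal)
  show ?thesis
    using fin by (simp add: ereal_integral_def e real_lebesgue_integral_def[OF assms])
qed

lemma circle_mean_circ: "circle_mean v a r = ereal_integral circ (\<lambda>t. v (a + of_real r * cis t))"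
  by (simp add: circle_mean_def circ_def)

subsection \<open>Circle means\<close>

lemma circ_density: "circ = density lborel (\<lambda>x. ennreal (indicator {0..2*pi} x / (2*pi)))"
  unfolding circ_def uniform_measure_def
proof (rule arg_cong[where f = "density lborel"], rule ext)
  fix x :: real
  show "indicator {0..2*pi} x / emeasure lborel {0..2*pi} = ennreal (indicator {0..2*pi} x / (2*pi))"
    by (auto simp: indicator_def divide_ennreal ennreal_1[symmetric] simp del: ennreal_1)
qed

lemma integrable_circ:
  fixes f :: "real \<Rightarrow> real"
  assumes "continuous_on UNIV f"
  shows "integrable circ f"
proof -
  have "integrable lborel (\<lambda>x. indicator {0..2*pi} x *\<^sub>R f x)"
    using borel_integrable_compact[of "{0..2*pi}" f] continuous_on_subset[OF assms] by auto
  then have "integrable lborel (\<lambda>x. (1/(2*pi)) *\<^sub>R (indicator {0..2*pi} x *\<^sub>R f x))"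
    by (rule integrable_scaleR_right)
  moreover have "f \<in> borel_measurable borel" using assms by (rule borel_measurable_continuous_onI)
  ultimately show ?thesis unfolding circ_density
    by (subst integrable_density) (auto simp: mult_ac)
qed

text \<open>The parameter interval \<open>{0..1}\<close> is that of \<open>circlepath\<close>, so
  that Cauchy's formula can be read as a statement about circle means.\<close>

lemma integral_circ:
  fixes f :: "real \<Rightarrow> real"
  assumes "continuous_on UNIV f"
  shows "integral\<^sup>L circ f = integral {0..1} (\<lambda>x. f (2*pi*x))"
proof -
  have [measurable]: "f \<in> borel_measurable borel" using assms by (rule borel_measurable_continuous_onI)
  have "integral\<^sup>L circ f = (\<integral>x. indicator {0..2*pi} x / (2*pi) * f x \<partial>lborel)"
    unfolding circ_density by (subst integral_density) auto
  also have "\<dots> = \<bar>2*pi\<bar> *\<^sub>R (\<integral>x. indicator {0..2*pi} (0 + (2*pi) * x) / (2*pi) * f (0 + (2*pi) * x) \<partial>lborel)"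
    by (rule lborel_integral_real_affine) auto
  also have "\<dots> = (\<integral>x. (2*pi) * (indicator {0..2*pi} (0 + (2*pi) * x) / (2*pi) * f (0 + (2*pi) * x)) \<partial>lborel)"
    by simp
  also have "\<dots> = (LINT x:{0..1}|lborel. f (2*pi*x))"
    unfolding set_lebesgue_integral_def
  proof (rule Bochner_Integration.integral_cong[OF refl])
    fix x :: real
    have "2*pi*x \<le> 2*pi \<longleftrightarrow> x \<le> 1" by (simp add: mult_le_cancel_left1)
    then show "(2*pi) * (indicator {0..2*pi} (0 + (2*pi) * x) / (2*pi) * f (0 + (2*pi) * x)) = indicator {0..1} x *\<^sub>R f (2*pi*x)"
      using pi_gt_zero by (auto simp: indicator_def zero_le_mult_iff not_le[symmetric] simp del: pi_gt_zero)
  qed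
  also have "\<dots> = integral {0..1} (\<lambda>x. f (2*pi*x))"
  proof (rule set_borel_integral_eq_integral)
    show "set_integrable lborel {0..1} (\<lambda>x. f (2*pi*x))"
      unfolding set_integrable_def
      by (intro borel_integrable_compact continuous_on_compose2[OF assms] continuous_intros) auto
  qed
  finally show ?thesis .
qed

lemma continuous_on_log_circle:
  assumes "norm C < norm (A::complex)"
  shows "continuous_on UNIV (\<lambda>t. ln (norm (A + C * cis t)))"
proof -
  have "A + C * cis t \<noteq> 0" for t
  proof
    assume "A + C * cis t = 0"
    then have "norm A = norm (C * cis t)" by (metis add_eq_0_iff norm_minus_cancel)
    then show False using assms by (simp add: norm_mult)
  qed
  then show ?thesis by (intro continuous_intros) auto
qed

text \<open>Mean value property at the centre of the unit disc for the real part of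
  \<open>Ln (1 + C / A * u)\<close>, which is holomorphic there because \<open>C\<close> is smaller
  than \<open>A\<close>; adding \<open>ln (norm A)\<close> gives the claim.\<close>

lemma log_circle_mean:
  assumes "norm C < norm (A::complex)"
  shows "integral\<^sup>L circ (\<lambda>t. ln (norm (A + C * cis t))) = ln (norm A)"
proof -
  have A: "A \<noteq> 0" using assms by auto
  define f where "f u = Ln (1 + C / A * u)" for u
  \<comment> \<open>Here \<open>C / A * u\<close> has modulus below 1, so the real part is positive
    and the branch cut of \<open>Ln\<close> is avoided.\<close>
  have *: "1 + C / A * u \<notin> \<real>\<^sub>\<le>\<^sub>0" if "norm u \<le> 1" for u
  proof -
    have "norm (C / A * u) \<le> norm (C / A)" using that
      by (metis mult_cancel_left1 mult_left_mono norm_ge_zero norm_mult mult.right_neutral)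
    also have "\<dots> < 1" using assms A by (simp add: norm_divide)
    finally have "\<bar>Re (C / A * u)\<bar> < 1" using abs_Re_le_cmod le_less_trans by blast
    then have "0 < Re (1 + C / A * u)" by (simp del: times_complex.simps)
    then show ?thesis by (auto simp: complex_nonpos_Reals_iff simp del: times_complex.simps)
  qed
  \<comment> \<open>Cauchy's formula at the centre; since \<open>f 0 = Ln 1 = 0\<close>, the mean of
    \<open>f\<close> vanishes.\<close>
  have "((\<lambda>u. f u/(u-0)) has_contour_integral (2 * of_real pi * \<i> * f 0)) (circlepath 0 1)"
  proof (rule Cauchy_integral_circlepath)
    show "continuous_on (cball 0 1) f" unfolding f_def using * by (intro continuous_intros) auto
    show "f holomorphic_on ball 0 1" unfolding f_def using * by (intro holomorphic_intros) auto
  qed auto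
  then have "((\<lambda>x. f (circlepath 0 1 x) / circlepath 0 1 x * vector_derivative (circlepath 0 1) (at x within {0..1}))
      has_integral 2 * of_real pi * \<i> * f 0) {0..1}"
    by (simp add: has_contour_integral_def)
  then have "((\<lambda>x. f (cis (2*pi*x)) * (2 * of_real pi * \<i>)) has_integral 2 * of_real pi * \<i> * f 0) {0..1}"
  proof (rule has_integral_eq[rotated])
    fix x :: real assume x: "x \<in> {0..1}"
    have "circlepath 0 1 x = cis (2*pi*x)" by (simp add: circlepath cis_conv_exp mult_ac)
    moreover have "vector_derivative (circlepath 0 1) (at x within {0..1}) = 2 * of_real pi * \<i> * cis (2*pi*x)"
      using x by (subst vector_derivative_circlepath01) (auto simp: cis_conv_exp mult_ac)
    ultimately show "f (circlepath 0 1 x) / circlepath 0 1 x * vector_derivative (circlepath 0 1) (at x within {0..1})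
        = f (cis (2*pi*x)) * (2 * of_real pi * \<i>)" by simp
  qed
  then have "((\<lambda>x. f (cis (2*pi*x)) * (2 * of_real pi * \<i>) * (1 / (2 * of_real pi * \<i>))) has_integral 2 * of_real pi * \<i> * f 0 * (1 / (2 * of_real pi * \<i>))) {0..1}"
    by (rule has_integral_mult_left)
  then have "((\<lambda>x. f (cis (2*pi*x))) has_integral 0) {0..1}"
    by (simp add: f_def)
  then have "((\<lambda>x. Re (f (cis (2*pi*x)))) has_integral Re 0) {0..1}"
    by (rule has_integral_Re)
  then have "((\<lambda>x. Re (f (cis (2*pi*x))) + ln (norm A)) has_integral Re 0 + ln (norm A)) {0..1}"
    by (intro has_integral_add) (use has_integral_const_real[of "ln (norm A)" 0 1] in simp_all)
  then have "((\<lambda>x. Re (f (cis (2*pi*x))) + ln (norm A)) has_integral ln (norm A)) {0..1}"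
    by simp
  then have **: "((\<lambda>x. ln (norm (A + C * cis (2*pi*x)))) has_integral ln (norm A)) {0..1}"
  proof (rule has_integral_eq[rotated])
    fix x :: real
    have ne: "1 + C / A * cis (2*pi*x) \<noteq> 0" using *[of "cis (2*pi*x)"] by auto
    have "Re (f (cis (2*pi*x))) + ln (norm A) = ln (norm (1 + C / A * cis (2*pi*x))) + ln (norm A)"
      using ne by (simp add: f_def)
    also have "\<dots> = ln (norm (A * (1 + C / A * cis (2*pi*x))))"
      using ne A by (simp add: norm_mult ln_mult)
    also have "A * (1 + C / A * cis (2*pi*x)) = A + C * cis (2*pi*x)" using A by (simp add: field_simps)
    finally show "Re (f (cis (2*pi*x))) + ln (norm A) = ln (norm (A + C * cis (2*pi*x)))" .
  qed
  show ?thesis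
    unfolding integral_circ[OF continuous_on_log_circle[OF assms]] using ** by (rule integral_unique)
qed

lemma cos_sin_circle_mean: "integral\<^sup>L circ cos = 0" "integral\<^sup>L circ sin = 0"
proof -
  have "((\<lambda>x. cos (2*pi*x)) has_integral sin (2*pi*1) / (2*pi) - sin (2*pi*0) / (2*pi)) {0..1}"
    by (rule fundamental_theorem_of_calculus)
       (auto intro!: derivative_eq_intros simp flip: has_real_derivative_iff_has_vector_derivative)
  then show "integral\<^sup>L circ cos = 0"
    by (subst integral_circ) (auto intro!: continuous_intros integral_unique)
  have "((\<lambda>x. sin (2*pi*x)) has_integral - cos (2*pi*1) / (2*pi) - (- cos (2*pi*0) / (2*pi))) {0..1}"
    by (rule fundamental_theorem_of_calculus)
       (auto intro!: derivative_eq_intros simp flip: has_real_derivative_iff_has_vector_derivative)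
  then show "integral\<^sup>L circ sin = 0"
    by (subst integral_circ) (auto intro!: continuous_intros integral_unique)
qed

text \<open>The surplus \<open>r\<^sup>2\<close> over the value at the centre is what contradicts an
  interior maximum in the maximum principle below.\<close>

lemma norm_sq_circle_mean:
  "integral\<^sup>L circ (\<lambda>t. (norm (z + of_real r * cis t))\<^sup>2) = (norm z)\<^sup>2 + r\<^sup>2"
proof -
  interpret finite_measure circ by (rule finite_measure_circ)
  have "(norm (z + of_real r * cis t))\<^sup>2 = ((norm z)\<^sup>2 + r\<^sup>2) + (2 * r * Re z * cos t + 2 * r * Im z * sin t)" for t
  proof -
    have "(norm (z + of_real r * cis t))\<^sup>2 = (Re z + r * cos t)\<^sup>2 + (Im z + r * sin t)\<^sup>2"
      by (simp add: cmod_power2)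
    also have "\<dots> = (Re z)\<^sup>2 + (Im z)\<^sup>2 + r\<^sup>2 * ((sin t)\<^sup>2 + (cos t)\<^sup>2) + (2 * r * Re z * cos t + 2 * r * Im z * sin t)"
      by (simp add: power2_eq_square algebra_simps del: sin_cos_squared_add sin_cos_squared_add2 sin_cos_squared_add3)
    finally show ?thesis by (simp add: cmod_power2)
  qed
  moreover have "integrable circ cos" "integrable circ sin"
    by (auto intro!: integrable_circ continuous_intros)
  ultimately show ?thesis
    using emeasure_circ by (simp add: cos_sin_circle_mean measure_def)
qed

lemma nn_integral_exp_atLeast:
  assumes "0 < b"
  shows "(\<integral>\<^sup>+s. indicator {a..} s * ennreal (exp (- (b * s))) \<partial>lborel) = ennreal (exp (- (b * a)) / b)"
proof -
  have "((\<lambda>s. exp (- (b * s))) \<longlongrightarrow> 0) at_top"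
    using assms by real_asymp
  then have "((\<lambda>s. - exp (- (b * s)) / b) \<longlongrightarrow> - 0 / b) at_top"
    by (intro tendsto_intros) (use assms in auto)
  then have "(\<integral>\<^sup>+s. ennreal (exp (- (b * s))) * indicator {a..} s \<partial>lborel) = ennreal (0 - (- exp (- (b * a)) / b))"
    using assms by (intro nn_integral_FTC_atLeast) (auto intro!: derivative_eq_intros)
  then show ?thesis by (simp add: mult.commute)
qed

subsection \<open>Logarithmic potentials and the maximum principle\<close>

lemma abs_ln_diff_le:
  assumes "0 < m" "m \<le> x" "m \<le> (y::real)"
  shows "\<bar>ln x - ln y\<bar> \<le> \<bar>x - y\<bar> / m"
proof -
  have *: "ln a - ln b \<le> (a - b) / m" if "m \<le> b" "b \<le> a" for a b :: real
  proof -
    have "ln a - ln b \<le> (a - b) / b" using that assms(1) by (intro ln_diff_le) auto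
    also have "\<dots> \<le> (a - b) / m" using that assms(1) by (intro divide_left_mono) auto
    finally show ?thesis .
  qed
  show ?thesis
  proof (cases "y \<le> x")
    case True
    then have "ln y \<le> ln x" using assms by simp
    with *[of y x] True assms show ?thesis by simp
  next
    case False
    then have "ln x \<le> ln y" using assms by simp
    with *[of x y] False assms show ?thesis by simp
  qed
qed

text \<open>Treats a real line in the plane and the plane itself at once, with
  \<open>DIM('k)\<close> equal to 1 or 2. The assumption \<open>proj\<close> is a weak orthogonal
  projection: an arbitrary point of the plane can be replaced by a point of the line without
  increasing any distance to points of the line.\<close>

locale isometric_line =
  fixes \<iota> :: "'k::euclidean_space \<Rightarrow> complex"
  assumes isometry: "norm (\<iota> x - \<iota> y) = norm (x - y)"
    and proj: "\<exists>x. \<forall>w. norm (x - w) \<le> norm (z - \<iota> w)"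
begin

lemma continuous_on_embedding: "continuous_on A \<iota>"
proof -
  have "1-lipschitz_on UNIV \<iota>" by (rule lipschitz_onI) (auto simp: dist_norm isometry)
  then show ?thesis using lipschitz_on_continuous_on continuous_on_subset by blast
qed

lemma embedding_measurable [measurable]: "\<iota> \<in> borel_measurable borel"
  using continuous_on_embedding by (rule borel_measurable_continuous_onI)

text \<open>Evaluated only off the image of \<open>K\<close>, where the logarithm is continuous on
  \<open>K\<close> and the integral exists.\<close>

definition potential :: "'k set \<Rightarrow> complex \<Rightarrow> real" where
  "potential K z = (\<integral>w. indicator K w *\<^sub>R ln (norm (z - \<iota> w)) \<partial>lborel) / measure lborel K"

lemma closed_image: "compact K \<Longrightarrow> closed (\<iota> ` K)"
  using compact_continuous_image[OF continuous_on_embedding] compact_imp_closed by blast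

lemma integrable_potential:
  assumes "compact K" "z \<notin> \<iota> ` K"
  shows "integrable lborel (\<lambda>w. indicator K w *\<^sub>R ln (norm (z - \<iota> w)))"
  using assms by (intro borel_integrable_compact continuous_intros continuous_on_embedding) auto

lemma integrable_indicator_compact: "compact K \<Longrightarrow> integrable lborel (\<lambda>w. indicator K (w::'k) *\<^sub>R (c::real))"
  using borel_integrable_compact[of K "\<lambda>_. c"] by (simp only: continuous_on_const)

lemma integral_indicator_compact: "compact K \<Longrightarrow> (\<integral>w. indicator K (w::'k) *\<^sub>R (c::real) \<partial>lborel) = measure lborel K * c"
  using integrable_indicator_compact[of K 1]
  by (subst integral_scaleR_left) (auto simp: borel_compact)

lemma potential_le:
  assumes K: "compact K" "z \<notin> \<iota> ` K" "0 < measure lborel K"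
    and "\<And>w. w \<in> K \<Longrightarrow> norm (z - \<iota> w) \<le> R"
  shows "potential K z \<le> ln R"
proof -
  have "(\<integral>w. indicator K w *\<^sub>R ln (norm (z - \<iota> w)) \<partial>lborel) \<le> (\<integral>w. indicator K w *\<^sub>R ln R \<partial>lborel)"
  proof (intro integral_mono integrable_potential integrable_indicator_compact K)
    fix w
    show "indicator K w *\<^sub>R ln (norm (z - \<iota> w)) \<le> indicator K w *\<^sub>R ln R"
    proof (cases "w \<in> K")
      case True
      then have "0 < norm (z - \<iota> w)" using K by auto
      then show ?thesis using assms(4)[OF True] True by (simp add: ln_mono)
    qed simp
  qed
  also have "\<dots> = measure lborel K * ln R" by (rule integral_indicator_compact[OF K(1)])
  finally show ?thesis using K(3) by (simp add: potential_def divide_le_eq mult.commute)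
qed

lemma potential_ge_far:
  assumes K: "compact K" "0 < measure lborel K"
    and "0 < R" "\<And>w. w \<in> K \<Longrightarrow> R \<le> norm (z - \<iota> w)"
  shows "ln R \<le> potential K z"
proof -
  have z: "z \<notin> \<iota> ` K" using assms(3,4) by force
  have "measure lborel K * ln R = (\<integral>w. indicator K w *\<^sub>R ln R \<partial>lborel)" by (rule integral_indicator_compact[OF K(1), symmetric])
  also have "(\<integral>w. indicator K w *\<^sub>R ln R \<partial>lborel) \<le> (\<integral>w. indicator K w *\<^sub>R ln (norm (z - \<iota> w)) \<partial>lborel)"
  proof (intro integral_mono integrable_potential integrable_indicator_compact K z)
    fix w
    show "indicator K w *\<^sub>R ln R \<le> indicator K w *\<^sub>R ln (norm (z - \<iota> w))"
      using assms(3) assms(4)[of w] by (cases "w \<in> K") (auto intro: ln_mono)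
  qed
  finally show ?thesis using K(2) by (simp add: potential_def le_divide_eq mult.commute)
qed

text \<open>Bathtub argument. Where \<open>ln \<rho> - ln (norm (z - \<iota> w))\<close> exceeds
  \<open>s \<ge> 0\<close>, the point \<open>w\<close> lies in a ball of radius
  \<open>\<rho> * exp (- s)\<close>, whose volume is that of \<open>K\<close> times
  \<open>exp (- k * s)\<close>; integrating over \<open>s\<close> gives the volume of
  \<open>K\<close> divided by \<open>k\<close>.\<close>

lemma potential_ge:
  assumes K: "compact K" "z \<notin> \<iota> ` K" and \<rho>: "0 < \<rho>"
    and vol: "measure lborel K = unit_ball_vol (real DIM('k)) * \<rho> ^ DIM('k)"
  shows "ln \<rho> - 1 / real DIM('k) \<le> potential K z"
proof -
  define k where "k = DIM('k)"
  have k: "0 < k" by (simp add: k_def)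
  define g where "g w = indicator K w *\<^sub>R ln \<rho> - indicator K w *\<^sub>R ln (norm (z - \<iota> w))" for w
  have gint: "integrable lborel g"
    unfolding g_def by (intro Bochner_Integration.integrable_diff integrable_potential integrable_indicator_compact K)
  have mK: "0 < measure lborel K" using \<rho> by (simp add: vol)
  \<comment> \<open>Moves the centre of that ball into \<open>'k\<close>, where its volume is
    known.\<close>
  obtain x where x: "\<And>w. norm (x - w) \<le> norm (z - \<iota> w)" using proj by blast
  have sub: "{w \<in> space lborel. ereal s < ereal (g w)} \<subseteq> cball x (\<rho> * exp (- s))" if "0 \<le> s" for s
  proof
    fix w assume "w \<in> {w \<in> space lborel. ereal s < ereal (g w)}"
    then have s: "s < g w" by simp
    have w: "w \<in> K"
    proof (rule ccontr)
      assume "w \<notin> K"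
      then show False using s that by (simp add: g_def)
    qed
    then have pos: "0 < norm (z - \<iota> w)" using K by auto
    have "ln (norm (z - \<iota> w)) < ln \<rho> - s" using s w by (simp add: g_def)
    then have "norm (z - \<iota> w) < exp (ln \<rho> - s)" using pos by (metis exp_less_cancel_iff exp_ln)
    also have "\<dots> = \<rho> * exp (- s)" using \<rho> by (simp add: exp_diff exp_minus field_simps)
    finally show "w \<in> cball x (\<rho> * exp (- s))" using x[of w] by (simp add: dist_norm)
  qed
  have "(\<integral>\<^sup>+w. ennreal (g w) \<partial>lborel) = (\<integral>\<^sup>+w. e2ennreal (ereal (g w)) \<partial>lborel)" by simp
  also have "\<dots> = (\<integral>\<^sup>+s. indicator {0..} s * emeasure lborel {w \<in> space lborel. ereal s < ereal (g w)} \<partial>lborel)"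
    using gint by (intro nn_integral_layer_cake sigma_finite_lborel) auto
  also have "\<dots> \<le> (\<integral>\<^sup>+s. ennreal (measure lborel K) * (indicator {0..} s * ennreal (exp (- (real k * s)))) \<partial>lborel)"
  proof (rule nn_integral_mono)
    fix s :: real
    show "indicator {0..} s * emeasure lborel {w \<in> space lborel. ereal s < ereal (g w)}
      \<le> ennreal (measure lborel K) * (indicator {0..} s * ennreal (exp (- (real k * s))))"
    proof (cases "0 \<le> s")
      case True
      have "emeasure lborel {w \<in> space lborel. ereal s < ereal (g w)} \<le> emeasure lborel (cball x (\<rho> * exp (- s)))"
        using sub[OF True] by (intro emeasure_mono) auto
      also have "\<dots> = ennreal (unit_ball_vol (real k) * (\<rho> * exp (- s)) ^ k)"
        using \<rho> by (simp add: emeasure_cball k_def)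
      also have "(\<rho> * exp (- s)) ^ k = \<rho> ^ k * exp (- (real k * s))"
        by (simp add: power_mult_distrib exp_of_nat_mult[symmetric])
      also have "ennreal (unit_ball_vol (real k) * (\<rho> ^ k * exp (- (real k * s)))) = ennreal (measure lborel K) * ennreal (exp (- (real k * s)))"
        by (simp add: vol k_def ennreal_mult''[symmetric] mult.assoc)
      finally show ?thesis using True by simp
    qed simp
  qed
  also have "\<dots> = ennreal (measure lborel K) * ennreal (exp (- (real k * 0)) / real k)"
    using k by (subst nn_integral_cmult) (simp_all add: nn_integral_exp_atLeast del: mult_zero_right)
  also have "\<dots> = ennreal (measure lborel K / real k)"
    by (simp add: ennreal_mult'[symmetric])
  finally have nn: "(\<integral>\<^sup>+w. ennreal (g w) \<partial>lborel) \<le> ennreal (measure lborel K / real k)" .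
  \<comment> \<open>Only the positive part of \<open>g\<close> has been bounded; dropping the
    negative part can only increase the integral.\<close>
  have "integral\<^sup>L lborel g \<le> enn2real (\<integral>\<^sup>+w. ennreal (g w) \<partial>lborel)"
    by (subst real_lebesgue_integral_def[OF gint]) simp
  also have "\<dots> \<le> measure lborel K / real k"
    using nn by (intro enn2real_leI) auto
  also have "integral\<^sup>L lborel g = measure lborel K * ln \<rho> - measure lborel K * potential K z"
    unfolding g_def using mK
    by (subst Bochner_Integration.integral_diff)
       (auto simp: integrable_potential integrable_indicator_compact K integral_indicator_compact potential_def simp del: scaleR_conv_of_real real_scaleR_def)
  finally have "measure lborel K * (ln \<rho> - 1 / real k) \<le> measure lborel K * potential K z"
    by (simp add: algebra_simps)
  then show ?thesis using mK by (simp add: k_def)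
qed

text \<open>If \<open>z0\<close> has distance at least \<open>e\<close> from the image of
  \<open>K\<close>, all the logarithms under the integral share the bound \<open>2 / e\<close> on
  their rate of change near \<open>z0\<close>, and so does their average.\<close>

lemma continuous_on_potential:
  assumes K: "compact K" "0 < measure lborel K"
  shows "continuous_on (- \<iota> ` K) (potential K)"
proof (rule continuous_at_imp_continuous_on, rule ballI)
  fix z0 assume z0: "z0 \<in> - \<iota> ` K"
  have "open (- \<iota> ` K)" using closed_image[OF K(1)] by auto
  then obtain e where e: "0 < e" "ball z0 e \<subseteq> - \<iota> ` K" using z0 open_contains_ball by blast
  have far: "e \<le> norm (z0 - \<iota> w)" if "w \<in> K" for w
    using e(2) that by (force simp: dist_norm not_le[symmetric])
  have bd: "\<bar>potential K z - potential K z0\<bar> \<le> dist z z0 / (e/2)" if "dist z z0 < e/2" for z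
  proof -
    have far': "e/2 \<le> norm (z - \<iota> w)" if "w \<in> K" for w
      using far[OF that] \<open>dist z z0 < e/2\<close> norm_triangle_ineq2[of "z0 - \<iota> w" "z0 - z"]
      by (simp add: dist_norm norm_minus_commute)
    have z: "z \<notin> \<iota> ` K" using far' e by force
    have "\<bar>(\<integral>w. indicator K w *\<^sub>R ln (norm (z - \<iota> w)) \<partial>lborel) - (\<integral>w. indicator K w *\<^sub>R ln (norm (z0 - \<iota> w)) \<partial>lborel)\<bar>
      = \<bar>\<integral>w. indicator K w *\<^sub>R ln (norm (z - \<iota> w)) - indicator K w *\<^sub>R ln (norm (z0 - \<iota> w)) \<partial>lborel\<bar>"
      using z z0 by (subst Bochner_Integration.integral_diff) (auto intro!: integrable_potential K simp del: real_scaleR_def)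
    also have "\<dots> \<le> (\<integral>w. \<bar>indicator K w *\<^sub>R ln (norm (z - \<iota> w)) - indicator K w *\<^sub>R ln (norm (z0 - \<iota> w))\<bar> \<partial>lborel)"
      by (rule integral_abs_bound)
    also have "\<dots> \<le> (\<integral>w. indicator K w *\<^sub>R (dist z z0 / (e/2)) \<partial>lborel)"
    proof (intro integral_mono integrable_abs Bochner_Integration.integrable_diff integrable_potential integrable_indicator_compact K z)
      show "z0 \<notin> \<iota> ` K" using z0 by auto
      fix w
      have "\<bar>ln (norm (z - \<iota> w)) - ln (norm (z0 - \<iota> w))\<bar> \<le> dist z z0 / (e/2)" if "w \<in> K"
      proof -
        have "\<bar>ln (norm (z - \<iota> w)) - ln (norm (z0 - \<iota> w))\<bar> \<le> \<bar>norm (z - \<iota> w) - norm (z0 - \<iota> w)\<bar> / (e/2)"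
          using far[OF that] far'[OF that] e by (intro abs_ln_diff_le) auto
        also have "\<dots> \<le> dist z z0 / (e/2)"
          using e norm_triangle_ineq3[of "z - \<iota> w" "z0 - \<iota> w"] by (intro divide_right_mono) (auto simp: dist_norm)
        finally show ?thesis .
      qed
      then show "\<bar>indicator K w *\<^sub>R ln (norm (z - \<iota> w)) - indicator K w *\<^sub>R ln (norm (z0 - \<iota> w))\<bar> \<le> indicator K w *\<^sub>R (dist z z0 / (e/2))"
        by (cases "w \<in> K") auto
    qed
    also have "\<dots> = measure lborel K * (dist z z0 / (e/2))" by (rule integral_indicator_compact[OF K(1)])
    finally show ?thesis
      using K(2) unfolding potential_def
      by (simp add: diff_divide_distrib[symmetric] abs_divide divide_le_eq mult.commute)
  qed
  show "isCont (potential K) z0"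
    unfolding continuous_at_eps_delta
  proof (intro allI impI)
    fix d :: real assume d: "0 < d"
    show "\<exists>\<delta>>0. \<forall>z. dist z z0 < \<delta> \<longrightarrow> dist (potential K z) (potential K z0) < d"
    proof (intro exI conjI allI impI)
      show "0 < min (e/2) (d * (e/2))" using d e by auto
      fix z assume z: "dist z z0 < min (e/2) (d * (e/2))"
      then have "dist z z0 / (e/2) < d" using e by (simp add: divide_less_eq)
      then show "dist (potential K z) (potential K z0) < d"
        using bd[of z] z by (simp add: dist_real_def)
    qed
  qed
qed

text \<open>Fubini reduces this to \<open>log_circle_mean\<close> for a single pole, since for every
  \<open>w\<close> in \<open>K\<close> the pole \<open>\<iota> w\<close> lies outside the closed
  disc.\<close>

lemma potential_circle_mean:
  assumes K: "compact K" "0 < measure lborel K" and r: "0 < r" "cball z r \<inter> \<iota> ` K = {}"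
  shows "integral\<^sup>L circ (\<lambda>t. potential K (z + of_real r * cis t)) = potential K z"
proof -
  interpret finite_measure circ by (rule finite_measure_circ)
  interpret pair_sigma_finite circ "lborel :: 'k measure" ..
  have mem: "z + of_real r * cis t \<in> cball z r" for t using r by (simp add: dist_norm norm_mult)
  have "compact ((\<lambda>(y, w). ln (norm (y - \<iota> w))) ` (cball z r \<times> K))"
  proof (intro compact_continuous_image compact_Times compact_cball K)
    show "continuous_on (cball z r \<times> K) (\<lambda>(y, w). ln (norm (y - \<iota> w)))"
      unfolding case_prod_unfold using r
      by (intro continuous_intros continuous_on_compose2[OF continuous_on_embedding[of UNIV]]) auto
  qed
  then have "bounded ((\<lambda>(y, w). ln (norm (y - \<iota> w))) ` (cball z r \<times> K))" by (rule compact_imp_bounded)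
  then obtain B where B: "\<And>y w. y \<in> cball z r \<Longrightarrow> w \<in> K \<Longrightarrow> \<bar>ln (norm (y - \<iota> w))\<bar> \<le> B"
    unfolding bounded_iff by fastforce
  have [measurable]: "K \<in> sets borel" using K by (simp add: borel_compact)
  define F where "F t w = indicator K w *\<^sub>R ln (norm (z + of_real r * cis t - \<iota> w))" for t w
  have cis [measurable]: "cis \<in> borel_measurable borel"
    by (intro borel_measurable_continuous_onI continuous_intros)
  have "integrable (circ \<Otimes>\<^sub>M lborel) (\<lambda>p. indicator (UNIV \<times> K) p *\<^sub>R ln (norm (z + of_real r * cis (fst p) - \<iota> (snd p))))"
  proof (rule integrableI_bounded_set_indicator)
    show "AE p in circ \<Otimes>\<^sub>M lborel. p \<in> UNIV \<times> K \<longrightarrow> norm (ln (norm (z + of_real r * cis (fst p) - \<iota> (snd p)))) \<le> B"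
      using B mem by auto
    show "emeasure (circ \<Otimes>\<^sub>M lborel) (UNIV \<times> K) < \<infinity>"
      using emeasure_compact_finite[OF K(1)]
      by (subst lborel.emeasure_pair_measure_Times) (auto simp: emeasure_circ)
  qed auto
  moreover have "(\<lambda>p. indicator (UNIV \<times> K) p *\<^sub>R ln (norm (z + of_real r * cis (fst p) - \<iota> (snd p)))) = case_prod F"
    by (auto simp: F_def fun_eq_iff indicator_def)
  ultimately have Fint: "integrable (circ \<Otimes>\<^sub>M lborel) (case_prod F)" by simp
  have "(\<integral>t. (\<integral>w. F t w \<partial>lborel) \<partial>circ) = (\<integral>w. (\<integral>t. F t w \<partial>circ) \<partial>lborel)"
    by (rule Fubini_integral[OF Fint, symmetric])
  also have "\<dots> = (\<integral>w. indicator K w *\<^sub>R ln (norm (z - \<iota> w)) \<partial>lborel)"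
  proof (rule Bochner_Integration.integral_cong[OF refl])
    fix w
    show "(\<integral>t. F t w \<partial>circ) = indicator K w *\<^sub>R ln (norm (z - \<iota> w))"
    proof (cases "w \<in> K")
      case True
      then have "norm (of_real r :: complex) < norm (z - \<iota> w)" using r by (force simp: dist_norm)
      from log_circle_mean[OF this] show ?thesis using True by (simp add: F_def algebra_simps)
    qed (simp add: F_def)
  qed
  finally show ?thesis
    by (simp add: potential_def F_def)
qed

end

section \<open>Comparison with the potential and the size of sublevel sets\<close>

context isometric_line
begin

text \<open>Maximum principle with two perturbations. The factor \<open>1 + \<epsilon>\<close> makes
  the potential outgrow \<open>v\<close>, which excludes a maximum on a large circle; the term
  \<open>\<delta> * (norm z)\<^sup>2\<close> makes \<open>p\<close> exceed its circle means
  strictly, which excludes an interior one. Boundary values at \<open>K\<close> are avoided by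
  cutting out the neighbourhood \<open>U\<close>, where \<open>v\<close> is below \<open>a\<close>
  anyway.\<close>

lemma bernstein_walsh_aux:
  assumes sub: "subharmonic v" and d: "0 < d"
    and growth: "\<And>z. v z \<le> ereal (C + d * ln (max 1 (norm z)))"
    and K: "compact K" and \<rho>: "0 < \<rho>"
    and vol: "measure lborel K = unit_ball_vol (real DIM('k)) * \<rho> ^ DIM('k)"
    and vK: "\<And>w. w \<in> K \<Longrightarrow> v (\<iota> w) < ereal a"
    and z0: "ereal a \<le> v z0"
    and \<epsilon>: "0 < \<epsilon>" and \<eta>: "0 < \<eta>"
  shows "v z0 \<le> ereal (a + (1 + \<epsilon>) * d * (potential K z0 - (ln \<rho> - 1 / real DIM('k))) + \<eta>)"
proof -
  define \<beta> where "\<beta> = ln \<rho> - 1 / real DIM('k)"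
  define U where "U = {z. v z < ereal a}"
  have mK: "0 < measure lborel K" using \<rho> by (simp add: vol)
  have U: "open U" using sub by (simp add: U_def subharmonic_def usc_def)
  have KU: "\<iota> ` K \<subseteq> U" using vK by (auto simp: U_def)
  define W where "W = - \<iota> ` K"
  have W: "open W" using closed_image[OF K] by (simp add: W_def open_Compl)
  have "bounded (\<iota> ` K)"
    by (intro compact_imp_bounded compact_continuous_image continuous_on_embedding K)
  then obtain A where A: "0 < A" "\<And>w. w \<in> K \<Longrightarrow> norm (\<iota> w) \<le> A"
    unfolding bounded_pos by auto
  \<comment> \<open>For \<open>R > 2 * A\<close> the potential is at least \<open>ln (R / 2)\<close>
    on the circle of radius \<open>R\<close>, so this expression bounds \<open>v\<close> minus the
    multiple of the potential there; it tends to minus infinity thanks to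
    \<open>\<epsilon>\<close>.\<close>
  have "filterlim (\<lambda>R. C + (1 + \<epsilon>) * d * ln 2 - \<epsilon> * d * ln R) at_bot at_top"
    using \<epsilon> d by real_asymp
  then have "eventually (\<lambda>R. C + (1 + \<epsilon>) * d * ln 2 - \<epsilon> * d * ln R \<le> a - (1 + \<epsilon>) * d * \<beta>) at_top"
    by (simp add: filterlim_at_bot)
  then have "eventually (\<lambda>R. C + (1 + \<epsilon>) * d * ln 2 - \<epsilon> * d * ln R \<le> a - (1 + \<epsilon>) * d * \<beta> \<and>
      R > 1 \<and> R > norm z0 \<and> R > 2 * A) at_top"
    by (intro eventually_conj eventually_gt_at_top)
  then obtain R where R: "C + (1 + \<epsilon>) * d * ln 2 - \<epsilon> * d * ln R \<le> a - (1 + \<epsilon>) * d * \<beta>"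
      "R > 1" "R > norm z0" "R > 2 * A"
    using eventually_happens'[OF trivial_limit_at_top_linorder] by blast
  \<comment> \<open>Chosen so that the quadratic perturbation costs at most \<open>\<eta>\<close> on
    the disc of radius \<open>R\<close>.\<close>
  define \<delta> where "\<delta> = \<eta> / R\<^sup>2"
  have \<delta>: "0 < \<delta>" using \<eta> R by (simp add: \<delta>_def)
  have \<delta>R: "\<delta> * (norm z)\<^sup>2 \<le> \<eta>" if "norm z \<le> R" for z :: complex
  proof -
    have "\<delta> * (norm z)\<^sup>2 \<le> \<delta> * R\<^sup>2" using that \<delta> by (intro mult_left_mono power_mono) auto
    then show ?thesis using R by (simp add: \<delta>_def)
  qed
  define p where "p z = (1 + \<epsilon>) * d * potential K z - \<delta> * (norm z)\<^sup>2" for z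
  have pcont: "continuous_on W p"
    unfolding p_def W_def by (intro continuous_intros continuous_on_potential K mK)
  have pge: "(1 + \<epsilon>) * d * \<beta> - \<eta> \<le> p z" if "z \<in> W" "norm z \<le> R" for z
  proof -
    have "\<beta> \<le> potential K z" unfolding \<beta>_def using that by (intro potential_ge K \<rho> vol) (auto simp: W_def)
    then have "(1 + \<epsilon>) * d * \<beta> \<le> (1 + \<epsilon>) * d * potential K z" using d \<epsilon> by (intro mult_left_mono) auto
    with \<delta>R[OF that(2)] show ?thesis by (simp add: p_def)
  qed
  \<comment> \<open>The largest value that \<open>v - p\<close> can have where \<open>v\<close> is
    at most \<open>a\<close>, by the lower bound \<open>pge\<close>.\<close>
  define m where "m = a - (1 + \<epsilon>) * d * \<beta> + \<eta>"
  define X where "X = cball 0 R - U"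
  have X: "compact X" unfolding X_def using U by (intro compact_diff compact_cball)
  have XW: "X \<subseteq> W" using KU by (auto simp: X_def W_def)
  have z0X: "z0 \<in> X" using z0 R by (auto simp: X_def U_def)
  have vfin: "v z < \<infinity>" for z using sub by (simp add: subharmonic_def)
  have "\<exists>x\<in>X. \<forall>y\<in>X. v y - ereal (p y) \<le> v x - ereal (p x)"
  proof (rule compact_attains_usc[OF X])
    show "X \<noteq> {}" using z0X by auto
    fix b
    have "open {x\<in>W. v x - ereal (p x) < b}"
      using sub W pcont by (intro usc_minus_continuous) (auto simp: subharmonic_def)
    moreover have "{x\<in>X. v x - ereal (p x) < b} = X \<inter> {x\<in>W. v x - ereal (p x) < b}" using XW by auto
    ultimately show "\<exists>V. open V \<and> {x\<in>X. v x - ereal (p x) < b} = X \<inter> V" by blast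
  qed
  then obtain zm where zm: "zm \<in> X" "\<And>y. y \<in> X \<Longrightarrow> v y - ereal (p y) \<le> v zm - ereal (p zm)" by blast
  have main: "v zm - ereal (p zm) \<le> ereal m"
  proof (rule ccontr)
    assume "\<not> ?thesis"
    then have "ereal m < v zm - ereal (p zm)" by simp
    moreover have "v zm - ereal (p zm) \<noteq> \<infinity>" using vfin[of zm] by (cases "v zm") auto
    ultimately obtain \<mu> where \<mu>: "v zm - ereal (p zm) = ereal \<mu>" "m < \<mu>"
      by (cases "v zm - ereal (p zm)") auto
    then have vzm: "v zm = ereal (\<mu> + p zm)" by (cases "v zm") auto
    have zmW: "zm \<in> W" and zmR: "norm zm \<le> R" using zm XW by (auto simp: X_def)
    have "norm zm \<noteq> R"
    proof
      assume eq: "norm zm = R"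
      have "R / 2 \<le> norm (zm - \<iota> w)" if "w \<in> K" for w
        using norm_triangle_ineq2[of zm "\<iota> w"] A(2)[OF that] R eq by simp
      then have "ln (R / 2) \<le> potential K zm" using R by (intro potential_ge_far K mK) auto
      then have "(1 + \<epsilon>) * d * ln (R / 2) \<le> (1 + \<epsilon>) * d * potential K zm"
        using d \<epsilon> by (intro mult_left_mono) auto
      moreover have "ln (R / 2) = ln R - ln 2" using R by (simp add: ln_div)
      moreover have "\<mu> + p zm \<le> C + d * ln R"
        using growth[of zm] vzm eq R by (simp add: max_def split: if_splits)
      ultimately have "\<mu> \<le> C + d * ln R - (1 + \<epsilon>) * d * (ln R - ln 2) + \<eta>"
        using \<delta>R[of zm] eq unfolding p_def by simp
      also have "\<dots> = C + (1 + \<epsilon>) * d * ln 2 - \<epsilon> * d * ln R + \<eta>" by (simp add: algebra_simps)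
      also have "\<dots> \<le> m" using R(1) by (simp add: m_def)
      finally show False using \<mu>(2) by simp
    qed
    then have "zm \<in> ball 0 R \<inter> W" using zmR zmW by auto
    moreover have "open (ball 0 R \<inter> W)" using W by auto
    ultimately obtain r where r: "0 < r" "cball zm r \<subseteq> ball 0 R \<inter> W"
      using open_contains_cball by blast
    have mem: "zm + of_real r * cis t \<in> cball zm r" for t using r by (simp add: dist_norm norm_mult)
    have memW: "zm + of_real r * cis t \<in> W" for t using mem r(2) by blast
    \<comment> \<open>The small disc may meet \<open>U\<close>, where the maximality of
      \<open>zm\<close> says nothing; there \<open>v\<close> is below \<open>a\<close>, and
      \<open>a \<le> \<mu> + p z\<close> because \<open>\<mu>\<close> exceeds
      \<open>m\<close>.\<close>
    have vle: "v z \<le> ereal (\<mu> + p z)" if "z \<in> cball zm r" for z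
    proof (cases "z \<in> U")
      case True
      have "z \<in> W" "norm z \<le> R" using that r by force+
      then have "a \<le> \<mu> + p z" using pge[of z] \<mu>(2) by (simp add: m_def)
      moreover have "v z < ereal a" using True by (simp add: U_def)
      ultimately show ?thesis by (meson ereal_less_eq(3) less_imp_le order_trans)
    next
      case False
      then have "z \<in> X" using that r by (auto simp: X_def)
      then have "v z - ereal (p z) \<le> ereal \<mu>" using zm \<mu> by metis
      then show ?thesis by (cases "v z") auto
    qed
    have cont: "continuous_on UNIV (\<lambda>t. potential K (zm + of_real r * cis t))"
      using memW by (intro continuous_on_compose2[OF continuous_on_potential[OF K mK]] continuous_intros)
        (auto simp: W_def[symmetric])
    have cont2: "continuous_on UNIV (\<lambda>t. (norm (zm + of_real r * cis t))\<^sup>2)"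
      by (intro continuous_intros)
    interpret finite_measure circ by (rule finite_measure_circ)
    have int: "integrable circ (\<lambda>t. \<mu> + p (zm + of_real r * cis t))"
      unfolding p_def using integrable_circ[OF cont] integrable_circ[OF cont2] by simp
    have "v zm \<le> circle_mean v zm r" using sub r by (simp add: subharmonic_def)
    also have "\<dots> \<le> ereal_integral circ (\<lambda>t. ereal (\<mu> + p (zm + of_real r * cis t)))"
      unfolding circle_mean_circ using vle mem by (intro ereal_integral_mono) auto
    also have "\<dots> = ereal (integral\<^sup>L circ (\<lambda>t. \<mu> + p (zm + of_real r * cis t)))"
      by (rule ereal_integral_real[OF int])
    also have "integral\<^sup>L circ (\<lambda>t. \<mu> + p (zm + of_real r * cis t)) =
        \<mu> + ((1 + \<epsilon>) * d * integral\<^sup>L circ (\<lambda>t. potential K (zm + of_real r * cis t))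
          - \<delta> * integral\<^sup>L circ (\<lambda>t. (norm (zm + of_real r * cis t))\<^sup>2))"
      unfolding p_def
      using integrable_circ[OF cont] integrable_circ[OF cont2] emeasure_circ
      by (simp add: measure_def)
    also have "integral\<^sup>L circ (\<lambda>t. potential K (zm + of_real r * cis t)) = potential K zm"
      using r by (intro potential_circle_mean K mK) (auto simp: W_def)
    also have "\<mu> + ((1 + \<epsilon>) * d * potential K zm - \<delta> * integral\<^sup>L circ (\<lambda>t. (norm (zm + of_real r * cis t))\<^sup>2))
        = \<mu> + p zm - \<delta> * r\<^sup>2"
      unfolding norm_sq_circle_mean p_def by (simp add: algebra_simps)
    \<comment> \<open>The circle mean of \<open>p\<close> is smaller than \<open>p zm\<close> by
      exactly \<open>\<delta> * r\<^sup>2\<close>, so the mean value inequality reads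
      \<open>v zm \<le> v zm - \<delta> * r\<^sup>2\<close>.\<close>
    finally have "\<delta> * r\<^sup>2 \<le> 0" using vzm by simp
    moreover have "0 < \<delta> * r\<^sup>2" using r(1) \<delta> by simp
    ultimately show False by simp
  qed
  have "v z0 - ereal (p z0) \<le> ereal m" using zm(2)[OF z0X] main by (rule order_trans)
  then have "v z0 \<le> ereal (m + p z0)" by (cases "v z0") auto
  also have "m + p z0 \<le> a + (1 + \<epsilon>) * d * (potential K z0 - \<beta>) + \<eta>"
    using \<delta> by (simp add: m_def p_def algebra_simps)
  finally show ?thesis unfolding \<beta>_def by simp
qed

text \<open>The limit of the preceding estimate for vanishing \<open>\<epsilon>\<close> and
  \<open>\<eta>\<close>, with the potential at \<open>z0\<close> replaced by its upper bound
  \<open>ln R\<close>. In this version of the Bernstein-Walsh inequality the volume radius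
  \<open>\<rho>\<close> takes the place of the logarithmic capacity.\<close>

lemma bernstein_walsh:
  assumes sub: "subharmonic v" and d: "0 < d"
    and growth: "\<And>z. v z \<le> ereal (C + d * ln (max 1 (norm z)))"
    and K: "compact K" and \<rho>: "0 < \<rho>"
    and vol: "measure lborel K = unit_ball_vol (real DIM('k)) * \<rho> ^ DIM('k)"
    and vK: "\<And>w. w \<in> K \<Longrightarrow> v (\<iota> w) < ereal a"
    and R: "\<And>w. w \<in> K \<Longrightarrow> norm (z0 - \<iota> w) \<le> R"
    and z0: "ereal a \<le> v z0"
  shows "v z0 \<le> ereal (a + d * (ln R - ln \<rho> + 1 / real DIM('k)))"
proof -
  have mK: "0 < measure lborel K" using \<rho> by (simp add: vol)
  have z0K: "z0 \<notin> \<iota> ` K" using vK z0 by (auto simp: not_less[symmetric])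
  define D where "D = potential K z0 - (ln \<rho> - 1 / real DIM('k))"
  have D0: "0 \<le> D" unfolding D_def using potential_ge[OF K z0K \<rho> vol] by simp
  have "v z0 \<noteq> \<infinity>" using sub by (force simp: subharmonic_def)
  then obtain x where x: "v z0 = ereal x" using z0 by (cases "v z0") auto
  have "x \<le> a + d * D + e" if e: "0 < e" for e
  proof -
    \<comment> \<open>The summand 1 keeps the quotient defined when \<open>D = 0\<close>. The error
      \<open>\<epsilon> * (d * D)\<close> is at most \<open>e / 2\<close>, and
      \<open>\<eta> = e / 2\<close> uses up the rest.\<close>
    define \<epsilon> where "\<epsilon> = e / (2 * (d * D + 1))"
    have dD: "0 \<le> d * D" using d D0 by simp
    have \<epsilon>: "0 < \<epsilon>" using e dD by (simp add: \<epsilon>_def)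
    have "\<epsilon> * (d * D) \<le> \<epsilon> * (d * D + 1)" using \<epsilon> by simp
    also have "\<dots> = e / 2" using dD by (simp add: \<epsilon>_def field_simps)
    finally have "\<epsilon> * (d * D) \<le> e / 2" .
    moreover have "x \<le> a + (1 + \<epsilon>) * d * D + e / 2"
      using bernstein_walsh_aux[OF sub d growth K \<rho> vol vK z0 \<epsilon>, of "e/2"] e x by (simp add: D_def)
    ultimately show ?thesis by (simp add: algebra_simps)
  qed
  then have "x \<le> a + d * D" by (rule field_le_epsilon)
  moreover have "d * potential K z0 \<le> d * ln R"
    using d by (intro mult_left_mono potential_le K z0K mK R) auto
  ultimately show ?thesis using x by (simp add: D_def algebra_simps)
qed

text \<open>Solves \<open>s \<le> d * (ln R - ln \<rho> + 1 / k)\<close>, which is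
  \<open>bernstein_walsh\<close> for the level \<open>M - s\<close> and the value \<open>M\<close>
  at the origin, for the volume. The sublevel set is open and hence exhausted by compact sets, to
  which that inequality applies.\<close>

lemma sublevel_le:
  assumes sub: "subharmonic v" and d: "0 < d"
    and growth: "\<And>z. v z \<le> ereal (C + d * ln (max 1 (norm z)))"
    and M: "v (\<iota> 0) = ereal M" and s: "0 \<le> s" and R: "0 < R"
  shows "emeasure lborel {w \<in> ball 0 R. v (\<iota> w) < ereal (M - s)}
    \<le> ennreal (unit_ball_vol (real DIM('k)) * R ^ DIM('k) * exp (1 - real DIM('k) * s / d))"
    (is "emeasure lborel ?S \<le> ennreal ?b")
proof -
  define k where "k = DIM('k)"
  have k: "0 < k" by (simp add: k_def)
  have "usc (\<lambda>w. v (\<iota> w))"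
    using sub by (auto intro: usc_compose[OF _ continuous_on_embedding] simp: subharmonic_def)
  then have "open (ball 0 R \<inter> {w. v (\<iota> w) < ereal (M - s)})" unfolding usc_def by blast
  moreover have "ball 0 R \<inter> {w. v (\<iota> w) < ereal (M - s)} = ?S" by auto
  ultimately have opS: "open ?S" by simp
  obtain F :: "nat \<Rightarrow> 'k set" where F: "\<And>n. compact (F n)" "\<And>n. F n \<subseteq> ?S" "\<And>n. F n \<subseteq> interior (F (Suc n))"
      "\<Union>(range F) = ?S"
    by (rule open_Union_compact_subsets[OF opS]) blast
  have bound: "emeasure lborel (F n) \<le> ennreal ?b" for n
  proof -
    have eq: "emeasure lborel (F n) = ennreal (measure lborel (F n))"
      using emeasure_compact_finite[OF F(1)[of n]] by (simp add: emeasure_eq_ennreal_measure)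
    have "measure lborel (F n) \<le> ?b"
    \<comment> \<open>A null set has no positive volume radius, and the bound is trivial for
      it.\<close>
    proof (cases "measure lborel (F n) = 0")
      case False
      define \<rho> where "\<rho> = root k (measure lborel (F n) / unit_ball_vol (real k))"
      have pos: "0 < measure lborel (F n)" using False by (simp add: zero_less_measure_iff)
      then have \<rho>: "0 < \<rho>" using k by (simp add: \<rho>_def)
      have "\<rho> ^ k = measure lborel (F n) / unit_ball_vol (real k)" unfolding \<rho>_def using k pos
        by (intro real_root_pow_pos2) auto
      then have vol: "measure lborel (F n) = unit_ball_vol (real k) * \<rho> ^ k"
        by (simp add: field_simps less_imp_neq[OF unit_ball_vol_pos, symmetric])
      have "v (\<iota> 0) \<le> ereal ((M - s) + d * (ln R - ln \<rho> + 1 / real k))"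
        unfolding k_def
      proof (rule bernstein_walsh[OF sub d growth F(1)[of n] \<rho>])
        show "measure lborel (F n) = unit_ball_vol (real DIM('k)) * \<rho> ^ DIM('k)" using vol by (simp add: k_def)
        show "ereal (M - s) \<le> v (\<iota> 0)" using M s by simp
        fix w assume "w \<in> F n"
        then have w: "w \<in> ?S" using F(2) by blast
        then show "v (\<iota> w) < ereal (M - s)" by simp
        show "norm (\<iota> 0 - \<iota> w) \<le> R" using w by (simp add: isometry)
      qed
      then have "s \<le> d * (ln R - ln \<rho> + 1 / real k)" using M by simp
      then have "s / d \<le> ln R - ln \<rho> + 1 / real k" using d by (simp add: divide_le_eq mult.commute)
      then have "real k * (s / d) \<le> real k * (ln R - ln \<rho> + 1 / real k)" by (rule mult_left_mono) simp
      also have "\<dots> = real k * ln R - real k * ln \<rho> + 1" using k by (simp add: algebra_simps)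
      finally have "real k * ln \<rho> \<le> real k * ln R + (1 - real k * s / d)" by simp
      then have "exp (real k * ln \<rho>) \<le> exp (real k * ln R + (1 - real k * s / d))" by simp
      then have "\<rho> ^ k \<le> R ^ k * exp (1 - real k * s / d)"
        using \<rho> R by (simp add: exp_add exp_of_nat_mult)
      then have "unit_ball_vol (real k) * \<rho> ^ k \<le> unit_ball_vol (real k) * (R ^ k * exp (1 - real k * s / d))"
        by (intro mult_left_mono) auto
      then show ?thesis using vol by (simp add: k_def mult.assoc)
    qed (use R in simp)
    then show ?thesis unfolding eq by (simp add: ennreal_leI)
  qed
  have "incseq F" using F(3) by (intro incseq_SucI) (meson interior_subset subset_trans)
  then have "emeasure lborel ?S = (SUP n. emeasure lborel (F n))"
    unfolding F(4)[symmetric] using F(1) by (intro SUP_emeasure_incseq[symmetric]) (auto simp: borel_compact)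
  also have "\<dots> \<le> ennreal ?b" using bound by (intro SUP_least) auto
  finally show ?thesis .
qed

end

lemma isometric_line_of_real: "isometric_line (of_real :: real \<Rightarrow> complex)"
proof
  show "norm (complex_of_real x - of_real y) = norm (x - y)" for x y
    unfolding of_real_diff[symmetric] norm_of_real real_norm_def ..
  have "norm (Re z - w) \<le> norm (z - of_real w)" for z :: complex and w
    using abs_Re_le_cmod[of "z - of_real w"] by simp
  then show "\<exists>x::real. \<forall>w. norm (x - w) \<le> norm (z - of_real w)" for z :: complex
    by (intro exI[of _ "Re z"] allI)
qed

subsection \<open>Lebesgue measure on a real subspace\<close>

definition coord_sum :: "'a::euclidean_space set \<Rightarrow> ('a \<Rightarrow> real) \<Rightarrow> 'a" where
  "coord_sum B f = (\<Sum>b\<in>B. f b *\<^sub>R b)"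

text \<open>The push-forward behind \<open>subspace_lborel\<close>, but taken on the whole ambient
  space, so that ordinary Borel sets and functions can be used; the subspace carries all the
  mass.\<close>

definition coord_measure :: "'a::euclidean_space set \<Rightarrow> 'a measure" where
  "coord_measure B = distr (\<Pi>\<^sub>M b\<in>B. lborel) borel (coord_sum B)"

lemma coord_sum_measurable [measurable]: "coord_sum B \<in> borel_measurable (\<Pi>\<^sub>M b\<in>B. lborel)"
  unfolding coord_sum_def by measurable

lemma sets_coord_measure [measurable_cong, simp]: "sets (coord_measure B) = sets borel" "space (coord_measure B) = UNIV"
  by (auto simp: coord_measure_def)

text \<open>Both sides are determined by their values on boxes, where the map acts coordinatewise
  and each coordinate contributes one factor \<open>\<bar>t\<bar>\<close>.\<close>

lemma PiM_lborel_affine: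
  fixes B :: "'b set" and y :: "'b \<Rightarrow> real"
  assumes "finite B" and t: "t \<noteq> 0"
  shows "scale_measure (ennreal (\<bar>t\<bar> ^ card B))
      (distr (\<Pi>\<^sub>M b\<in>B. lborel) (\<Pi>\<^sub>M b\<in>B. lborel) (\<lambda>f. \<lambda>b\<in>B. y b + t * f b)) = (\<Pi>\<^sub>M b\<in>B. lborel)"
proof -
  interpret product_sigma_finite "\<lambda>b::'b. lborel :: real measure" ..
  show ?thesis
  proof (rule PiM_eqI)
    fix A :: "'b \<Rightarrow> real set" assume A: "\<And>i. i \<in> B \<Longrightarrow> A i \<in> sets lborel"
    have m: "(\<lambda>f. \<lambda>b\<in>B. y b + t * f b) \<in> measurable (\<Pi>\<^sub>M b\<in>B. lborel) (\<Pi>\<^sub>M b\<in>B. lborel)"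
      by measurable
    have pre: "(\<lambda>x. y i + t * x) -` A i \<in> sets lborel" if "i \<in> B" for i
      using A[OF that] by (auto intro: measurable_sets_borel[of _ borel])
    have one: "emeasure lborel (A i) = ennreal \<bar>t\<bar> * emeasure lborel ((\<lambda>x. y i + t * x) -` A i)" if "i \<in> B" for i
      using A[OF that] by (subst lborel_real_affine[OF t, of "y i"])
        (simp add: emeasure_density nn_integral_cmult emeasure_distr)
    have "(\<lambda>f. \<lambda>b\<in>B. y b + t * f b) -` (Pi\<^sub>E B A) \<inter> space (\<Pi>\<^sub>M b\<in>B. lborel) = Pi\<^sub>E B (\<lambda>b. (\<lambda>x. y b + t * x) -` A b)"
      by (auto simp: space_PiM PiE_iff extensional_def)
    then have "emeasure (distr (\<Pi>\<^sub>M b\<in>B. lborel) (\<Pi>\<^sub>M b\<in>B. lborel) (\<lambda>f. \<lambda>b\<in>B. y b + t * f b)) (Pi\<^sub>E B A)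
      = (\<Prod>i\<in>B. emeasure lborel ((\<lambda>x. y i + t * x) -` A i))"
      using A m pre assms(1) by (subst emeasure_distr) (auto simp: emeasure_PiM intro!: sets_PiM_I_finite)
    moreover have "ennreal (\<bar>t\<bar> ^ card B) = (\<Prod>i\<in>B. ennreal \<bar>t\<bar>)"
      by (simp add: ennreal_power)
    ultimately show "emeasure (scale_measure (ennreal (\<bar>t\<bar> ^ card B)) (distr (\<Pi>\<^sub>M b\<in>B. lborel) (\<Pi>\<^sub>M b\<in>B. lborel) (\<lambda>f. \<lambda>b\<in>B. y b + t * f b))) (Pi\<^sub>E B A)
      = (\<Prod>i\<in>B. emeasure lborel (A i))"
      using one by (simp add: prod.distrib)
  qed (use assms in auto)
qed

text \<open>The properties of Lebesgue measure on \<open>G\<close> from which the estimates are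
  derived. Translations go along \<open>G\<close> only; \<open>t\<close> may be negative, so point
  reflections are included.\<close>

locale homogeneous_measure =
  fixes G :: "'a::euclidean_space set" and \<mu> :: "'a measure" and N :: nat
  assumes subspace_G: "subspace G"
    and sets_\<mu> [measurable_cong, simp]: "sets \<mu> = sets borel"
    and AE_G: "AE x in \<mu>. x \<in> G"
    and affine: "\<And>c t f. c \<in> G \<Longrightarrow> t \<noteq> 0 \<Longrightarrow> f \<in> borel_measurable borel \<Longrightarrow>
      (\<integral>\<^sup>+x. f x \<partial>\<mu>) = ennreal (\<bar>t\<bar> ^ N) * (\<integral>\<^sup>+x. f (c + t *\<^sub>R x) \<partial>\<mu>)"
    and ball_finite: "emeasure \<mu> (ball 0 r) < \<infinity>"
    and ball_pos: "0 < r \<Longrightarrow> 0 < emeasure \<mu> (ball 0 r)"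

context
  fixes G B :: "'a::euclidean_space set"
  assumes G: "subspace G" and B: "orthonormal_basis G B"
begin

lemma basis_facts:
  shows "finite B" "\<And>b c. b \<in> B \<Longrightarrow> c \<in> B \<Longrightarrow> b \<bullet> c = (if b = c then 1 else 0)" "span B = G"
    and "card B = dim G"
proof -
  show "finite B" using B independent_imp_finite by (auto simp: orthonormal_basis_def)
  show "b \<bullet> c = (if b = c then 1 else 0)" if "b \<in> B" "c \<in> B" for b c
    using B that by (auto simp: orthonormal_basis_def pairwise_def orthogonal_def norm_eq_1)
  show "span B = G" using B by (simp add: orthonormal_basis_def)
  show "card B = dim G" using B basis_card_eq_dim[of B G]
    by (auto simp: orthonormal_basis_def)
qed

lemma inner_coord_sum:
  assumes "c \<in> B" shows "coord_sum B f \<bullet> c = f c"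
proof -
  have "coord_sum B f \<bullet> c = (\<Sum>b\<in>B. f b * (b \<bullet> c))" by (simp add: coord_sum_def inner_sum_left)
  also have "\<dots> = (\<Sum>b\<in>B. if b = c then f c else 0)"
    using assms by (intro sum.cong refl) (simp add: basis_facts(2))
  finally show ?thesis using assms basis_facts(1) by simp
qed

lemma coord_sum_inner:
  assumes "c \<in> G" shows "coord_sum B (\<lambda>b. c \<bullet> b) = c"
proof -
  obtain u where u: "c = (\<Sum>b\<in>B. u b *\<^sub>R b)"
    using assms basis_facts(1,3) span_finite[of B] by auto
  have "coord_sum B (\<lambda>b. c \<bullet> b) = coord_sum B u"
    unfolding coord_sum_def
  proof (rule sum.cong[OF refl])
    fix b assume "b \<in> B"
    then have "c \<bullet> b = u b" using inner_coord_sum[of b u] u by (simp add: coord_sum_def)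
    then show "(c \<bullet> b) *\<^sub>R b = u b *\<^sub>R b" by simp
  qed
  then show ?thesis by (simp add: u coord_sum_def)
qed

lemma coord_sum_in: "coord_sum B f \<in> G"
  using basis_facts(3) unfolding coord_sum_def by (auto intro!: span_sum span_scale intro: span_base)

lemma coord_measure_affine:
  assumes c: "c \<in> G" and t: "t \<noteq> 0" and f [measurable]: "f \<in> borel_measurable borel"
  shows "(\<integral>\<^sup>+x. f x \<partial>coord_measure B) = ennreal (\<bar>t\<bar> ^ dim G) * (\<integral>\<^sup>+x. f (c + t *\<^sub>R x) \<partial>coord_measure B)"
proof -
  let ?P = "\<Pi>\<^sub>M b\<in>B. (lborel :: real measure)"
  define T where "T f = (\<lambda>b\<in>B. c \<bullet> b + t * f b)" for f
  have [measurable]: "T \<in> measurable ?P ?P" unfolding T_def by measurable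
  have P: "?P = scale_measure (ennreal (\<bar>t\<bar> ^ dim G)) (distr ?P ?P T)"
    using PiM_lborel_affine[OF basis_facts(1) t, of "\<lambda>b. c \<bullet> b"] basis_facts(4) by (simp add: T_def[abs_def])
  have T: "coord_sum B (T g) = c + t *\<^sub>R coord_sum B g" for g
  proof -
    have "coord_sum B (T g) = coord_sum B (\<lambda>b. c \<bullet> b) + t *\<^sub>R coord_sum B g"
      by (simp add: coord_sum_def T_def scaleR_add_left sum.distrib scaleR_sum_right)
    then show ?thesis by (simp add: coord_sum_inner[OF c])
  qed
  have "(\<integral>\<^sup>+x. f x \<partial>coord_measure B) = (\<integral>\<^sup>+g. f (coord_sum B g) \<partial>?P)"
    unfolding coord_measure_def by (subst nn_integral_distr) auto
  also have "\<dots> = (\<integral>\<^sup>+g. f (coord_sum B g) \<partial>scale_measure (ennreal (\<bar>t\<bar> ^ dim G)) (distr ?P ?P T))"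
    using P by simp
  also have "\<dots> = ennreal (\<bar>t\<bar> ^ dim G) * (\<integral>\<^sup>+g. f (coord_sum B (T g)) \<partial>?P)"
    by (subst nn_integral_scale_measure) (auto simp: nn_integral_distr)
  also have "(\<integral>\<^sup>+g. f (coord_sum B (T g)) \<partial>?P) = (\<integral>\<^sup>+x. f (c + t *\<^sub>R x) \<partial>coord_measure B)"
    unfolding T coord_measure_def by (subst nn_integral_distr) auto
  finally show ?thesis .
qed

lemma emeasure_PiM_lborel_box:
  fixes A :: "'a \<Rightarrow> real set"
  assumes "\<And>b. b \<in> B \<Longrightarrow> A b \<in> sets borel"
  shows "emeasure (\<Pi>\<^sub>M b\<in>B. lborel) (Pi\<^sub>E B A) = (\<Prod>b\<in>B. emeasure lborel (A b))"
proof -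
  interpret product_sigma_finite "\<lambda>b::'a. lborel :: real measure" ..
  show ?thesis by (simp add: emeasure_PiM assms basis_facts(1))
qed

text \<open>Balls are compared with cubes in coordinates: Cauchy-Schwarz puts the ball into the cube
  of half side \<open>r\<close>, and the triangle inequality puts a small cube into the
  ball.\<close>

lemma homogeneous_coord_measure: "homogeneous_measure G (coord_measure B) (dim G)"
proof
  show "AE x in coord_measure B. x \<in> G"
    unfolding coord_measure_def using closed_subspace[OF G] coord_sum_in
    by (subst AE_distr_iff) auto
  show "emeasure (coord_measure B) (ball 0 r) < \<infinity>" for r
  proof -
    have "emeasure (coord_measure B) (ball 0 r) = emeasure (\<Pi>\<^sub>M b\<in>B. lborel) (coord_sum B -` ball 0 r \<inter> space (\<Pi>\<^sub>M b\<in>B. lborel))"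
      unfolding coord_measure_def by (intro emeasure_distr) auto
    also have "\<dots> \<le> emeasure (\<Pi>\<^sub>M b\<in>B. lborel) (Pi\<^sub>E B (\<lambda>_. {-r..r}))"
    proof (intro emeasure_mono subsetI)
      show "Pi\<^sub>E B (\<lambda>_. {-r..r}) \<in> sets (\<Pi>\<^sub>M b\<in>B. lborel)"
        using basis_facts(1) by (intro sets_PiM_I_finite) auto
      fix g assume g: "g \<in> coord_sum B -` ball 0 r \<inter> space (\<Pi>\<^sub>M b\<in>B. lborel)"
      have "\<bar>g b\<bar> \<le> r" if "b \<in> B" for b
      proof -
        have "\<bar>g b\<bar> = \<bar>coord_sum B g \<bullet> b\<bar>" using inner_coord_sum[OF that] by simp
        also have "\<dots> \<le> norm (coord_sum B g) * norm b" by (rule Cauchy_Schwarz_ineq2)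
        also have "norm b = 1" using B that by (simp add: orthonormal_basis_def)
        finally show ?thesis using g by simp
      qed
      then show "g \<in> Pi\<^sub>E B (\<lambda>_. {-r..r})" using g by (auto simp: space_PiM PiE_iff abs_le_iff minus_le_iff)
    qed
    also have "\<dots> = (\<Prod>b\<in>B. emeasure lborel {-r..r})" by (rule emeasure_PiM_lborel_box) simp
    also have "\<dots> < \<infinity>" by (simp add: power_eq_top_ennreal less_top[symmetric] emeasure_lborel_Icc_eq)
    finally show ?thesis .
  qed
  show "0 < emeasure (coord_measure B) (ball 0 r)" if r: "0 < r" for r
  proof -
    \<comment> \<open>The added 1 gives a strict inequality and covers an empty basis.\<close>
    define e where "e = r / (real (card B) + 1)"
    have e: "0 < e" using r by (simp add: e_def)
    have "0 < ennreal ((2 * e) ^ card B)" using e by simp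
    also have "\<dots> = (\<Prod>b\<in>B. emeasure lborel {-e<..<e})"
      using e by (simp add: ennreal_power)
    also have "\<dots> = emeasure (\<Pi>\<^sub>M b\<in>B. lborel) (Pi\<^sub>E B (\<lambda>_. {-e<..<e}))"
      by (rule emeasure_PiM_lborel_box[symmetric]) simp
    also have "\<dots> \<le> emeasure (\<Pi>\<^sub>M b\<in>B. lborel) (coord_sum B -` ball 0 r \<inter> space (\<Pi>\<^sub>M b\<in>B. lborel))"
    proof (intro emeasure_mono subsetI)
      show "coord_sum B -` ball 0 r \<inter> space (\<Pi>\<^sub>M b\<in>B. lborel) \<in> sets (\<Pi>\<^sub>M b\<in>B. lborel)"
        by measurable
      fix g assume g: "g \<in> Pi\<^sub>E B (\<lambda>_. {-e<..<e})"
      have "norm (coord_sum B g) \<le> (\<Sum>b\<in>B. norm (g b *\<^sub>R b))" unfolding coord_sum_def by (rule norm_sum)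
      also have "\<dots> \<le> (\<Sum>b\<in>B. e)"
      proof (rule sum_mono)
        fix b assume b: "b \<in> B"
        then have "g b \<in> {-e<..<e}" using g by blast
        then show "norm (g b *\<^sub>R b) \<le> e" using B b by (auto simp: orthonormal_basis_def abs_le_iff)
      qed
      also have "\<dots> = real (card B) * e" by simp
      also have "\<dots> < (real (card B) + 1) * e" using e by (intro mult_strict_right_mono) auto
      also have "\<dots> = r" by (simp add: e_def add_pos_nonneg less_imp_neq[symmetric])
      finally show "g \<in> coord_sum B -` ball 0 r \<inter> space (\<Pi>\<^sub>M b\<in>B. lborel)" using g by (simp add: space_PiM PiE_iff)
    qed
    also have "\<dots> = emeasure (coord_measure B) (ball 0 r)"
      unfolding coord_measure_def by (intro emeasure_distr[symmetric]) auto
    finally show ?thesis .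
  qed
qed (fact G sets_coord_measure coord_measure_affine)+

end

section \<open>Radial integrals\<close>

lemma nn_integral_lborel_scale:
  fixes f :: "'k::euclidean_space \<Rightarrow> ennreal"
  assumes [measurable]: "f \<in> borel_measurable borel" and c: "c \<noteq> 0"
  shows "(\<integral>\<^sup>+x. f x \<partial>lborel) = ennreal (\<bar>c\<bar> ^ DIM('k)) * (\<integral>\<^sup>+x. f (c *\<^sub>R x) \<partial>lborel)"
  by (subst lborel_affine[OF c, of 0])
     (simp add: nn_integral_density nn_integral_distr nn_integral_cmult)

text \<open>Integrates the complement \<open>\<rho> ^ j - norm \<zeta> ^ j\<close>, written as the
  integral of \<open>j * a ^ (j - 1)\<close> over the radii \<open>a\<close> between
  \<open>norm \<zeta>\<close> and \<open>\<rho>\<close>; after Fubini only volumes of balls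
  remain.\<close>

lemma nn_integral_norm_power_ball:
  assumes \<rho>: "0 < \<rho>"
  shows "(\<integral>\<^sup>+\<zeta>. indicator (ball 0 \<rho>) \<zeta> * ennreal (norm \<zeta> ^ j) \<partial>(lborel :: 'k::euclidean_space measure))
    = ennreal (unit_ball_vol (real DIM('k)) * real DIM('k) / real (j + DIM('k)) * \<rho> ^ (j + DIM('k)))"
    (is "?A = _")
proof (cases "j = 0")
  \<comment> \<open>For \<open>j = 0\<close> the exponents below would not add up,
    \<open>j - 1\<close> being truncated.\<close>
  case True
  then show ?thesis using \<rho> by (simp add: emeasure_ball)
next
  case False
  define k where "k = DIM('k)"
  define \<omega> where "\<omega> = unit_ball_vol (real k)"
  have \<omega>: "0 < \<omega>" by (simp add: \<omega>_def)
  have k: "0 < k" by (simp add: k_def)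
  have lev: "emeasure lborel {\<zeta> :: 'k \<in> ball 0 \<rho>. norm \<zeta> \<le> a} = ennreal (\<omega> * a ^ k)"
    if "0 \<le> a" "a \<le> \<rho>" for a
  proof (cases "a = \<rho>")
    case True
    have eq: "{\<zeta> :: 'k \<in> ball 0 \<rho>. norm \<zeta> \<le> a} = ball 0 \<rho>" using True by auto
    show ?thesis unfolding eq using \<rho> True by (simp add: emeasure_ball \<omega>_def k_def)
  next
    case False
    then have eq: "{\<zeta> :: 'k \<in> ball 0 \<rho>. norm \<zeta> \<le> a} = cball 0 a" using that by auto
    show ?thesis unfolding eq using that by (simp add: emeasure_cball \<omega>_def k_def)
  qed
  define b where "b = \<omega> * real j / real (j + k) * \<rho> ^ (j + k)"
  have "(\<integral>\<^sup>+\<zeta>. indicator (ball 0 \<rho>) \<zeta> * ennreal (\<rho> ^ j - norm \<zeta> ^ j) \<partial>(lborel :: 'k measure))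
     = (\<integral>\<^sup>+\<zeta>. (\<integral>\<^sup>+a. indicator (ball 0 \<rho>) \<zeta> * (ennreal (real j * a ^ (j - 1)) * indicator {norm \<zeta>..\<rho>} a) \<partial>lborel) \<partial>(lborel :: 'k measure))"
  proof (rule nn_integral_cong)
    fix \<zeta> :: 'k
    have "(\<integral>\<^sup>+a. ennreal (real j * a ^ (j - 1)) * indicator {norm \<zeta>..\<rho>} a \<partial>lborel) = ennreal (\<rho> ^ j - norm \<zeta> ^ j)"
      if "norm \<zeta> < \<rho>"
    proof (rule nn_integral_FTC_Icc)
      fix x assume "x \<in> {norm \<zeta>..\<rho>}"
      then have "0 \<le> x" using norm_ge_zero[of \<zeta>] by (auto simp del: norm_ge_zero)
      then show "0 \<le> real j * x ^ (j - 1)" by simp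
    qed (use that in \<open>auto intro!: derivative_eq_intros\<close>)
    then show "indicator (ball 0 \<rho>) \<zeta> * ennreal (\<rho> ^ j - norm \<zeta> ^ j) =
        (\<integral>\<^sup>+a. indicator (ball 0 \<rho>) \<zeta> * (ennreal (real j * a ^ (j - 1)) * indicator {norm \<zeta>..\<rho>} a) \<partial>lborel)"
      by (cases "norm \<zeta> < \<rho>") auto
  qed
  also have "\<dots> = (\<integral>\<^sup>+a. (\<integral>\<^sup>+\<zeta>. indicator (ball 0 \<rho>) \<zeta> * (ennreal (real j * a ^ (j - 1)) * indicator {norm \<zeta>..\<rho>} a) \<partial>(lborel :: 'k measure)) \<partial>lborel)"
    by (rule lborel_pair.Fubini') (simp add: indicator_def case_prod_unfold)
  also have "\<dots> = (\<integral>\<^sup>+a. ennreal (\<omega> * (real j * a ^ (j + k - 1))) * indicator {0..\<rho>} a \<partial>lborel)"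
  proof (rule nn_integral_cong)
    fix a :: real
    show "(\<integral>\<^sup>+\<zeta>. indicator (ball 0 \<rho>) \<zeta> * (ennreal (real j * a ^ (j - 1)) * indicator {norm \<zeta>..\<rho>} a) \<partial>(lborel :: 'k measure))
      = ennreal (\<omega> * (real j * a ^ (j + k - 1))) * indicator {0..\<rho>} a"
    proof (cases "0 \<le> a \<and> a \<le> \<rho>")
      case True
      have "(\<integral>\<^sup>+\<zeta>. indicator (ball 0 \<rho>) \<zeta> * (ennreal (real j * a ^ (j - 1)) * indicator {norm \<zeta>..\<rho>} a) \<partial>(lborel :: 'k measure))
        = (\<integral>\<^sup>+\<zeta>. ennreal (real j * a ^ (j - 1)) * indicator {\<zeta> \<in> ball 0 \<rho>. norm \<zeta> \<le> a} \<zeta> \<partial>(lborel :: 'k measure))"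
        using True by (intro nn_integral_cong) (auto simp: indicator_def)
      also have "\<dots> = ennreal (real j * a ^ (j - 1)) * ennreal (\<omega> * a ^ k)"
      proof -
        have "{\<zeta> :: 'k \<in> ball 0 \<rho>. norm \<zeta> \<le> a} \<in> sets lborel" by simp
        from nn_integral_cmult_indicator[OF this] show ?thesis using lev[of a] True by simp
      qed
      also have "\<dots> = ennreal (\<omega> * (real j * (a ^ (j - 1) * a ^ k)))"
        using True \<omega> by (simp add: ennreal_mult[symmetric] mult_ac)
      also have "a ^ (j - 1) * a ^ k = a ^ (j + k - 1)" using False by (simp add: power_add[symmetric])
      finally show ?thesis using True by simp
    next
      case F: False
      have z: "indicator (ball 0 \<rho>) \<zeta> * (ennreal (real j * a ^ (j - 1)) * indicator {norm \<zeta>..\<rho>} a) = 0" for \<zeta> :: 'k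
        using F norm_ge_zero[of \<zeta>] by (auto simp: indicator_def simp del: norm_ge_zero)
      have "a \<notin> {0..\<rho>}" using F by auto
      then show ?thesis unfolding z by simp
    qed
  qed
  also have "\<dots> = ennreal (b - \<omega> * real j / real (j + k) * 0 ^ (j + k))"
    unfolding b_def using \<omega> \<rho> k False
    by (intro nn_integral_FTC_Icc) (auto intro!: derivative_eq_intros)
  finally have Beq: "(\<integral>\<^sup>+\<zeta>. indicator (ball 0 \<rho>) \<zeta> * ennreal (\<rho> ^ j - norm \<zeta> ^ j) \<partial>(lborel :: 'k measure)) = ennreal b"
    using k by (simp add: zero_power)
  have b: "0 \<le> b" using \<omega> \<rho> by (simp add: b_def)
  have "?A + ennreal b = (\<integral>\<^sup>+\<zeta>. indicator (ball 0 \<rho>) \<zeta> * ennreal (norm \<zeta> ^ j)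
      + indicator (ball 0 \<rho>) \<zeta> * ennreal (\<rho> ^ j - norm \<zeta> ^ j) \<partial>(lborel :: 'k measure))"
    unfolding Beq[symmetric]
    by (rule nn_integral_add[symmetric]) (auto intro!: borel_measurable_times_ennreal borel_measurable_indicator)
  also have "\<dots> = (\<integral>\<^sup>+\<zeta>. ennreal (\<rho> ^ j) * indicator (ball 0 \<rho>) \<zeta> \<partial>(lborel :: 'k measure))"
  proof (rule nn_integral_cong)
    fix \<zeta> :: 'k
    show "indicator (ball 0 \<rho>) \<zeta> * ennreal (norm \<zeta> ^ j) + indicator (ball 0 \<rho>) \<zeta> * ennreal (\<rho> ^ j - norm \<zeta> ^ j)
      = ennreal (\<rho> ^ j) * indicator (ball 0 \<rho>) \<zeta>"
    proof (cases "norm \<zeta> < \<rho>")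
      case True
      then have "norm \<zeta> ^ j \<le> \<rho> ^ j" by (intro power_mono) auto
      then have "ennreal (norm \<zeta> ^ j) + ennreal (\<rho> ^ j - norm \<zeta> ^ j) = ennreal (\<rho> ^ j)"
        by (subst ennreal_plus[symmetric]) auto
      then show ?thesis using True by simp
    qed auto
  qed
  also have "\<dots> = ennreal (\<omega> * \<rho> ^ (j + k))"
    using \<rho> \<omega> by (simp add: nn_integral_cmult_indicator emeasure_ball \<omega>_def k_def ennreal_mult[symmetric] power_add mult_ac)
  finally have eq: "?A + ennreal b = ennreal (\<omega> * \<rho> ^ (j + k))" .
  \<comment> \<open>Finiteness of \<open>?A\<close> permits subtracting \<open>b\<close> in the
    reals.\<close>
  then have "?A \<noteq> \<infinity>" by (auto simp: top_unique)
  then obtain x where x: "?A = ennreal x" "0 \<le> x" by (cases ?A) auto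
  then have "x + b = \<omega> * \<rho> ^ (j + k)"
    using eq b \<omega> \<rho> by (simp add: ennreal_plus[symmetric] del: ennreal_plus)
  moreover have "\<omega> * \<rho> ^ (j + k) - b = \<omega> * real k / real (j + k) * \<rho> ^ (j + k)"
    using k by (simp add: b_def field_simps)
  ultimately have "x = \<omega> * real k / real (j + k) * \<rho> ^ (j + k)" by simp
  then show ?thesis unfolding x(1) by (simp add: \<omega>_def k_def)
qed

section \<open>Polar estimates and similarities for a homogeneous measure\<close>

context homogeneous_measure
begin

lemma space_\<mu> [simp]: "space \<mu> = UNIV"
  using sets_eq_imp_space_eq[OF sets_\<mu>] by simp

lemma sigma_finite_\<mu>: "sigma_finite_measure \<mu>"
proof
  have "\<exists>n::nat. x \<in> ball 0 (real n)" for x :: 'a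
    using reals_Archimedean2[of "norm x"] by simp
  then have "\<Union> (range (\<lambda>n::nat. ball 0 (real n))) = (UNIV :: 'a set)" by blast
  then show "\<exists>A. countable A \<and> A \<subseteq> sets \<mu> \<and> \<Union> A = space \<mu> \<and> (\<forall>a\<in>A. emeasure \<mu> a \<noteq> \<infinity>)"
    using ball_finite by (intro exI[of _ "range (\<lambda>n::nat. ball 0 (real n))"]) (auto simp: less_top)
qed

lemma emeasure_affine:
  assumes "c \<in> G" "t \<noteq> 0" and A: "A \<in> sets borel"
  shows "emeasure \<mu> A = ennreal (\<bar>t\<bar> ^ N) * emeasure \<mu> ((\<lambda>x. c + t *\<^sub>R x) -` A)"
proof -
  have [measurable]: "(\<lambda>x. c + t *\<^sub>R x) -` A \<in> sets borel"
    using measurable_sets_borel[of "\<lambda>x. c + t *\<^sub>R x" borel A] A by simp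
  have "emeasure \<mu> A = (\<integral>\<^sup>+x. indicator A x \<partial>\<mu>)" using A by simp
  also have "\<dots> = ennreal (\<bar>t\<bar> ^ N) * (\<integral>\<^sup>+x. indicator A (c + t *\<^sub>R x) \<partial>\<mu>)"
    using assms by (intro affine) auto
  also have "(\<integral>\<^sup>+x. indicator A (c + t *\<^sub>R x) \<partial>\<mu>) = (\<integral>\<^sup>+x. indicator ((\<lambda>x. c + t *\<^sub>R x) -` A) x \<partial>\<mu>)"
    by (intro nn_integral_cong) (simp add: indicator_def)
  finally show ?thesis by simp
qed

lemma emeasure_ball_affine:
  assumes "c \<in> G" "0 < t"
  shows "emeasure \<mu> (ball c (t * r)) = ennreal (t ^ N) * emeasure \<mu> (ball 0 r)"
proof -
  have "(\<lambda>x. c + t *\<^sub>R x) -` ball c (t * r) = ball 0 r"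
    using assms(2) by (auto simp: dist_norm)
  then show ?thesis using emeasure_affine[of c t "ball c (t * r)"] assms by simp
qed

text \<open>Polar coordinates without a measure on the sphere. The indicator of a set
  \<open>F\<close> is averaged along the orbits \<open>act \<zeta> x\<close> of the points of a
  shell, with weight \<open>norm \<zeta> ^ (N - k)\<close>. The substitution
  \<open>y = act \<zeta> x\<close> turns the total into a constant multiple of the measure of
  \<open>F\<close>, with the same constant for \<open>E\<close> and for the ball, so that the two
  can be compared orbit by orbit. The factor \<open>N / k\<close> is the price for replacing the
  weight on the orbit part of \<open>E\<close> by its maximum.\<close>

lemma emeasure_polar_le:
  fixes act :: "'k::euclidean_space \<Rightarrow> 'a \<Rightarrow> 'a"
  assumes act_meas [measurable]: "(\<lambda>p. act (fst p) (snd p)) \<in> borel_measurable (borel \<Otimes>\<^sub>M borel)"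
    and norm_act: "\<And>\<zeta> x. norm (act \<zeta> x) = norm \<zeta> * norm x"
    and act_scale: "\<And>\<zeta> f. \<zeta> \<noteq> 0 \<Longrightarrow> f \<in> borel_measurable borel \<Longrightarrow>
      (\<integral>\<^sup>+x. f x \<partial>\<mu>) = ennreal (norm \<zeta> ^ N) * (\<integral>\<^sup>+x. f (act \<zeta> x) \<partial>\<mu>)"
    and kN: "DIM('k) \<le> N"
    and E [measurable]: "E \<in> sets borel" and ER: "E \<subseteq> ball 0 R - {0}" and R: "0 < R" and q: "0 \<le> q"
    and fib: "\<And>x. x \<in> G \<Longrightarrow> x \<noteq> 0 \<Longrightarrow>
      emeasure lborel {\<zeta> \<in> ball 0 (R / norm x). act \<zeta> x \<in> E}
        \<le> ennreal (q * (unit_ball_vol (real DIM('k)) * (R / norm x) ^ DIM('k)))"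
  shows "ennreal (real DIM('k)) * emeasure \<mu> E \<le> ennreal (q * real N) * emeasure \<mu> (ball 0 R)"
proof -
  interpret sigma_finite_measure \<mu> by (rule sigma_finite_\<mu>)
  interpret P: pair_sigma_finite \<mu> "lborel :: 'k measure" ..
  define k where "k = DIM('k)"
  define \<omega> where "\<omega> = unit_ball_vol (real k)"
  have \<omega>: "0 < \<omega>" by (simp add: \<omega>_def)
  have k: "0 < k" by (simp add: k_def)
  have N: "0 < N" "k \<le> N" using kN k unfolding k_def by linarith+
  have am [measurable]: "(\<lambda>p. act (snd p) (fst p)) \<in> borel_measurable (borel \<Otimes>\<^sub>M borel)"
    "(\<lambda>\<zeta>. act \<zeta> x) \<in> borel_measurable borel" "act \<zeta> \<in> borel_measurable borel" for x \<zeta>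
  proof -
    have "(\<lambda>p. (snd p, fst p)) \<in> measurable (borel \<Otimes>\<^sub>M borel) (borel \<Otimes>\<^sub>M (borel :: 'a measure))"
      "(\<lambda>\<zeta>. (\<zeta>, x)) \<in> measurable borel (borel \<Otimes>\<^sub>M borel)"
      "(\<lambda>x. (\<zeta>, x)) \<in> measurable borel (borel \<Otimes>\<^sub>M borel)" by measurable
    from this[THEN measurable_compose[OF _ act_meas]]
    show "(\<lambda>p. act (snd p) (fst p)) \<in> borel_measurable (borel \<Otimes>\<^sub>M borel)"
      "(\<lambda>\<zeta>. act \<zeta> x) \<in> borel_measurable borel" "act \<zeta> \<in> borel_measurable borel"
      by simp_all
  qed
  \<comment> \<open>The restriction of \<open>r / norm \<zeta>\<close> to a shell keeps
    \<open>norm \<zeta>\<close> away from 0 and from infinity, so that \<open>\<kappa> r\<close> is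
    finite and positive for \<open>r > 0\<close>.\<close>
  define \<kappa> where "\<kappa> r = (\<integral>\<^sup>+\<zeta>. indicator {1..2} (r / norm \<zeta>) * ennreal (1 / norm \<zeta> ^ k) \<partial>(lborel :: 'k measure))" for r :: real
  define I where "I F x = (\<integral>\<^sup>+\<zeta>. indicator F (act \<zeta> x) * indicator {1..2} (norm x) * ennreal (norm \<zeta> ^ (N - k)) \<partial>(lborel :: 'k measure))" for F x
  have I_meas [measurable]: "I F \<in> borel_measurable \<mu>" if [measurable]: "F \<in> sets borel" for F
    unfolding I_def by (rule lborel.borel_measurable_nn_integral) (simp add: case_prod_unfold)
  have T: "(\<integral>\<^sup>+x. I F x \<partial>\<mu>) = (\<integral>\<^sup>+y. indicator F y * \<kappa> (norm y) \<partial>\<mu>)" if [measurable]: "F \<in> sets borel" for F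
  proof -
    have "(\<integral>\<^sup>+x. I F x \<partial>\<mu>) = (\<integral>\<^sup>+\<zeta>. (\<integral>\<^sup>+x. indicator F (act \<zeta> x) * indicator {1..2} (norm x) * ennreal (norm \<zeta> ^ (N - k)) \<partial>\<mu>) \<partial>lborel)"
      unfolding I_def by (rule P.Fubini'[symmetric]) (simp add: case_prod_unfold)
    also have "\<dots> = (\<integral>\<^sup>+\<zeta>. (\<integral>\<^sup>+y. indicator F y * (indicator {1..2} (norm y / norm \<zeta>) * ennreal (1 / norm \<zeta> ^ k)) \<partial>\<mu>) \<partial>(lborel :: 'k measure))"
    proof (rule nn_integral_cong_AE)
      \<comment> \<open>The scalar 0 collapses everything and must be left out of the substitution;
        it is a null set.\<close>
      have "AE \<zeta> in lborel. \<zeta> \<noteq> (0::'k)" by (rule AE_lborel_singleton)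
      then show "AE \<zeta> in lborel. (\<integral>\<^sup>+x. indicator F (act \<zeta> x) * indicator {1..2} (norm x) * ennreal (norm \<zeta> ^ (N - k)) \<partial>\<mu>)
        = (\<integral>\<^sup>+y. indicator F y * (indicator {1..2} (norm y / norm \<zeta>) * ennreal (1 / norm \<zeta> ^ k)) \<partial>\<mu>)"
      proof eventually_elim
        case (elim \<zeta>)
        have "(\<integral>\<^sup>+y. indicator F y * (indicator {1..2} (norm y / norm \<zeta>) * ennreal (1 / norm \<zeta> ^ k)) \<partial>\<mu>)
          = ennreal (norm \<zeta> ^ N) * (\<integral>\<^sup>+x. indicator F (act \<zeta> x) * (indicator {1..2} (norm (act \<zeta> x) / norm \<zeta>) * ennreal (1 / norm \<zeta> ^ k)) \<partial>\<mu>)"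
          by (rule act_scale[OF elim]) simp
        also have "\<dots> = (\<integral>\<^sup>+x. ennreal (norm \<zeta> ^ N) * (indicator F (act \<zeta> x) * (indicator {1..2} (norm (act \<zeta> x) / norm \<zeta>) * ennreal (1 / norm \<zeta> ^ k))) \<partial>\<mu>)"
          by (rule nn_integral_cmult[symmetric]) simp
        also have "\<dots> = (\<integral>\<^sup>+x. indicator F (act \<zeta> x) * indicator {1..2} (norm x) * ennreal (norm \<zeta> ^ (N - k)) \<partial>\<mu>)"
        proof (rule nn_integral_cong)
          fix x
          have "norm \<zeta> ^ N * (1 / norm \<zeta> ^ k) = norm \<zeta> ^ (N - k)"
            using N elim by (simp add: power_diff)
          then have eq: "ennreal (norm \<zeta> ^ (N - k)) = ennreal (norm \<zeta> ^ N) * ennreal (1 / norm \<zeta> ^ k)"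
            by (simp add: ennreal_mult[symmetric])
          show "ennreal (norm \<zeta> ^ N) * (indicator F (act \<zeta> x) * (indicator {1..2} (norm (act \<zeta> x) / norm \<zeta>) * ennreal (1 / norm \<zeta> ^ k)))
            = indicator F (act \<zeta> x) * indicator {1..2} (norm x) * ennreal (norm \<zeta> ^ (N - k))"
            unfolding eq using elim by (simp add: norm_act mult_ac)
        qed
        finally show ?case by simp
      qed
    qed
    also have "\<dots> = (\<integral>\<^sup>+y. (\<integral>\<^sup>+\<zeta>. indicator F y * (indicator {1..2} (norm y / norm \<zeta>) * ennreal (1 / norm \<zeta> ^ k)) \<partial>(lborel :: 'k measure)) \<partial>\<mu>)"
      by (rule P.Fubini') (simp add: case_prod_unfold)
    also have "\<dots> = (\<integral>\<^sup>+y. indicator F y * \<kappa> (norm y) \<partial>\<mu>)"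
      unfolding \<kappa>_def by (intro nn_integral_cong nn_integral_cmult) simp
    finally show ?thesis .
  qed
  \<comment> \<open>Lebesgue measure with density \<open>1 / norm \<zeta> ^ k\<close> is invariant
    under dilations.\<close>
  have \<kappa>: "\<kappa> r = \<kappa> 1" if "0 < r" for r
  proof -
    have "\<kappa> r = ennreal (\<bar>r\<bar> ^ DIM('k)) * (\<integral>\<^sup>+\<zeta>. indicator {1..2} (r / norm (r *\<^sub>R \<zeta>)) * ennreal (1 / norm (r *\<^sub>R \<zeta>) ^ k) \<partial>(lborel :: 'k measure))"
      unfolding \<kappa>_def using that by (intro nn_integral_lborel_scale) auto
    also have "\<dots> = (\<integral>\<^sup>+\<zeta>. ennreal (\<bar>r\<bar> ^ DIM('k)) * (indicator {1..2} (r / norm (r *\<^sub>R \<zeta>)) * ennreal (1 / norm (r *\<^sub>R \<zeta>) ^ k)) \<partial>(lborel :: 'k measure))"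
      by (rule nn_integral_cmult[symmetric]) simp
    also have "\<dots> = \<kappa> 1"
      unfolding \<kappa>_def
    proof (rule nn_integral_cong)
      fix \<zeta> :: 'k
      have eq: "ennreal (1 / norm \<zeta> ^ k) = ennreal (\<bar>r\<bar> ^ DIM('k)) * ennreal (1 / norm (r *\<^sub>R \<zeta>) ^ k)"
        using that by (simp add: ennreal_mult[symmetric] k_def power_mult_distrib)
      show "ennreal (\<bar>r\<bar> ^ DIM('k)) * (indicator {1..2} (r / norm (r *\<^sub>R \<zeta>)) * ennreal (1 / norm (r *\<^sub>R \<zeta>) ^ k))
        = indicator {1..2} (1 / norm \<zeta>) * ennreal (1 / norm \<zeta> ^ k)"
        unfolding eq using that by (simp add: mult_ac)
    qed
    finally show ?thesis .
  qed
  \<comment> \<open>The origin is the only point with a different constant. \<open>E\<close> omits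
    it, so the constant comes out of the integral over \<open>E\<close> exactly; for the ball an
    upper bound remains, which is the direction required.\<close>
  have \<kappa>0: "\<kappa> 0 = 0" by (simp add: \<kappa>_def)
  have \<kappa>fin: "\<kappa> 1 < \<infinity>"
  proof -
    have "\<kappa> 1 \<le> (\<integral>\<^sup>+\<zeta>. ennreal (2 ^ k) * indicator (cball 0 1) \<zeta> \<partial>(lborel :: 'k measure))"
      unfolding \<kappa>_def
    proof (rule nn_integral_mono)
      fix \<zeta> :: 'k
      show "indicator {1..2} (1 / norm \<zeta>) * ennreal (1 / norm \<zeta> ^ k) \<le> ennreal (2 ^ k) * indicator (cball 0 1) \<zeta>"
      proof (cases "1 / norm \<zeta> \<in> {1..2}")
        case True
        then have "0 < norm \<zeta>" by (cases "norm \<zeta> = 0") auto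
        then have "norm \<zeta> \<le> 1" using True by (simp add: le_divide_eq)
        moreover have "(1 / norm \<zeta>) ^ k \<le> 2 ^ k" using True by (intro power_mono) auto
        ultimately show ?thesis using True by (simp add: power_one_over ennreal_leI)
      qed simp
    qed
    also have "\<dots> < \<infinity>" by (simp add: nn_integral_cmult_indicator emeasure_cball ennreal_mult_less_top)
    finally show ?thesis .
  qed
  have \<kappa>pos: "0 < \<kappa> 1"
  proof -
    have "0 < \<omega> * (1 - (1/2) ^ k)" using \<omega> k by (simp add: power_less_one_iff)
    then have "0 < ennreal (\<omega> * (1 - (1/2) ^ k))" by simp
    also have "ennreal (\<omega> * (1 - (1/2) ^ k)) = emeasure lborel (cball (0::'k) 1) - emeasure lborel (ball (0::'k) (1/2))"
      using \<omega> by (simp add: emeasure_cball emeasure_ball \<omega>_def k_def ennreal_minus right_diff_distrib)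
    also have "\<dots> = emeasure lborel (cball (0::'k) 1 - ball 0 (1/2))"
      by (rule emeasure_Diff[symmetric]) (auto simp: emeasure_ball)
    also have "\<dots> = (\<integral>\<^sup>+\<zeta>. indicator (cball 0 1 - ball 0 (1/2)) \<zeta> \<partial>(lborel :: 'k measure))" by simp
    also have "\<dots> \<le> \<kappa> 1"
      unfolding \<kappa>_def
    proof (rule nn_integral_mono)
      fix \<zeta> :: 'k
      show "indicator (cball 0 1 - ball 0 (1/2)) \<zeta> \<le> indicator {1..2} (1 / norm \<zeta>) * ennreal (1 / norm \<zeta> ^ k)"
      proof (cases "\<zeta> \<in> cball 0 1 - ball 0 (1/2)")
        case True
        then have z: "1/2 \<le> norm \<zeta>" "norm \<zeta> \<le> 1" by auto
        then have "1 / norm \<zeta> \<in> {1..2}" by (auto simp: le_divide_eq divide_le_eq)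
        moreover have "1 \<le> 1 / norm \<zeta> ^ k" using z by (auto simp: le_divide_eq power_le_one intro!: zero_less_power)
        ultimately show ?thesis using True by (simp add: ennreal_leI del: divide_le_eq_1 le_divide_eq_1)
      qed simp
    qed
    finally show ?thesis .
  qed
  have pt: "AE x in \<mu>. ennreal (real k) * I E x \<le> ennreal (q * real N) * I (ball 0 R) x"
    using AE_G
  proof eventually_elim
    case (elim x)
    show ?case
    proof (cases "norm x \<in> {1..2}")
      case True
      then have x: "0 < norm x" "x \<noteq> 0" by auto
      define \<rho> where "\<rho> = R / norm x"
      have \<rho>: "0 < \<rho>" using x R by (simp add: \<rho>_def)
      have "I E x \<le> (\<integral>\<^sup>+\<zeta>. ennreal (\<rho> ^ (N - k)) * indicator {\<zeta> \<in> ball 0 \<rho>. act \<zeta> x \<in> E} \<zeta> \<partial>lborel)"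
        unfolding I_def
      proof (rule nn_integral_mono)
        fix \<zeta>
        show "indicator E (act \<zeta> x) * indicator {1..2} (norm x) * ennreal (norm \<zeta> ^ (N - k))
          \<le> ennreal (\<rho> ^ (N - k)) * indicator {\<zeta> \<in> ball 0 \<rho>. act \<zeta> x \<in> E} \<zeta>"
        proof (cases "act \<zeta> x \<in> E")
          case T: True
          then have "norm \<zeta> * norm x < R" using ER norm_act by force
          then have z: "norm \<zeta> < \<rho>" using x by (simp add: \<rho>_def less_divide_eq)
          then have "norm \<zeta> ^ (N - k) \<le> \<rho> ^ (N - k)" by (intro power_mono) auto
          then show ?thesis using T True z by (simp add: ennreal_leI)
        qed simp
      qed
      also have "\<dots> = ennreal (\<rho> ^ (N - k)) * emeasure lborel {\<zeta> \<in> ball 0 \<rho>. act \<zeta> x \<in> E}"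
        by (rule nn_integral_cmult_indicator) measurable
      also have "\<dots> \<le> ennreal (\<rho> ^ (N - k)) * ennreal (q * (\<omega> * \<rho> ^ k))"
        using fib[OF elim x(2)] by (intro mult_left_mono) (auto simp: \<rho>_def \<omega>_def k_def)
      also have "\<dots> = ennreal (q * (\<omega> * (\<rho> ^ (N - k) * \<rho> ^ k)))"
        using \<rho> q \<omega> by (simp add: ennreal_mult[symmetric] mult_ac)
      also have "\<rho> ^ (N - k) * \<rho> ^ k = \<rho> ^ N" using N by (simp add: power_add[symmetric])
      finally have "ennreal (real k) * I E x \<le> ennreal (real k) * ennreal (q * (\<omega> * \<rho> ^ N))"
        by (rule mult_left_mono) simp
      also have "\<dots> = ennreal (q * real N) * ennreal (\<omega> * real k / real N * \<rho> ^ N)"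
        using q \<omega> \<rho> N by (simp add: ennreal_mult[symmetric] mult_ac)
      also have "ennreal (\<omega> * real k / real N * \<rho> ^ N) = (\<integral>\<^sup>+\<zeta>. indicator (ball 0 \<rho>) \<zeta> * ennreal (norm \<zeta> ^ (N - k)) \<partial>(lborel :: 'k measure))"
        using N by (subst nn_integral_norm_power_ball[OF \<rho>]) (simp add: \<omega>_def k_def)
      also have "\<dots> = I (ball 0 R) x"
        unfolding I_def
      proof (rule nn_integral_cong)
        fix \<zeta> :: 'k
        have "act \<zeta> x \<in> ball 0 R \<longleftrightarrow> \<zeta> \<in> ball 0 \<rho>" using x by (simp add: norm_act \<rho>_def less_divide_eq)
        then show "indicator (ball 0 \<rho>) \<zeta> * ennreal (norm \<zeta> ^ (N - k))
          = indicator (ball 0 R) (act \<zeta> x) * indicator {1..2} (norm x) * ennreal (norm \<zeta> ^ (N - k))"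
          using True by (simp add: indicator_def)
      qed
      finally show ?thesis .
    qed (simp add: I_def)
  qed
  have "\<kappa> 1 * (ennreal (real k) * emeasure \<mu> E) = ennreal (real k) * (\<integral>\<^sup>+y. indicator E y * \<kappa> 1 \<partial>\<mu>)"
    by (subst nn_integral_multc) (auto simp: mult_ac)
  also have "(\<integral>\<^sup>+y. indicator E y * \<kappa> 1 \<partial>\<mu>) = (\<integral>\<^sup>+y. indicator E y * \<kappa> (norm y) \<partial>\<mu>)"
  proof (rule nn_integral_cong)
    fix y show "indicator E y * \<kappa> 1 = indicator E y * \<kappa> (norm y)"
    proof (cases "y \<in> E")
      case True
      then have "0 < norm y" using ER by auto
      from \<kappa>[OF this] show ?thesis by simp
    qed simp
  qed
  also have "\<dots> = (\<integral>\<^sup>+x. I E x \<partial>\<mu>)" by (rule T[symmetric]) fact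
  also have "ennreal (real k) * (\<integral>\<^sup>+x. I E x \<partial>\<mu>) = (\<integral>\<^sup>+x. ennreal (real k) * I E x \<partial>\<mu>)"
    by (rule nn_integral_cmult[symmetric]) simp
  also have "\<dots> \<le> (\<integral>\<^sup>+x. ennreal (q * real N) * I (ball 0 R) x \<partial>\<mu>)"
    by (rule nn_integral_mono_AE[OF pt])
  also have "\<dots> = ennreal (q * real N) * (\<integral>\<^sup>+x. I (ball 0 R) x \<partial>\<mu>)"
    by (rule nn_integral_cmult) simp
  also have "(\<integral>\<^sup>+x. I (ball 0 R) x \<partial>\<mu>) = (\<integral>\<^sup>+y. indicator (ball 0 R) y * \<kappa> (norm y) \<partial>\<mu>)" by (rule T) simp
  also have "\<dots> \<le> (\<integral>\<^sup>+y. indicator (ball 0 R) y * \<kappa> 1 \<partial>\<mu>)"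
  proof (rule nn_integral_mono)
    fix y :: 'a
    have "\<kappa> (norm y) \<le> \<kappa> 1" using \<kappa>[of "norm y"] \<kappa>0 by (cases "y = 0") auto
    then show "indicator (ball 0 R) y * \<kappa> (norm y) \<le> indicator (ball 0 R) y * \<kappa> 1" by (rule mult_left_mono) simp
  qed
  also have "\<dots> = emeasure \<mu> (ball 0 R) * \<kappa> 1"
    by (subst nn_integral_multc) (auto intro!: borel_measurable_indicator)
  also have "ennreal (q * real N) * (emeasure \<mu> (ball 0 R) * \<kappa> 1) = \<kappa> 1 * (ennreal (q * real N) * emeasure \<mu> (ball 0 R))"
    by (simp add: mult_ac)
  finally have "\<kappa> 1 * (ennreal (real k) * emeasure \<mu> E) \<le> \<kappa> 1 * (ennreal (q * real N) * emeasure \<mu> (ball 0 R))"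
    by (simp add: mult_left_mono)
  then show ?thesis
    using \<kappa>pos \<kappa>fin by (simp add: ennreal_mult_le_mult_iff k_def)
qed

text \<open>Both \<open>\<mu>\<close> and its image under a similarity are translation invariant; Fubini's theorem
  shows that such measures are proportional.\<close>

lemma nn_integral_similarity:
  assumes G: "G = UNIV" and L: "linear L" "surj L" and c: "0 < c" "\<And>x. norm (L x) = c * norm x"
    and f [measurable]: "f \<in> borel_measurable borel"
  shows "(\<integral>\<^sup>+x. f x \<partial>\<mu>) = ennreal (c ^ N) * (\<integral>\<^sup>+x. f (L x) \<partial>\<mu>)"
proof -
  have Lm [measurable]: "L \<in> borel_measurable borel"
    by (intro borel_measurable_continuous_onI linear_continuous_on linear_conv_bounded_linear[THEN iffD1] L)
  define \<nu> where "\<nu> = distr \<mu> borel L"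
  have sets_\<nu> [measurable_cong, simp]: "sets \<nu> = sets borel" "space \<nu> = UNIV" by (auto simp: \<nu>_def)
  have \<nu>ball: "emeasure \<nu> (ball 0 r) = emeasure \<mu> (ball 0 (r / c))" for r
  proof -
    have "L -` ball 0 r = ball 0 (r / c)" using c by (auto simp: less_divide_eq mult.commute)
    then show ?thesis unfolding \<nu>_def by (subst emeasure_distr) auto
  qed
  interpret M: sigma_finite_measure \<mu> by (rule sigma_finite_\<mu>)
  interpret N: sigma_finite_measure \<nu>
  proof
    have "\<exists>n::nat. x \<in> ball 0 (real n)" for x :: 'a
      using reals_Archimedean2[of "norm x"] by simp
    then have "\<Union> (range (\<lambda>n::nat. ball 0 (real n))) = (UNIV :: 'a set)" by blast
    then show "\<exists>A. countable A \<and> A \<subseteq> sets \<nu> \<and> \<Union> A = space \<nu> \<and> (\<forall>a\<in>A. emeasure \<nu> a \<noteq> \<infinity>)"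
      using ball_finite by (intro exI[of _ "range (\<lambda>n::nat. ball 0 (real n))"]) (auto simp: less_top \<nu>ball)
  qed
  interpret P: pair_sigma_finite \<mu> \<nu> ..
  have transl: "(\<integral>\<^sup>+x. h (x - y) \<partial>\<nu>) = (\<integral>\<^sup>+x. h x \<partial>\<nu>)" if [measurable]: "h \<in> borel_measurable borel" for h y
  proof -
    \<comment> \<open>By surjectivity every translation is the image under \<open>L\<close> of a
      translation, so \<open>\<nu>\<close> inherits the invariance of \<open>\<mu>\<close>.\<close>
    obtain y' where y': "- y = L y'" using L(2) by (metis surjD)
    have "(\<integral>\<^sup>+x. h (x - y) \<partial>\<nu>) = (\<integral>\<^sup>+x. h (L x - y) \<partial>\<mu>)"
      unfolding \<nu>_def by (subst nn_integral_distr) auto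
    also have "\<dots> = (\<integral>\<^sup>+x. h (L (y' + 1 *\<^sub>R x)) \<partial>\<mu>)"
      using y' by (intro nn_integral_cong) (simp add: linear_add[OF L(1)] y'[symmetric])
    also have "\<dots> = (\<integral>\<^sup>+x. h (L x) \<partial>\<mu>)"
      using affine[of y' 1 "\<lambda>x. h (L x)"] G by simp
    also have "\<dots> = (\<integral>\<^sup>+x. h x \<partial>\<nu>)"
      unfolding \<nu>_def by (subst nn_integral_distr) auto
    finally show ?thesis .
  qed
  \<comment> \<open>The case \<open>t = -1\<close> of \<open>affine\<close>, a point
    reflection.\<close>
  have refl: "(\<integral>\<^sup>+x. h (y - x) \<partial>\<mu>) = (\<integral>\<^sup>+x. h x \<partial>\<mu>)" if "h \<in> borel_measurable borel" for h y
    using affine[of y "-1" h] G that by simp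
  define B where "B = (ball 0 1 :: 'a set)"
  have [measurable]: "B \<in> sets borel" by (simp add: B_def)
  \<comment> \<open>The preimage of the unit ball under \<open>L\<close> is the ball of radius
    \<open>1 / c\<close>, which determines the constant of proportionality.\<close>
  have B: "emeasure \<mu> B = ennreal (c ^ N) * emeasure \<nu> B"
    using emeasure_ball_affine[of 0 c "1 / c"] G c by (simp add: B_def \<nu>ball)
  have Bfin: "0 < emeasure \<nu> B" "emeasure \<nu> B < \<infinity>"
    using c ball_pos ball_finite by (simp_all add: B_def \<nu>ball)
  have proportional: "emeasure \<mu> E = ennreal (c ^ N) * emeasure \<nu> E" if [measurable]: "E \<in> sets borel" for E
  proof -
    have "emeasure \<mu> E * emeasure \<nu> B = (\<integral>\<^sup>+x. indicator E x * emeasure \<nu> B \<partial>\<mu>)"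
      by (subst nn_integral_multc) auto
    also have "\<dots> = (\<integral>\<^sup>+x. (\<integral>\<^sup>+z. indicator E x * indicator B (z - x) \<partial>\<nu>) \<partial>\<mu>)"
    proof (rule nn_integral_cong)
      fix x
      have "(\<integral>\<^sup>+z. indicator E x * indicator B (z - x) \<partial>\<nu>) = indicator E x * (\<integral>\<^sup>+z. indicator B (z - x) \<partial>\<nu>)"
        by (rule nn_integral_cmult) simp
      also have "(\<integral>\<^sup>+z. indicator B (z - x) \<partial>\<nu>) = (\<integral>\<^sup>+z. indicator B z \<partial>\<nu>)"
        by (rule transl) simp
      finally show "indicator E x * emeasure \<nu> B = (\<integral>\<^sup>+z. indicator E x * indicator B (z - x) \<partial>\<nu>)" by simp
    qed
    also have "\<dots> = (\<integral>\<^sup>+z. (\<integral>\<^sup>+x. indicator E x * indicator B (z - x) \<partial>\<mu>) \<partial>\<nu>)"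
      by (rule P.Fubini'[symmetric]) (simp add: case_prod_unfold)
    \<comment> \<open>Replacing \<open>x\<close> by \<open>z - x\<close> interchanges the roles of
      \<open>E\<close> and \<open>B\<close>, so that the integral over \<open>z\<close> now produces
      the measure of \<open>E\<close> under \<open>\<nu>\<close>.\<close>
    also have "\<dots> = (\<integral>\<^sup>+z. (\<integral>\<^sup>+x. indicator E (z - x) * indicator B x \<partial>\<mu>) \<partial>\<nu>)"
    proof (rule nn_integral_cong)
      fix z
      show "(\<integral>\<^sup>+x. indicator E x * indicator B (z - x) \<partial>\<mu>) = (\<integral>\<^sup>+x. indicator E (z - x) * indicator B x \<partial>\<mu>)"
        using refl[of "\<lambda>x. indicator E x * indicator B (z - x)" z] by simp
    qed
    also have "\<dots> = (\<integral>\<^sup>+x. (\<integral>\<^sup>+z. indicator E (z - x) * indicator B x \<partial>\<nu>) \<partial>\<mu>)"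
      by (rule P.Fubini') (simp add: case_prod_unfold)
    also have "\<dots> = (\<integral>\<^sup>+x. emeasure \<nu> E * indicator B x \<partial>\<mu>)"
    proof (rule nn_integral_cong)
      fix x
      have "(\<integral>\<^sup>+z. indicator E (z - x) * indicator B x \<partial>\<nu>) = (\<integral>\<^sup>+z. indicator E (z - x) \<partial>\<nu>) * indicator B x"
        by (rule nn_integral_multc) simp
      also have "(\<integral>\<^sup>+z. indicator E (z - x) \<partial>\<nu>) = (\<integral>\<^sup>+z. indicator E z \<partial>\<nu>)"
        by (rule transl) simp
      finally show "(\<integral>\<^sup>+z. indicator E (z - x) * indicator B x \<partial>\<nu>) = emeasure \<nu> E * indicator B x" by simp
    qed
    also have "\<dots> = emeasure \<nu> E * emeasure \<mu> B" by (rule nn_integral_cmult_indicator) simp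
    also have "\<dots> = emeasure \<nu> B * (ennreal (c ^ N) * emeasure \<nu> E)" unfolding B by (simp add: mult_ac)
    finally have "emeasure \<nu> B * emeasure \<mu> E = emeasure \<nu> B * (ennreal (c ^ N) * emeasure \<nu> E)" by (simp add: mult.commute)
    then show ?thesis using Bfin by (auto simp: ennreal_mult_cancel_left)
  qed
  have "\<mu> = scale_measure (ennreal (c ^ N)) \<nu>"
    by (rule measure_eqI) (auto simp: proportional)
  then have "(\<integral>\<^sup>+x. f x \<partial>\<mu>) = (\<integral>\<^sup>+x. f x \<partial>scale_measure (ennreal (c ^ N)) \<nu>)" by simp
  also have "\<dots> = ennreal (c ^ N) * (\<integral>\<^sup>+x. f x \<partial>\<nu>)" by (rule nn_integral_scale_measure) simp
  also have "(\<integral>\<^sup>+x. f x \<partial>\<nu>) = (\<integral>\<^sup>+x. f (L x) \<partial>\<mu>)"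
    unfolding \<nu>_def by (subst nn_integral_distr) auto
  finally show ?thesis .
qed

end

subsection \<open>Sublevel sets of functions of logarithmic growth\<close>

lemma norm_vector_scalar_mult: "norm (\<zeta> *s (x :: complex ^ 'n)) = norm \<zeta> * norm x"
  by (simp add: norm_vec_def norm_mult L2_set_right_distrib)

lemma of_real_scalar_mult: "of_real t *s (x :: complex ^ 'n) = t *\<^sub>R x"
  by (simp add: vec_eq_iff) (simp add: scaleR_conv_of_real)

lemma continuous_on_scalar_mult:
  fixes f :: "'a::topological_space \<Rightarrow> complex" and g :: "'a \<Rightarrow> complex ^ 'n"
  assumes "continuous_on S f" "continuous_on S g"
  shows "continuous_on S (\<lambda>x. f x *s g x)"
  unfolding vector_scalar_mult_def using assms by (intro continuous_intros)

locale log_growth =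
  fixes u :: "complex ^ 'n \<Rightarrow> ereal" and C d :: real
  assumes psh: "psh u" and d: "0 < d"
    and growth: "\<And>z. u z \<le> ereal (C + d * ln (max 1 (norm z)))"
begin

lemma usc: "usc u"
  using psh by (simp add: psh_def)

lemma not_PInf: "u z \<noteq> \<infinity>"
  using psh by (force simp: psh_def)

lemma line_subharmonic: "subharmonic (\<lambda>\<zeta>. u (a + \<zeta> *s b))"
  using psh by (simp add: psh_def)

text \<open>On a complex line the growth rate \<open>d\<close> is unchanged; base point and
  direction enter only the additive constant, which the estimates of sublevel sets do not
  contain.\<close>

lemma line_growth:
  "u (a + \<zeta> *s b) \<le> ereal (C + d * ln (1 + norm a + norm b) + d * ln (max 1 (norm \<zeta>)))"
proof -
  define A where "A = 1 + norm a + norm b"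
  have A: "1 \<le> A" by (simp add: A_def)
  have "norm (a + \<zeta> *s b) \<le> norm a + norm \<zeta> * norm b"
    using norm_triangle_ineq[of a "\<zeta> *s b"] by (simp add: norm_vector_scalar_mult)
  also have "\<dots> \<le> norm a * max 1 (norm \<zeta>) + max 1 (norm \<zeta>) * norm b"
    by (intro add_mono mult_right_mono) (auto simp: mult_le_cancel_left1)
  also have "\<dots> \<le> A * max 1 (norm \<zeta>)" by (simp add: A_def algebra_simps)
  finally have "max 1 (norm (a + \<zeta> *s b)) \<le> A * max 1 (norm \<zeta>)"
    using A mult_mono[of 1 A 1 "max 1 (norm \<zeta>)"] by simp
  then have "ln (max 1 (norm (a + \<zeta> *s b))) \<le> ln (A * max 1 (norm \<zeta>))"
    by (intro ln_mono) auto
  also have "\<dots> = ln A + ln (max 1 (norm \<zeta>))" using A by (intro ln_mult_pos) auto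
  finally have "C + d * ln (max 1 (norm (a + \<zeta> *s b))) \<le> C + d * (ln A + ln (max 1 (norm \<zeta>)))"
    using d by (intro add_left_mono mult_left_mono) auto
  then show ?thesis
    using order_trans[OF growth[of "a + \<zeta> *s b"]] by (simp add: A_def algebra_simps)
qed

text \<open>A real segment has positive length, so \<open>bernstein_walsh\<close> applies with the
  segment as \<open>K\<close> and with any level, however low; this rules out a finite value
  elsewhere on the line.\<close>

lemma line_eq_MInf:
  assumes "0 < \<epsilon>" and inf: "\<And>t::real. \<bar>t\<bar> \<le> \<epsilon> \<Longrightarrow> u (a + of_real t *s b) = -\<infinity>"
  shows "u (a + \<zeta> *s b) = -\<infinity>"
proof (rule ccontr)
  interpret isometric_line "of_real :: real \<Rightarrow> complex" by (rule isometric_line_of_real)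
  assume "u (a + \<zeta> *s b) \<noteq> -\<infinity>"
  then obtain y where y: "u (a + \<zeta> *s b) = ereal y"
    using not_PInf by (cases "u (a + \<zeta> *s b)") auto
  \<comment> \<open>The level \<open>y - \<bar>X\<bar> - 1\<close> is below \<open>y\<close> and
    remains so after adding \<open>X\<close>.\<close>
  define X where "X = d * (ln (norm \<zeta> + \<epsilon>) - ln \<epsilon> + 1 / real DIM(real))"
  have "u (a + \<zeta> *s b) \<le> ereal ((y - \<bar>X\<bar> - 1) + X)"
    unfolding X_def
  proof (rule bernstein_walsh[OF line_subharmonic d line_growth, where K = "{-\<epsilon>..\<epsilon>}"])
    show "measure lborel {-\<epsilon>..\<epsilon>} = unit_ball_vol (real DIM(real)) * \<epsilon> ^ DIM(real)"
      using assms(1) by simp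
    fix w :: real assume w: "w \<in> {-\<epsilon>..\<epsilon>}"
    then have "\<bar>w\<bar> \<le> \<epsilon>" by auto
    then show "u (a + of_real w *s b) < ereal (y - \<bar>d * (ln (norm \<zeta> + \<epsilon>) - ln \<epsilon> + 1 / real DIM(real))\<bar> - 1)"
      using inf[of w] by simp
    show "norm (\<zeta> - of_real w) \<le> norm \<zeta> + \<epsilon>"
      using norm_triangle_ineq4[of \<zeta> "of_real w"] \<open>\<bar>w\<bar> \<le> \<epsilon>\<close> by simp
  qed (use assms(1) y in auto)
  then show False using y by simp
qed

text \<open>The value minus infinity would spread twice: from the ball to all of \<open>G\<close>
  along real lines through \<open>c\<close>, and then to the whole space along the complex lines
  \<open>x + \<zeta> *s y\<close> with \<open>x\<close> and \<open>y\<close> in \<open>G\<close>,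
  whose real points lie in \<open>G\<close>. Genericity says that the points with
  \<open>\<zeta> = \<i>\<close> are all points.\<close>

lemma not_MInf_on_ball:
  assumes G: "generic_subspace G" and c: "c \<in> G" and r: "0 < r" and ne: "u z0 \<noteq> -\<infinity>"
  shows "\<exists>x\<in>ball c r \<inter> G. u x \<noteq> -\<infinity>"
proof (rule ccontr)
  assume "\<not> ?thesis"
  then have inf: "\<And>x. x \<in> ball c r \<Longrightarrow> x \<in> G \<Longrightarrow> u x = -\<infinity>" by blast
  have sub: "subspace G" using G by (simp add: generic_subspace_def)
  have infG: "u y = -\<infinity>" if y: "y \<in> G" for y
  proof -
    \<comment> \<open>Parameters up to \<open>e\<close> move the point by at most
      \<open>r / 2\<close>; the summand 1 covers \<open>y = c\<close>.\<close>
    define e where "e = r / 2 / (1 + norm (y - c))"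
    have pos: "0 < 1 + norm (y - c)" by (simp add: add_pos_nonneg)
    have e: "0 < e" using r pos by (simp add: e_def)
    have "u (c + 1 *s (y - c)) = -\<infinity>"
    proof (rule line_eq_MInf[OF e])
      fix t :: real assume t: "\<bar>t\<bar> \<le> e"
      have "\<bar>t\<bar> * norm (y - c) \<le> e * (1 + norm (y - c))" using t e by (intro mult_mono) auto
      also have "\<dots> = r / 2" using pos e_def by (metis less_irrefl nonzero_eq_divide_eq)
      also have "\<dots> < r" using r by simp
      finally have "norm (of_real t *s (y - c)) < r" unfolding norm_vector_scalar_mult by simp
      moreover have "dist c (c + v) = norm v" for v :: "complex ^ 'n" by (simp add: dist_norm)
      ultimately have "c + of_real t *s (y - c) \<in> ball c r" unfolding mem_ball by metis
      moreover have "c + of_real t *s (y - c) \<in> G"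
        unfolding of_real_scalar_mult using sub c y by (intro subspace_add subspace_scale subspace_diff)
      ultimately show "u (c + of_real t *s (y - c)) = -\<infinity>" by (rule inf)
    qed
    then show ?thesis by simp
  qed
  have "z0 \<in> {x + J y | x y. x \<in> G \<and> y \<in> G}" using G by (simp add: generic_subspace_def)
  then obtain x y where xy: "z0 = x + J y" "x \<in> G" "y \<in> G" by blast
  have "u (x + \<i> *s y) = -\<infinity>"
  proof (rule line_eq_MInf[of 1])
    fix t :: real
    show "u (x + of_real t *s y) = -\<infinity>"
      unfolding of_real_scalar_mult using sub xy by (intro infG subspace_add subspace_scale)
  qed simp
  then show False using ne xy(1) by (simp add: J_def)
qed

lemma attains_max:
  assumes G: "generic_subspace G" and c: "c \<in> G" and r: "0 < r" and ne: "u z0 \<noteq> -\<infinity>"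
  obtains x0 M where "x0 \<in> cball c r \<inter> G" "u x0 = ereal M" "\<And>x. x \<in> cball c r \<inter> G \<Longrightarrow> u x \<le> ereal M"
proof -
  have "closed G" using G by (intro closed_subspace) (simp add: generic_subspace_def)
  then have "compact (cball c r \<inter> G)" by (intro compact_Int_closed compact_cball)
  moreover have "cball c r \<inter> G \<noteq> {}" using centre_in_cball[of c r] c r by (metis IntI empty_iff less_imp_le)
  moreover have "\<exists>U. open U \<and> {x \<in> cball c r \<inter> G. u x < a} = cball c r \<inter> G \<inter> U" for a
    using usc by (intro exI[of _ "{x. u x < a}"]) (auto simp: usc_def)
  ultimately have "\<exists>x0\<in>cball c r \<inter> G. \<forall>x\<in>cball c r \<inter> G. u x \<le> u x0"
    by (rule compact_attains_usc)
  then obtain x0 where x0: "x0 \<in> cball c r \<inter> G" "\<And>x. x \<in> cball c r \<inter> G \<Longrightarrow> u x \<le> u x0" by blast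
  obtain x where "x \<in> ball c r \<inter> G" "u x \<noteq> -\<infinity>" using not_MInf_on_ball[OF G c r ne] by blast
  then have "u x \<le> u x0" "u x \<noteq> -\<infinity>" using x0(2)[of x] ball_subset_cball[of c r] by blast+
  then obtain M where "u x0 = ereal M" using not_PInf[of x0] by (cases "u x0") auto
  then show thesis using x0 that by metis
qed

end

text \<open>Scalars from the line act by multiplication: real scalars for any \<open>G\<close>,
  complex scalars for the whole space. The assumption \<open>act_scale\<close> is the change of
  variables that \<open>emeasure_polar_le\<close> asks for.\<close>

locale polar_action = isometric_line \<iota> + homogeneous_measure G \<mu> N + log_growth u C d
  for \<iota> :: "'k::euclidean_space \<Rightarrow> complex" and G :: "(complex ^ 'n) set" and \<mu> N and u :: "complex ^ 'n \<Rightarrow> ereal" and C d +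
  assumes \<iota>0: "\<iota> 0 = 0"
    and act_scale: "\<And>\<zeta> f. \<zeta> \<noteq> 0 \<Longrightarrow> f \<in> borel_measurable borel \<Longrightarrow>
      (\<integral>\<^sup>+x. f x \<partial>\<mu>) = ennreal (norm \<zeta> ^ N) * (\<integral>\<^sup>+x. f (\<iota> \<zeta> *s x) \<partial>\<mu>)"
    and dim_le: "DIM('k) \<le> N"
begin

lemma norm_\<iota>: "norm (\<iota> \<zeta>) = norm \<zeta>"
  using isometry[of \<zeta> 0] \<iota>0 by simp

text \<open>Along each orbit the set is a sublevel set of the subharmonic function
  \<open>u (x0 + \<iota> \<zeta> *s x)\<close> of \<open>\<zeta>\<close>, with the value
  \<open>M\<close> at the origin whatever \<open>x\<close> is; \<open>sublevel_le\<close> bounds its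
  share of the orbit by \<open>exp (1 - k * s / d)\<close>.\<close>

lemma sublevel_ball_le:
  assumes M: "u x0 = ereal M" and s: "0 \<le> s" and R: "0 < R"
  shows "ennreal (real DIM('k)) * emeasure \<mu> {x \<in> ball 0 R. u (x0 + x) < ereal (M - s)}
    \<le> ennreal (exp (1 - real DIM('k) * s / d) * real N) * emeasure \<mu> (ball 0 R)"
proof (rule emeasure_polar_le[where act = "\<lambda>\<zeta> x. \<iota> \<zeta> *s x"])
  show "(\<lambda>p. \<iota> (fst p) *s snd p) \<in> borel_measurable (borel \<Otimes>\<^sub>M (borel :: (complex ^ 'n) measure))"
    unfolding borel_prod
    by (intro borel_measurable_continuous_onI continuous_on_scalar_mult
        continuous_on_compose2[OF continuous_on_embedding[of UNIV]] continuous_intros) auto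
  show "norm (\<iota> \<zeta> *s x) = norm \<zeta> * norm x" for \<zeta> and x :: "complex ^ 'n"
    by (simp add: norm_vector_scalar_mult norm_\<iota>)
  have "usc (\<lambda>x. u (x0 + x))"
    by (rule usc_compose[OF usc]) (intro continuous_intros)
  then have "open (ball 0 R \<inter> {x. u (x0 + x) < ereal (M - s)})" unfolding usc_def by blast
  moreover have "ball 0 R \<inter> {x. u (x0 + x) < ereal (M - s)} = {x \<in> ball 0 R. u (x0 + x) < ereal (M - s)}" by auto
  ultimately show "{x \<in> ball 0 R. u (x0 + x) < ereal (M - s)} \<in> sets borel" by (metis borel_open)
  \<comment> \<open>The origin is excluded because \<open>u x0 = M\<close> is not below
    \<open>M - s\<close>.\<close>
  show "{x \<in> ball 0 R. u (x0 + x) < ereal (M - s)} \<subseteq> ball 0 R - {0}" using M s by auto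
  fix x :: "complex ^ 'n" assume "x \<noteq> 0"
  then have x: "0 < norm x" by simp
  have "{\<zeta> \<in> ball 0 (R / norm x). \<iota> \<zeta> *s x \<in> {x \<in> ball 0 R. u (x0 + x) < ereal (M - s)}}
    = {\<zeta> \<in> ball 0 (R / norm x). u (x0 + \<iota> \<zeta> *s x) < ereal (M - s)}"
    using x by (auto simp: norm_vector_scalar_mult norm_\<iota> less_divide_eq)
  moreover have "emeasure lborel {\<zeta> \<in> ball 0 (R / norm x). u (x0 + \<iota> \<zeta> *s x) < ereal (M - s)}
    \<le> ennreal (unit_ball_vol (real DIM('k)) * (R / norm x) ^ DIM('k) * exp (1 - real DIM('k) * s / d))"
    using x R s M \<iota>0 by (intro sublevel_le[OF line_subharmonic d line_growth]) auto
  ultimately show "emeasure lborel {\<zeta> \<in> ball 0 (R / norm x). \<iota> \<zeta> *s x \<in> {x \<in> ball 0 R. u (x0 + x) < ereal (M - s)}}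
    \<le> ennreal (exp (1 - real DIM('k) * s / d) * (unit_ball_vol (real DIM('k)) * (R / norm x) ^ DIM('k)))"
    by (simp only: mult_ac)
qed (use act_scale dim_le R in auto)

text \<open>The factor \<open>2 ^ N\<close> is the cost of passing to the ball of radius
  \<open>2 * r\<close> about \<open>x0\<close>, \<open>N / k\<close> comes from the polar estimate,
  and \<open>exp 1\<close> from the term \<open>1 / k\<close> in the bound for the
  potential.\<close>

lemma sublevel_fraction_le:
  assumes c: "c \<in> G" and r: "0 < r" and x0: "x0 \<in> cball c r \<inter> G" and M: "u x0 = ereal M" and s: "0 \<le> s"
  shows "emeasure \<mu> {x \<in> ball c r. u x < ereal (M - s)}
    \<le> ennreal (real N * 2 ^ N * exp 1 / real DIM('k) * exp (- (real DIM('k) / d * s))) * emeasure \<mu> (ball c r)"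
proof -
  define k where "k = DIM('k)"
  have k: "0 < k" by (simp add: k_def)
  define A where "A = {x \<in> ball x0 (2 * r). u x < ereal (M - s)}"
  define E where "E = {x \<in> ball 0 (2 * r). u (x0 + x) < ereal (M - s)}"
  have "open (ball x0 (2 * r) \<inter> {x. u x < ereal (M - s)})" using usc unfolding usc_def by blast
  moreover have "ball x0 (2 * r) \<inter> {x. u x < ereal (M - s)} = A" by (auto simp: A_def)
  ultimately have A: "A \<in> sets borel" by (metis borel_open)
  have "{x \<in> ball c r. u x < ereal (M - s)} \<subseteq> A"
  proof
    fix x assume x: "x \<in> {x \<in> ball c r. u x < ereal (M - s)}"
    have "dist x0 x \<le> dist c x0 + dist c x" by (rule dist_triangle3)
    also have "\<dots> < r + r" using x x0 by (intro add_le_less_mono) auto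
    finally show "x \<in> A" using x by (simp add: A_def)
  qed
  then have "emeasure \<mu> {x \<in> ball c r. u x < ereal (M - s)} \<le> emeasure \<mu> A" using A by (intro emeasure_mono) auto
  also have "\<dots> = emeasure \<mu> ((\<lambda>x. x0 + 1 *\<^sub>R x) -` A)"
    using emeasure_affine[of x0 1 A] x0 A by simp
  also have "(\<lambda>x. x0 + 1 *\<^sub>R x) -` A = E" by (auto simp: A_def E_def dist_norm)
  finally have le: "emeasure \<mu> {x \<in> ball c r. u x < ereal (M - s)} \<le> emeasure \<mu> E" .
  have "emeasure \<mu> E = ennreal (1 / real k) * (ennreal (real k) * emeasure \<mu> E)"
    using k by (simp add: mult.assoc[symmetric] ennreal_mult[symmetric])
  also have "\<dots> \<le> ennreal (1 / real k) * (ennreal (exp (1 - real k * s / d) * real N) * emeasure \<mu> (ball 0 (2 * r)))"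
    unfolding E_def k_def using M s r by (intro mult_left_mono sublevel_ball_le) auto
  also have "emeasure \<mu> (ball 0 (2 * r)) = ennreal (2 ^ N) * emeasure \<mu> (ball 0 r)"
    using emeasure_ball_affine[of 0 2 r] subspace_0[OF subspace_G] by simp
  also have "emeasure \<mu> (ball 0 r) = emeasure \<mu> (ball c r)"
    using emeasure_ball_affine[of c 1 r] c by simp
  also have "ennreal (1 / real k) * (ennreal (exp (1 - real k * s / d) * real N) * (ennreal (2 ^ N) * emeasure \<mu> (ball c r)))
    = ennreal (1 / real k * (exp (1 - real k * s / d) * real N) * 2 ^ N) * emeasure \<mu> (ball c r)"
    by (simp add: ennreal_mult[symmetric] mult.assoc[symmetric])
  also have "1 / real k * (exp (1 - real k * s / d) * real N) * 2 ^ N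
    = real N * 2 ^ N * exp 1 / real k * exp (- (real k / d * s))"
    by (simp add: exp_diff exp_minus field_simps)
  finally show ?thesis using le unfolding k_def by (rule order_trans[rotated])
qed

text \<open>Layer cake with two bounds for the share of the sublevel set: 1 up to \<open>s0\<close>,
  and exponential decay beyond. The total is \<open>s0 + 1 / b\<close>; the 2 consists of this
  \<open>1 / b\<close> and of the factor \<open>exp 1\<close> inside \<open>Q\<close>.\<close>

lemma excess_integral_le:
  assumes c: "c \<in> G" and r: "0 < r" and x0: "x0 \<in> cball c r \<inter> G" and M: "u x0 = ereal M"
  shows "(\<integral>\<^sup>+x. indicator (ball c r) x * e2ennreal (ereal M - u x) \<partial>\<mu>)
    \<le> ennreal (d / real DIM('k) * (2 + ln (real N * 2 ^ N / real DIM('k)))) * emeasure \<mu> (ball c r)"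
proof -
  define k where "k = DIM('k)"
  have k: "0 < k" by (simp add: k_def)
  define b where "b = real k / d"
  have b: "0 < b" using k d by (simp add: b_def)
  define Q where "Q = real N * 2 ^ N * exp 1 / real k"
  have Nk: "real k \<le> real N" using dim_le by (simp add: k_def)
  have "1 * 1 * 1 \<le> real N / real k * 2 ^ N * exp 1"
    using Nk k by (intro mult_mono) (auto simp: le_divide_eq)
  then have Q: "1 \<le> Q" by (simp add: Q_def)
  \<comment> \<open>The level at which the exponential bound \<open>Q * exp (- (b * s))\<close> has
    dropped to 1.\<close>
  define s0 where "s0 = ln Q / b"
  have s0: "0 \<le> s0" using Q b by (simp add: s0_def)
  define f where "f x = (if x \<in> ball c r then ereal M - u x else 0)" for x
  have [measurable]: "u \<in> borel_measurable borel" using usc by (rule usc_borel_measurable)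
  have [measurable]: "ball c r \<in> sets borel" by simp
  have f: "f \<in> borel_measurable \<mu>" unfolding f_def by measurable
  have lev: "{x \<in> space \<mu>. ereal s < f x} = {x \<in> ball c r. u x < ereal (M - s)}" if "0 \<le> s" for s
  proof -
    have "ereal s < ereal M - u x \<longleftrightarrow> u x < ereal (M - s)" for x by (cases "u x") auto
    then show ?thesis using that by (auto simp: f_def)
  qed
  have "(\<integral>\<^sup>+x. indicator (ball c r) x * e2ennreal (ereal M - u x) \<partial>\<mu>) = (\<integral>\<^sup>+x. e2ennreal (f x) \<partial>\<mu>)"
    by (intro nn_integral_cong) (auto simp: f_def e2ennreal_neg)
  also have "\<dots> = (\<integral>\<^sup>+s. indicator {0..} s * emeasure \<mu> {x \<in> space \<mu>. ereal s < f x} \<partial>lborel)"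
    by (rule nn_integral_layer_cake[OF sigma_finite_\<mu> f])
  also have "\<dots> \<le> (\<integral>\<^sup>+s. (indicator {0..s0} s + ennreal Q * (indicator {s0..} s * ennreal (exp (- (b * s))))) * emeasure \<mu> (ball c r) \<partial>lborel)"
  proof (rule nn_integral_mono)
    fix s :: real
    consider "s < 0" | "0 \<le> s" "s \<le> s0" | "0 \<le> s" "s0 < s" by linarith
    then show "indicator {0..} s * emeasure \<mu> {x \<in> space \<mu>. ereal s < f x}
      \<le> (indicator {0..s0} s + ennreal Q * (indicator {s0..} s * ennreal (exp (- (b * s))))) * emeasure \<mu> (ball c r)"
    proof cases
      case 2
      have "indicator {0..} s * emeasure \<mu> {x \<in> space \<mu>. ereal s < f x} = emeasure \<mu> {x \<in> ball c r. u x < ereal (M - s)}"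
        using 2 lev by simp
      also have "\<dots> \<le> 1 * emeasure \<mu> (ball c r)" unfolding mult_1 by (intro emeasure_mono) auto
      also have "\<dots> \<le> (indicator {0..s0} s + ennreal Q * (indicator {s0..} s * ennreal (exp (- (b * s))))) * emeasure \<mu> (ball c r)"
        using 2 by (intro mult_right_mono) auto
      finally show ?thesis .
    next
      case 3
      have "indicator {0..} s * emeasure \<mu> {x \<in> space \<mu>. ereal s < f x} = emeasure \<mu> {x \<in> ball c r. u x < ereal (M - s)}"
        using 3 lev by simp
      also have "\<dots> \<le> ennreal (Q * exp (- (b * s))) * emeasure \<mu> (ball c r)"
        unfolding Q_def b_def k_def by (rule sublevel_fraction_le[OF c r x0 M 3(1)])
      also have "ennreal (Q * exp (- (b * s))) = indicator {0..s0} s + ennreal Q * (indicator {s0..} s * ennreal (exp (- (b * s))))"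
        using 3 Q by (simp add: ennreal_mult)
      finally show ?thesis .
    qed simp
  qed
  also have "\<dots> = (\<integral>\<^sup>+s. indicator {0..s0} s + ennreal Q * (indicator {s0..} s * ennreal (exp (- (b * s)))) \<partial>lborel) * emeasure \<mu> (ball c r)"
    by (rule nn_integral_multc) measurable
  also have "(\<integral>\<^sup>+s. indicator {0..s0} s + ennreal Q * (indicator {s0..} s * ennreal (exp (- (b * s)))) \<partial>lborel)
    = (\<integral>\<^sup>+s. indicator {0..s0} s \<partial>lborel) + (\<integral>\<^sup>+s. ennreal Q * (indicator {s0..} s * ennreal (exp (- (b * s)))) \<partial>lborel)"
    by (rule nn_integral_add) measurable
  also have "(\<integral>\<^sup>+s. ennreal Q * (indicator {s0..} s * ennreal (exp (- (b * s)))) \<partial>lborel) = ennreal Q * ennreal (exp (- (b * s0)) / b)"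
    by (subst nn_integral_cmult) (auto simp: nn_integral_exp_atLeast[OF b])
  also have "exp (- (b * s0)) = 1 / Q"
    using b Q by (simp add: s0_def exp_minus inverse_eq_divide)
  also have "(\<integral>\<^sup>+s. indicator {0..s0} s \<partial>lborel) + ennreal Q * ennreal (1 / Q / b) = ennreal (s0 + 1 / b)"
    using s0 Q b by (simp add: ennreal_mult[symmetric] ennreal_plus[symmetric] del: ennreal_plus)
  also have "s0 + 1 / b = d / real k * (2 + ln (real N * 2 ^ N / real k))"
  proof -
    have "Q = real N * 2 ^ N / real k * exp 1" by (simp add: Q_def)
    moreover have "0 < real N * 2 ^ N / real k" using Nk k by simp
    ultimately have "ln Q = ln (real N * 2 ^ N / real k) + ln (exp 1)" by (metis exp_gt_zero ln_mult_pos)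
    then show ?thesis using k d by (simp add: s0_def b_def field_simps)
  qed
  finally show ?thesis by (simp add: k_def)
qed

end

subsection \<open>Mean oscillation\<close>

text \<open>Bridge to \<open>coord_measure\<close>: for Borel integrands neither the completion nor
  the restricted sigma-algebra changes the integral.\<close>

lemma nn_integral_subspace_lebesgue:
  assumes "subspace G" and f: "f \<in> borel_measurable borel"
  shows "(\<integral>\<^sup>+x. f x \<partial>subspace_lebesgue G) = (\<integral>\<^sup>+x. f x \<partial>coord_measure (SOME B. orthonormal_basis G B))"
proof -
  define B where "B = (SOME B. orthonormal_basis G B)"
  have B: "orthonormal_basis G B" unfolding B_def by (rule orthonormal_basis_some) fact
  have "(\<integral>\<^sup>+x. f x \<partial>subspace_lebesgue G) = (\<integral>\<^sup>+x. f x \<partial>subspace_lborel G)"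
    by (simp add: subspace_lebesgue_def nn_integral_completion)
  also have "\<dots> = (\<integral>\<^sup>+g. f (coord_sum B g) \<partial>(\<Pi>\<^sub>M b\<in>B. lborel))"
    unfolding subspace_lborel_def Let_def B_def[symmetric] coord_sum_def
    using f by (subst nn_integral_distr) (auto intro!: subspace_coords_measurable B measurable_restrict_space1)
  also have "\<dots> = (\<integral>\<^sup>+x. f x \<partial>coord_measure B)"
    unfolding coord_measure_def using f by (subst nn_integral_distr) auto
  finally show ?thesis by (simp add: B_def)
qed

lemma borel_Int_sets_subspace_lebesgue:
  assumes "A \<in> sets borel" shows "A \<inter> G \<in> sets (subspace_lebesgue G)"
proof -
  have "A \<inter> G \<in> sets (subspace_lborel G)"
    using assms by (auto simp: subspace_lborel_def Let_def sets_restrict_space)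
  then show ?thesis unfolding subspace_lebesgue_def by (rule sets_completionI_sets)
qed

lemma borel_measurable_subspace_lebesgue:
  assumes "f \<in> borel_measurable borel" shows "f \<in> borel_measurable (subspace_lebesgue G)"
proof -
  have "f \<in> measurable (subspace_lborel G) borel"
    using measurable_restrict_space1[OF assms, of G] by (simp add: subspace_lborel_def Let_def cong: measurable_cong_sets)
  then show ?thesis unfolding subspace_lebesgue_def by (rule measurable_completion)
qed

lemma emeasure_subspace_lebesgue:
  assumes "subspace G" and A: "A \<in> sets borel"
  shows "emeasure (subspace_lebesgue G) (A \<inter> G) = emeasure (coord_measure (SOME B. orthonormal_basis G B)) A"
proof -
  have "emeasure (subspace_lebesgue G) (A \<inter> G) = (\<integral>\<^sup>+x. indicator (A \<inter> G) x \<partial>subspace_lebesgue G)"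
    using A by (simp add: borel_Int_sets_subspace_lebesgue)
  also have "\<dots> = (\<integral>\<^sup>+x. indicator A x \<partial>subspace_lebesgue G)"
    by (intro nn_integral_cong) (simp add: indicator_def)
  also have "\<dots> = emeasure (coord_measure (SOME B. orthonormal_basis G B)) A"
    using assms by (subst nn_integral_subspace_lebesgue) auto
  finally show ?thesis .
qed

text \<open>If the mean of \<open>M - u\<close> over a ball is \<open>\<delta>\<close>, then the average of \<open>u\<close> is \<open>M - \<delta>\<close> and
  \<open>\<bar>u - (M - \<delta>)\<bar> \<le> (M - u) + \<delta>\<close>.\<close>

lemma bmo_of_excess:
  fixes u :: "'a::euclidean_space \<Rightarrow> ereal"
  assumes G: "subspace G" and u: "u \<in> borel_measurable borel" and D: "0 \<le> D"
    and meas: "\<And>c r. c \<in> G \<Longrightarrow> 0 < r \<Longrightarrow> 0 < emeasure (subspace_lebesgue G) (ball c r \<inter> G) \<and>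
      emeasure (subspace_lebesgue G) (ball c r \<inter> G) < \<infinity>"
    and excess: "\<And>c r. c \<in> G \<Longrightarrow> 0 < r \<Longrightarrow> \<exists>M::real. (\<forall>x\<in>ball c r \<inter> G. u x \<le> ereal M) \<and>
      (\<integral>\<^sup>+x. e2ennreal (ereal M - u x) * indicator (ball c r \<inter> G) x \<partial>subspace_lebesgue G)
        \<le> ennreal D * emeasure (subspace_lebesgue G) (ball c r \<inter> G)"
  shows "u \<in> bmo G \<and> bmo_norm G u \<le> ennreal (2 * D)"
proof -
  let ?L = "subspace_lebesgue G"
  have [measurable]: "u \<in> borel_measurable ?L" using u by (rule borel_measurable_subspace_lebesgue)
  have S [measurable]: "ball c r \<inter> G \<in> sets ?L" for c r by (rule borel_Int_sets_subspace_lebesgue) simp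
  have loc: "locally_integrable G u"
    unfolding locally_integrable_def
  proof (intro conjI allI impI)
    fix K :: "'a set" assume K: "compact K \<and> K \<subseteq> G"
    then have "bounded K" by (simp add: compact_imp_bounded)
    then obtain r where r: "0 < r" "K \<subseteq> ball 0 r" using bounded_subset_ballD[of K 0] by auto
    have 0: "0 \<in> G" using G by (rule subspace_0)
    obtain M where M: "\<forall>x\<in>ball 0 r \<inter> G. u x \<le> ereal M"
        "(\<integral>\<^sup>+x. e2ennreal (ereal M - u x) * indicator (ball 0 r \<inter> G) x \<partial>?L) \<le> ennreal D * emeasure ?L (ball 0 r \<inter> G)"
      using excess[OF 0 r(1)] by blast
    \<comment> \<open>Where \<open>u x \<le> M\<close>, the absolute value of \<open>u x\<close> is
      at most \<open>(M - u x) + \<bar>M\<bar>\<close>.\<close>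
    have "(\<integral>\<^sup>+x\<in>K. e2ennreal \<bar>u x\<bar> \<partial>?L)
      \<le> (\<integral>\<^sup>+x. e2ennreal (ereal M - u x) * indicator (ball 0 r \<inter> G) x + ennreal \<bar>M\<bar> * indicator (ball 0 r \<inter> G) x \<partial>?L)"
    proof (rule nn_integral_mono)
      fix x
      show "e2ennreal \<bar>u x\<bar> * indicator K x \<le> e2ennreal (ereal M - u x) * indicator (ball 0 r \<inter> G) x + ennreal \<bar>M\<bar> * indicator (ball 0 r \<inter> G) x"
      proof (cases "x \<in> K")
        case True
        then have x: "x \<in> ball 0 r \<inter> G" using r K by auto
        then have "u x \<le> ereal M" using M(1) by blast
        then have "e2ennreal \<bar>u x\<bar> \<le> e2ennreal (ereal M - u x) + ennreal \<bar>M\<bar>"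
          by (cases "u x") (auto simp flip: ennreal_plus simp: ennreal_leI)
        then show ?thesis using True x by simp
      qed simp
    qed
    also have "\<dots> = (\<integral>\<^sup>+x. e2ennreal (ereal M - u x) * indicator (ball 0 r \<inter> G) x \<partial>?L) + ennreal \<bar>M\<bar> * emeasure ?L (ball 0 r \<inter> G)"
      by (subst nn_integral_add) (auto simp: nn_integral_cmult_indicator)
    also have "\<dots> \<le> ennreal D * emeasure ?L (ball 0 r \<inter> G) + ennreal \<bar>M\<bar> * emeasure ?L (ball 0 r \<inter> G)"
      using M(2) by (rule add_right_mono)
    also have "\<dots> < \<infinity>" using meas[OF 0 r(1)] by (simp add: ennreal_mult_less_top)
    finally show "(\<integral>\<^sup>+x\<in>K. e2ennreal \<bar>u x\<bar> \<partial>?L) < \<infinity>" .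
  qed simp
  have osc: "mean_oscillation G u (ball c r \<inter> G) \<le> ennreal (2 * D)" if c: "c \<in> G" and r: "0 < r" for c r
  proof -
    define S where "S = ball c r \<inter> G"
    have S [measurable]: "S \<in> sets ?L" and SG: "S \<inter> G = S" by (auto simp: S_def)
    define m where "m = measure ?L S"
    have em: "emeasure ?L S = ennreal m" "0 < m"
      using meas[OF c r] by (auto simp: m_def S_def emeasure_eq_ennreal_measure measure_def enn2real_positive_iff)
    obtain M where M: "\<And>x. x \<in> S \<Longrightarrow> u x \<le> ereal M"
        "(\<integral>\<^sup>+x. e2ennreal (ereal M - u x) * indicator S x \<partial>?L) \<le> ennreal D * ennreal m"
      using excess[OF c r] em unfolding S_def by metis
    \<comment> \<open>A real version of \<open>M - u\<close> on \<open>S\<close>. Where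
      \<open>u\<close> is minus infinity, \<open>real_of_ereal\<close> gives 0, as it does in
      \<open>average\<close>, so the two fit together exactly; the finite excess makes this a null
      set.\<close>
    define w where "w x = indicator S x * (M - real_of_ereal (u x))" for x
    have [measurable]: "w \<in> borel_measurable ?L" unfolding w_def by measurable
    have "(\<integral>\<^sup>+x. e2ennreal (ereal M - u x) * indicator S x \<partial>?L) < \<infinity>"
      using M(2) by (rule order_le_less_trans) (simp add: ennreal_mult_less_top)
    then have "AE x in ?L. e2ennreal (ereal M - u x) * indicator S x \<noteq> \<infinity>"
      by (intro nn_integral_noteq_infinite) auto
    then have fin: "AE x in ?L. x \<in> S \<longrightarrow> u x = ereal (real_of_ereal (u x))"
    proof eventually_elim
      case (elim x)
      show ?case
      proof
        assume x: "x \<in> S"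
        then show "u x = ereal (real_of_ereal (u x))" using elim M(1)[OF x] by (cases "u x") auto
      qed
    qed
    have weq: "AE x in ?L. e2ennreal (ereal M - u x) * indicator S x = ennreal (w x)"
      using fin
    proof eventually_elim
      case (elim x)
      then show ?case by (cases "x \<in> S"; cases "u x") (auto simp: w_def)
    qed
    have w0: "AE x in ?L. 0 \<le> w x"
      using fin
    proof eventually_elim
      case (elim x)
      then show ?case using M(1)[of x] by (cases "x \<in> S"; cases "u x") (auto simp: w_def)
    qed
    have wnn: "(\<integral>\<^sup>+x. ennreal (w x) \<partial>?L) = (\<integral>\<^sup>+x. e2ennreal (ereal M - u x) * indicator S x \<partial>?L)"
      by (rule nn_integral_cong_AE) (use weq in \<open>auto elim: eventually_mono\<close>)
    have wint: "integrable ?L w"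
      by (rule integrableI_nonneg) (use w0 wnn M(2) in \<open>auto simp: ennreal_mult_less_top elim: order_le_less_trans\<close>)
    define \<delta> where "\<delta> = integral\<^sup>L ?L w / m"
    have wI: "(\<integral>\<^sup>+x. ennreal (w x) \<partial>?L) = ennreal (\<delta> * m)"
      using nn_integral_eq_integral[OF wint w0] em by (simp add: \<delta>_def)
    have \<delta>0: "0 \<le> \<delta>" unfolding \<delta>_def using em(2) integral_nonneg_AE[OF w0] by simp
    have "ennreal (\<delta> * m) \<le> ennreal (D * m)"
      using M(2) wI wnn D em by (simp add: ennreal_mult)
    then have \<delta>D: "\<delta> \<le> D" using D em(2) by (simp add: ennreal_le_iff)
    have "average G u S = M - \<delta>"
    proof -
      have "(LINT x:S|?L. real_of_ereal (u x)) = (\<integral>x. M * indicator S x - w x \<partial>?L)"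
        unfolding set_lebesgue_integral_def
        by (intro Bochner_Integration.integral_cong) (auto simp: w_def indicator_def)
      also have "\<dots> = M * m - \<delta> * m"
        using wint em by (subst Bochner_Integration.integral_diff)
          (auto simp: m_def \<delta>_def SG)
      finally show ?thesis using em(2) by (simp add: average_def m_def[symmetric] field_simps)
    qed
    then have "(\<integral>\<^sup>+x\<in>S. e2ennreal \<bar>u x - ereal (average G u S)\<bar> \<partial>?L)
      \<le> (\<integral>\<^sup>+x. e2ennreal (ereal M - u x) * indicator S x + ennreal \<delta> * indicator S x \<partial>?L)"
    proof (intro nn_integral_mono)
      fix x
      assume av: "average G u S = M - \<delta>"
      show "e2ennreal \<bar>u x - ereal (average G u S)\<bar> * indicator S x \<le> e2ennreal (ereal M - u x) * indicator S x + ennreal \<delta> * indicator S x"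
      proof (cases "x \<in> S")
        case True
        have "e2ennreal \<bar>u x - ereal (M - \<delta>)\<bar> \<le> e2ennreal (ereal M - u x) + ennreal \<delta>"
          using M(1)[OF True] \<delta>0
          by (cases "u x") (auto simp flip: ennreal_plus simp: ennreal_leI)
        then show ?thesis using True av by simp
      qed simp
    qed
    also have "\<dots> = ennreal (\<delta> * m) + ennreal \<delta> * ennreal m"
      by (subst nn_integral_add) (auto simp: nn_integral_cmult_indicator em wI[symmetric] wnn)
    also have "\<dots> = ennreal (2 * \<delta> * m)"
      using \<delta>0 em by (simp add: ennreal_mult[symmetric] ennreal_plus[symmetric] del: ennreal_plus)
    also have "\<dots> \<le> ennreal (2 * D * m)"
      using \<delta>D em(2) by (intro ennreal_leI mult_right_mono) auto
    finally have "mean_oscillation G u S \<le> ennreal (2 * D * m) / ennreal m"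
      unfolding mean_oscillation_def em(1) by (rule divide_right_mono_ennreal)
    also have "\<dots> = ennreal (2 * D)" using em(2) D by (simp add: divide_ennreal)
    finally show ?thesis unfolding S_def .
  qed
  have "bmo_norm G u \<le> ennreal (2 * D)"
    unfolding bmo_norm_def using osc by (intro SUP_least) auto
  then show ?thesis using loc by (auto simp: bmo_def elim: order_le_less_trans)
qed

text \<open>Since \<open>c_const n\<close> equals \<open>2 * n * 4 ^ n / (2 * n choose n)\<close>,
  this bounds the central binomial coefficient by \<open>4 ^ n / 2\<close>. The induction step
  multiplies by \<open>4 * (n + 1)\<^sup>2 / ((2 * n + 1) * (2 * n))\<close>.\<close>

lemma c_const_ge: "1 \<le> n \<Longrightarrow> 4 * real n \<le> c_const n"
proof (induction n rule: nat_induct_at_least)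
  case base
  show ?case by (simp add: c_const_def)
next
  case (Suc n)
  have "fact (2 * n) = (2 * real n) * fact (2 * n - 1)" using Suc by (subst fact_reduce) auto
  then have f: "fact (2 * Suc n - 1) = (2 * real n + 1) * (2 * real n) * fact (2 * n - 1)" by simp
  have "4 * (real n + 1) * ((2 * real n + 1) * (2 * real n)) \<le> 4 * (real n + 1)\<^sup>2 * (4 * real n)"
    by (simp add: power2_eq_square algebra_simps)
  also have "\<dots> \<le> 4 * (real n + 1)\<^sup>2 * c_const n"
    using Suc by (intro mult_left_mono) auto
  finally have "4 * (real n + 1) \<le> 4 * (real n + 1)\<^sup>2 * c_const n / ((2 * real n + 1) * (2 * real n))"
    using Suc by (subst pos_le_divide_eq) auto
  also have "\<dots> = c_const (Suc n)"
    unfolding c_const_def f using Suc by (simp add: power2_eq_square field_simps)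
  finally show ?case by simp
qed

text \<open>The logarithm in \<open>sigma\<close> absorbs \<open>ln N\<close>. As
  \<open>ln 2 < 1\<close> and \<open>N \<le> 2 * n\<close>, the other terms add up to at most
  \<open>4 + 4 * n\<close>, which \<open>8 * (n + m)\<close> absorbs.\<close>

lemma sigma_real_bound:
  assumes "1 \<le> n" "1 \<le> N" "N \<le> 2 * n" "m \<noteq> n"
  shows "2 * (2 + ln (real N * 2 ^ N)) \<le> sigma n m"
proof -
  have "ln (real N * 2 ^ N) = ln (real N) + real N * ln 2"
    using assms by (simp add: ln_mult_pos ln_realpow)
  moreover have "ln (real N) \<le> ln (1 + 8 * real (n + m))" using assms by (intro ln_mono) auto
  moreover have "real N * ln 2 \<le> (2 * real n) * 1"
    using assms ln_2_less_1 by (intro mult_mono) auto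
  moreover have "1 \<le> real n" "real n \<le> real (n + m)" using assms by auto
  ultimately have "2 * (2 + ln (real N * 2 ^ N)) \<le> 2 * ln (1 + 8 * real (n + m)) + 8 * real (n + m)"
    unfolding distrib_left by argo
  then show ?thesis using assms by (simp add: sigma_def)
qed

text \<open>\<open>ln (1 + c_const n)\<close> absorbs \<open>ln (4 * n)\<close>, and
  \<open>c_const n / 2\<close> absorbs the rest, \<open>2 + 2 * (n - 1) * ln 2 \<le> 2 * n\<close>.
  There is little room: for \<open>n = 1\<close> the two sides differ by
  \<open>ln 5 - ln 4\<close>.\<close>

lemma sigma_complex_bound:
  assumes n: "1 \<le> n"
  shows "2 + ln (real n * 4 ^ n) \<le> sigma n n"
proof -
  have c: "4 * real n \<le> c_const n" by (rule c_const_ge[OF n])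
  have ln4: "ln (4::real) = 2 * ln 2" using ln_realpow[of 2 2] by simp
  have "ln (real n * 4 ^ n) = ln (real n) + real n * (2 * ln 2)"
    using n by (simp add: ln_mult_pos ln_realpow ln4)
  moreover have "ln (real n) + 2 * ln 2 \<le> ln (1 + c_const n)"
  proof -
    have "ln (real n) + 2 * ln 2 = ln (real n * 4)" using n by (simp add: ln_mult_pos ln4)
    also have "\<dots> \<le> ln (1 + c_const n)" using n c by (intro ln_mono) auto
    finally show ?thesis .
  qed
  moreover have "0 \<le> (real n - 1) * (1 - ln 2)"
    using n ln_2_less_1 by (intro mult_nonneg_nonneg) auto
  ultimately show ?thesis using c by (simp add: sigma_def algebra_simps)
qed

section \<open>Generic subspaces and the estimate for functions of logarithmic growth\<close>

lemma generic_subspace_dim_pos: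
  fixes G :: "(complex ^ 'n) set"
  assumes "generic_subspace G" shows "1 \<le> dim G"
proof (rule ccontr)
  assume "\<not> ?thesis"
  then have "dim G = 0" by linarith
  then have "G \<subseteq> {0}" by (simp only: eucl.dim_eq_0)
  then have G0: "x = 0" if "x \<in> G" for x using that by auto
  have "{x + J y | x y. x \<in> G \<and> y \<in> G} \<subseteq> {0}"
  proof
    fix w assume "w \<in> {x + J y | x y. x \<in> G \<and> y \<in> G}"
    then obtain x y where "w = x + J y" "x \<in> G" "y \<in> G" by blast
    moreover from this have "x = 0" "y = 0" using G0 by blast+
    ultimately show "w \<in> {0}" by (simp add: J_def)
  qed
  then have "(UNIV :: (complex ^ 'n) set) \<subseteq> {0}" using assms by (simp add: generic_subspace_def)
  moreover have "(vec 1 :: complex ^ 'n) \<noteq> 0" by (simp add: vec_eq_iff)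
  ultimately show False by blast
qed

text \<open>The set \<open>H\<close> is closed under \<open>J\<close>, because \<open>J\<close>
  squared is minus the identity, and hence is a complex subspace; full complex dimension makes it
  everything.\<close>

lemma complex_dim_eq_full:
  fixes G :: "(complex ^ 'n) set"
  assumes G: "subspace G" and full: "complex_dim G = CARD('n)"
  shows "G = UNIV"
proof -
  define H where "H = G \<inter> J ` G"
  have J_add: "J (x + y) = J x + J y" for x y :: "complex ^ 'n"
    by (simp add: J_def vec.scale_right_distrib)
  have J_scale: "J (t *\<^sub>R x) = t *\<^sub>R J x" for t and x :: "complex ^ 'n"
    by (simp add: J_def vec_eq_iff scaleR_conv_of_real)
  have JJ: "J (J x) = - x" for x :: "complex ^ 'n"
    by (simp add: J_def vec_eq_iff)
  have H_add: "x + y \<in> H" if "x \<in> H" "y \<in> H" for x y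
    using that G unfolding H_def by (auto simp: J_add[symmetric] intro: subspace_add)
  have H_scale: "t *\<^sub>R x \<in> H" if "x \<in> H" for t x
    using that G unfolding H_def by (auto simp: J_scale[symmetric] intro: subspace_scale)
  have H_J: "J x \<in> H" if "x \<in> H" for x
    using that G unfolding H_def by (auto simp: JJ intro: subspace_neg)
  have "vec.subspace H"
  proof (rule vec.subspaceI)
    have "J 0 = (0 :: complex ^ 'n)" by (simp add: J_def)
    then show "0 \<in> H" using subspace_0[OF G] unfolding H_def by (metis IntI imageI)
    fix c and x :: "complex ^ 'n" assume x: "x \<in> H"
    have "c *s x = Re c *\<^sub>R x + Im c *\<^sub>R J x"
      by (simp add: vec_eq_iff J_def complex_eq_iff)
    then show "c *s x \<in> H" using x by (simp add: H_add H_scale H_J)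
  qed (rule H_add)
  moreover have "vec.dim H = vec.dim (UNIV :: (complex ^ 'n) set)"
    using full unfolding complex_dim_def H_def vec_dim_card .
  ultimately have "H = UNIV"
    by (intro vec.subspace_dim_equal vec.subspace_UNIV) auto
  then show ?thesis by (auto simp: H_def)
qed

theorem (in log_growth) bmo:
  fixes G :: "(complex ^ 'n) set"
  assumes G: "generic_subspace G" and ne: "u z0 \<noteq> -\<infinity>"
  shows "u \<in> bmo G \<and> bmo_norm G u \<le> ennreal (sigma CARD('n) (complex_dim G) * d)"
proof -
  have sub: "subspace G" using G by (simp add: generic_subspace_def)
  define n where "n = CARD('n)"
  have n: "1 \<le> n" by (simp add: n_def Suc_leI)
  define \<mu> where "\<mu> = coord_measure (SOME B. orthonormal_basis G B)"
  define N where "N = dim G"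
  interpret homogeneous_measure G \<mu> N
    unfolding \<mu>_def N_def by (intro homogeneous_coord_measure sub orthonormal_basis_some)
  have N: "1 \<le> N" using generic_subspace_dim_pos[OF G] by (simp add: N_def)
  have N2: "N \<le> 2 * n" using dim_subset_UNIV[of G] by (simp add: N_def n_def)
  have [measurable]: "u \<in> borel_measurable borel" using usc by (rule usc_borel_measurable)
  \<comment> \<open>Only the bound \<open>D\<close> leaves the case split, so that the two
    interpretations of \<open>polar_action\<close> stay inside it.\<close>
  have "\<exists>D. 0 \<le> D \<and> 2 * D \<le> sigma n (complex_dim G) * d \<and>
    (\<forall>c r x0 M. c \<in> G \<longrightarrow> 0 < r \<longrightarrow> x0 \<in> cball c r \<inter> G \<longrightarrow> u x0 = ereal M \<longrightarrow>
      (\<integral>\<^sup>+x. indicator (ball c r) x * e2ennreal (ereal M - u x) \<partial>\<mu>) \<le> ennreal D * emeasure \<mu> (ball c r))"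
  proof (cases "complex_dim G = n")
    case False
    interpret polar_action of_real G \<mu> N u C d
    proof
      show "norm (complex_of_real x - of_real y) = norm (x - y)" for x y
        using isometric_line_of_real by (rule isometric_line.isometry)
      show "\<exists>x::real. \<forall>w. norm (x - w) \<le> norm (z - of_real w)" for z :: complex
        using isometric_line_of_real by (rule isometric_line.proj)
      fix t :: real and f :: "complex ^ 'n \<Rightarrow> ennreal"
      assume "t \<noteq> 0" "f \<in> borel_measurable borel"
      then show "(\<integral>\<^sup>+x. f x \<partial>\<mu>) = ennreal (norm t ^ N) * (\<integral>\<^sup>+x. f (of_real t *s x) \<partial>\<mu>)"
        using affine[of 0 t f] subspace_0[OF sub] by (simp add: of_real_scalar_mult)
    qed (use N in auto)
    define D where "D = d / real DIM(real) * (2 + ln (real N * 2 ^ N / real DIM(real)))"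
    have "1 * 1 \<le> real N * 2 ^ N" using N by (intro mult_mono) auto
    then have "0 \<le> D" unfolding D_def using d by (intro mult_nonneg_nonneg add_nonneg_nonneg ln_ge_zero) auto
    moreover have "2 * D \<le> sigma n (complex_dim G) * d"
      using mult_right_mono[OF sigma_real_bound[OF n N N2 False], of d] d by (simp add: D_def mult_ac)
    moreover have "\<forall>c r x0 M. c \<in> G \<longrightarrow> 0 < r \<longrightarrow> x0 \<in> cball c r \<inter> G \<longrightarrow> u x0 = ereal M \<longrightarrow>
      (\<integral>\<^sup>+x. indicator (ball c r) x * e2ennreal (ereal M - u x) \<partial>\<mu>) \<le> ennreal D * emeasure \<mu> (ball c r)"
      unfolding D_def by (intro allI impI, rule excess_integral_le)
    ultimately show ?thesis by blast
  next
    case True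
    have U: "G = UNIV" using complex_dim_eq_full[OF sub] True by (simp add: n_def)
    then have N2n: "N = 2 * n" by (simp add: N_def n_def)
    interpret polar_action "\<lambda>z. z" G \<mu> N u C d
    proof
      show "\<exists>x::complex. \<forall>w. norm (x - w) \<le> norm (z - w)" for z by blast
      fix \<zeta> :: complex and f :: "complex ^ 'n \<Rightarrow> ennreal"
      assume \<zeta>: "\<zeta> \<noteq> 0" and f: "f \<in> borel_measurable borel"
      show "(\<integral>\<^sup>+x. f x \<partial>\<mu>) = ennreal (norm \<zeta> ^ N) * (\<integral>\<^sup>+x. f (\<zeta> *s x) \<partial>\<mu>)"
      \<comment> \<open>Multiplication by \<open>\<zeta>\<close> is a similarity of ratio
        \<open>norm \<zeta>\<close>.\<close>
      proof (rule nn_integral_similarity[OF U])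
        show "linear (\<lambda>x :: complex ^ 'n. \<zeta> *s x)"
          by (rule linearI) (simp_all add: vec.scale_right_distrib vec_eq_iff)
        have "x = \<zeta> *s ((1 / \<zeta>) *s x)" for x :: "complex ^ 'n" using \<zeta> by simp
        then show "surj (\<lambda>x :: complex ^ 'n. \<zeta> *s x)" by (metis surjI)
      qed (use \<zeta> f in \<open>auto simp: norm_vector_scalar_mult\<close>)
    qed (use n N2n in auto)
    define D where "D = d / real DIM(complex) * (2 + ln (real N * 2 ^ N / real DIM(complex)))"
    \<comment> \<open>With \<open>N = 2 * n\<close> and \<open>k = 2\<close> the dimension factor
      \<open>N / k\<close> is \<open>n\<close>, and \<open>2 ^ N\<close> is
      \<open>4 ^ n\<close>.\<close>
    have eq: "real N * 2 ^ N / real DIM(complex) = real n * 4 ^ n"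
      by (simp add: N2n power_mult)
    have "1 * 1 \<le> real n * 4 ^ n" using n by (intro mult_mono) auto
    then have "0 \<le> D" unfolding D_def eq using d by (intro mult_nonneg_nonneg add_nonneg_nonneg ln_ge_zero) auto
    moreover have "2 * D \<le> sigma n (complex_dim G) * d"
      using mult_right_mono[OF sigma_complex_bound[OF n], of d] d True unfolding D_def eq by (simp add: mult_ac)
    moreover have "\<forall>c r x0 M. c \<in> G \<longrightarrow> 0 < r \<longrightarrow> x0 \<in> cball c r \<inter> G \<longrightarrow> u x0 = ereal M \<longrightarrow>
      (\<integral>\<^sup>+x. indicator (ball c r) x * e2ennreal (ereal M - u x) \<partial>\<mu>) \<le> ennreal D * emeasure \<mu> (ball c r)"
      unfolding D_def by (intro allI impI, rule excess_integral_le)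
    ultimately show ?thesis by blast
  qed
  then obtain D where D: "0 \<le> D" "2 * D \<le> sigma n (complex_dim G) * d"
    "\<And>c r x0 M. c \<in> G \<Longrightarrow> 0 < r \<Longrightarrow> x0 \<in> cball c r \<inter> G \<Longrightarrow> u x0 = ereal M \<Longrightarrow>
      (\<integral>\<^sup>+x. indicator (ball c r) x * e2ennreal (ereal M - u x) \<partial>\<mu>) \<le> ennreal D * emeasure \<mu> (ball c r)"
    by blast
  have eball: "emeasure (subspace_lebesgue G) (ball c r \<inter> G) = emeasure \<mu> (ball c r)" for c r
    unfolding \<mu>_def by (rule emeasure_subspace_lebesgue[OF sub]) simp
  have "u \<in> bmo G \<and> bmo_norm G u \<le> ennreal (2 * D)"
  proof (rule bmo_of_excess[OF sub _ D(1)])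
    fix r :: real and c :: "complex ^ 'n" assume c: "c \<in> G" and r: "0 < r"
    have "emeasure \<mu> (ball c r) = emeasure \<mu> (ball 0 r)"
      using emeasure_ball_affine[OF c, of 1 r] by simp
    then show "0 < emeasure (subspace_lebesgue G) (ball c r \<inter> G) \<and> emeasure (subspace_lebesgue G) (ball c r \<inter> G) < \<infinity>"
      unfolding eball using ball_pos[OF r] ball_finite[of r] by simp
    obtain x0 M where x0: "x0 \<in> cball c r \<inter> G" "u x0 = ereal M" "\<And>x. x \<in> cball c r \<inter> G \<Longrightarrow> u x \<le> ereal M"
      using attains_max[OF G c r ne] by metis
    have "(\<integral>\<^sup>+x. e2ennreal (ereal M - u x) * indicator (ball c r \<inter> G) x \<partial>subspace_lebesgue G)
      = (\<integral>\<^sup>+x. indicator (ball c r) x * e2ennreal (ereal M - u x) \<partial>subspace_lebesgue G)"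
      by (intro nn_integral_cong) (simp add: indicator_def)
    also have "\<dots> = (\<integral>\<^sup>+x. indicator (ball c r) x * e2ennreal (ereal M - u x) \<partial>\<mu>)"
      unfolding \<mu>_def by (intro nn_integral_subspace_lebesgue sub borel_measurable_times_ennreal borel_measurable_indicator) auto
    also have "\<dots> \<le> ennreal D * emeasure (subspace_lebesgue G) (ball c r \<inter> G)"
      unfolding eball using D(3)[OF c r x0(1,2)] .
    finally show "\<exists>M::real. (\<forall>x\<in>ball c r \<inter> G. u x \<le> ereal M) \<and>
      (\<integral>\<^sup>+x. e2ennreal (ereal M - u x) * indicator (ball c r \<inter> G) x \<partial>subspace_lebesgue G)
        \<le> ennreal D * emeasure (subspace_lebesgue G) (ball c r \<inter> G)"
      using x0(3) by (intro exI[of _ M]) auto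
  qed simp
  moreover have "ennreal (2 * D) \<le> ennreal (sigma n (complex_dim G) * d)" using D(2) by (rule ennreal_leI)
  ultimately show ?thesis unfolding n_def by (blast intro: order_trans)
qed

subsection \<open>Logarithms of polynomials\<close>

definition log_abs :: "complex \<Rightarrow> ereal" where
  "log_abs z = (if z = 0 then -\<infinity> else ereal (ln (norm z)))"

lemma log_abs_mult: "log_abs (x * y) = log_abs x + log_abs y"
  by (auto simp: log_abs_def norm_mult ln_mult_pos)

lemma log_abs_le: "0 < B \<Longrightarrow> norm z \<le> B \<Longrightarrow> log_abs z \<le> ereal (ln B)"
  by (auto simp: log_abs_def intro: ln_mono)

lemma usc_log_abs: "usc log_abs"
  unfolding usc_def
proof
  fix a
  show "open {x. log_abs x < a}"
  proof (cases a)
    case (real b)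
    have "log_abs x < ereal b \<longleftrightarrow> norm x < exp b" for x
    proof (cases "x = 0")
      case False
      then have "ln (norm x) < b \<longleftrightarrow> norm x < exp b" by (metis exp_less_cancel_iff exp_ln zero_less_norm_iff)
      then show ?thesis using False by (simp only: log_abs_def if_False less_ereal.simps)
    qed (simp add: log_abs_def)
    then have "{x. log_abs x < a} = ball 0 (exp b)" using real by (simp add: ball_def)
    then show ?thesis by simp
  next
    case PInf
    then have "{x. log_abs x < a} = UNIV" by (auto simp: log_abs_def)
    then show ?thesis by simp
  qed simp
qed

lemma log_abs_measurable [measurable]: "log_abs \<in> borel_measurable borel"
  by (rule usc_borel_measurable[OF usc_log_abs])

text \<open>Turns a difference of two integrals into a constant minus one integral of a nonnegative
  function. In this form circle means can be added, and Fatou's lemma applies.\<close>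

lemma ereal_integral_circ_shift:
  assumes [measurable]: "f \<in> borel_measurable borel" and L: "0 \<le> L" "\<And>t. f t \<le> ereal L"
  shows "ereal_integral circ f = ereal L - enn2ereal (\<integral>\<^sup>+t. e2ennreal (ereal L - f t) \<partial>circ)"
proof -
  define p where "p = (\<integral>\<^sup>+t. e2ennreal (f t) \<partial>circ)"
  define n where "n = (\<integral>\<^sup>+t. e2ennreal (- f t) \<partial>circ)"
  define q where "q = (\<integral>\<^sup>+t. e2ennreal (ereal L - f t) \<partial>circ)"
  \<comment> \<open>At \<open>f t = -\<infinity>\<close> both sides are infinite.\<close>
  have pt: "e2ennreal (f t) + e2ennreal (ereal L - f t) = ennreal L + e2ennreal (- f t)" for t
  proof (cases "f t")
    case (real x)
    then show ?thesis using L(1) L(2)[of t]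
      by (cases "0 \<le> x") (auto simp: ennreal_neg ennreal_plus[symmetric] simp del: ennreal_plus)
  qed (use L(2)[of t] in \<open>auto simp: e2ennreal_neg\<close>)
  have "p + q = (\<integral>\<^sup>+t. ennreal L + e2ennreal (- f t) \<partial>circ)"
    unfolding p_def q_def pt[symmetric] by (rule nn_integral_add[symmetric]) auto
  also have "\<dots> = ennreal L + n"
    unfolding n_def by (subst nn_integral_add) (auto simp: emeasure_circ)
  finally have eq: "p + q = ennreal L + n" .
  have "p \<le> (\<integral>\<^sup>+t. ennreal L \<partial>circ)"
    unfolding p_def using e2ennreal_mono[OF L(2)] by (intro nn_integral_mono) simp
  also have "\<dots> = ennreal L" by (simp add: emeasure_circ)
  finally have "p \<noteq> \<infinity>" by (auto simp: top_unique)
  then obtain p' where p: "p = ennreal p'" "0 \<le> p'" by (cases p) auto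
  have "enn2ereal p - enn2ereal n = ereal L - enn2ereal q"
  proof (cases n)
    case (real n')
    then have "q \<noteq> \<infinity>" using eq p by (metis ennreal_add_eq_top ennreal_neq_top infinity_ennreal_def)
    then obtain q' where q: "q = ennreal q'" "0 \<le> q'" by (cases q) auto
    then have "p' + q' = L + n'" using eq p real L(1)
      by (simp add: ennreal_plus[symmetric] del: ennreal_plus)
    then show ?thesis using p q real by simp
  next
    case top
    then have "q = \<infinity>" using eq p by (metis ennreal_add_eq_top ennreal_neq_top infinity_ennreal_def)
    then show ?thesis using p top by simp
  qed
  then show ?thesis by (simp add: ereal_integral_def p_def n_def q_def)
qed

text \<open>The sub-mean value property of the logarithm of the modulus, stated in terms of
  \<open>q\<close> so that it can be passed to products and a polynomial can be treated factor by
  factor.\<close>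

definition log_submean :: "(complex \<Rightarrow> complex) \<Rightarrow> bool" where
  "log_submean q \<longleftrightarrow> (\<forall>a. \<forall>r>0. log_abs (q a) \<le> circle_mean (\<lambda>z. log_abs (q z)) a r)"

lemma log_submean_const: "log_submean (\<lambda>_. c)"
proof -
  interpret finite_measure circ by (rule finite_measure_circ)
  have "log_abs c \<le> ereal_integral circ (\<lambda>t. log_abs c)"
  proof (cases "c = 0")
    case False
    have "ereal_integral circ (\<lambda>t. ereal (ln (norm c))) = ereal (integral\<^sup>L circ (\<lambda>t. ln (norm c)))"
      by (rule ereal_integral_real) simp
    then show ?thesis using False by (simp add: log_abs_def measure_def emeasure_circ)
  qed (simp add: log_abs_def)
  then show ?thesis by (simp add: log_submean_def circle_mean_circ)
qed

lemma bounded_on_circle: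
  fixes q :: "complex \<Rightarrow> complex"
  assumes "continuous_on UNIV q"
  obtains L where "0 \<le> L" "\<And>t. log_abs (q (a + of_real r * cis t)) \<le> ereal L"
proof -
  have "compact (q ` cball a \<bar>r\<bar>)"
    using continuous_on_subset[OF assms] by (intro compact_continuous_image) auto
  then have "bounded (q ` cball a \<bar>r\<bar>)" by (rule compact_imp_bounded)
  then obtain B where "\<forall>x\<in>q ` cball a \<bar>r\<bar>. norm x \<le> B" unfolding bounded_iff by (rule exE)
  then have B: "norm (q z) \<le> B" if "z \<in> cball a \<bar>r\<bar>" for z using that by (rule bspec[OF _ imageI])
  have "log_abs (q (a + of_real r * cis t)) \<le> ereal (ln (max 1 B))" for t
    using B[of "a + of_real r * cis t"] by (intro log_abs_le) (auto simp: dist_norm norm_mult)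
  then show thesis by (intro that[of "ln (max 1 B)"]) auto
qed

lemma circle_compose_measurable:
  assumes "continuous_on UNIV (q :: complex \<Rightarrow> complex)"
  shows "(\<lambda>t. log_abs (q (a + of_real r * cis t))) \<in> borel_measurable borel"
proof -
  have "(\<lambda>t. q (a + of_real r * cis t)) \<in> borel_measurable borel"
    by (intro borel_measurable_continuous_onI continuous_on_compose2[OF assms] continuous_intros) auto
  then show ?thesis by (rule measurable_compose[OF _ log_abs_measurable])
qed

text \<open>The logarithm of a product is a sum. Measured from the upper bounds \<open>L1\<close>
  and \<open>L2\<close>, the circle means become integrals of nonnegative functions, which add
  without differences of infinities.\<close>

lemma log_submean_mult:
  assumes q: "continuous_on UNIV q1" "continuous_on UNIV q2" and s: "log_submean q1" "log_submean q2"
  shows "log_submean (\<lambda>z. q1 z * q2 z)"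
  unfolding log_submean_def
proof (intro allI impI)
  fix a and r :: real assume r: "0 < r"
  \<comment> \<open>Indexed by a truth value so that measurability is shown once for both
    factors.\<close>
  define f where "f i t = log_abs (if i then q1 (a + of_real r * cis t) else q2 (a + of_real r * cis t))" for i t
  have fm [measurable]: "f i \<in> borel_measurable borel" for i
    unfolding f_def by (cases i) (use circle_compose_measurable q in auto)
  obtain L1 where L1: "0 \<le> L1" "\<And>t. f True t \<le> ereal L1"
    using bounded_on_circle[OF q(1), where a = a and r = r] unfolding f_def by auto
  obtain L2 where L2: "0 \<le> L2" "\<And>t. f False t \<le> ereal L2"
    using bounded_on_circle[OF q(2), where a = a and r = r] unfolding f_def by auto
  define I1 where "I1 = (\<integral>\<^sup>+t. e2ennreal (ereal L1 - f True t) \<partial>circ)"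
  define I2 where "I2 = (\<integral>\<^sup>+t. e2ennreal (ereal L2 - f False t) \<partial>circ)"
  have "log_abs (q1 a) \<le> ereal_integral circ (f True)"
    using s(1) r unfolding log_submean_def circle_mean_circ by (simp add: f_def[abs_def])
  also have "\<dots> = ereal L1 - enn2ereal I1"
    unfolding I1_def by (rule ereal_integral_circ_shift[OF fm L1])
  finally have 1: "log_abs (q1 a) \<le> ereal L1 - enn2ereal I1" .
  have "log_abs (q2 a) \<le> ereal_integral circ (f False)"
    using s(2) r unfolding log_submean_def circle_mean_circ by (simp add: f_def[abs_def])
  also have "\<dots> = ereal L2 - enn2ereal I2"
    unfolding I2_def by (rule ereal_integral_circ_shift[OF fm L2])
  finally have 2: "log_abs (q2 a) \<le> ereal L2 - enn2ereal I2" .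
  have fle: "f True t + f False t \<le> ereal (L1 + L2)" for t
    using add_mono[OF L1(2)[of t] L2(2)[of t]] by simp
  have "circle_mean (\<lambda>z. log_abs (q1 z * q2 z)) a r = ereal_integral circ (\<lambda>t. f True t + f False t)"
    by (simp add: circle_mean_circ log_abs_mult f_def)
  also have "\<dots> = ereal (L1 + L2) - enn2ereal (\<integral>\<^sup>+t. e2ennreal (ereal (L1 + L2) - (f True t + f False t)) \<partial>circ)"
    using L1 L2 fle by (intro ereal_integral_circ_shift) auto
  also have "(\<integral>\<^sup>+t. e2ennreal (ereal (L1 + L2) - (f True t + f False t)) \<partial>circ) = (\<integral>\<^sup>+t. e2ennreal (ereal L1 - f True t) + e2ennreal (ereal L2 - f False t) \<partial>circ)"
  proof (rule nn_integral_cong)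
    fix t
    show "e2ennreal (ereal (L1 + L2) - (f True t + f False t)) = e2ennreal (ereal L1 - f True t) + e2ennreal (ereal L2 - f False t)"
      using L1(2)[of t] L2(2)[of t]
      by (cases "f True t"; cases "f False t") (auto simp: algebra_simps simp flip: ennreal_plus)
  qed
  also have "\<dots> = I1 + I2" unfolding I1_def I2_def by (rule nn_integral_add) auto
  finally have mean: "circle_mean (\<lambda>z. log_abs (q1 z * q2 z)) a r = ereal (L1 + L2) - enn2ereal (I1 + I2)" .
  have "log_abs (q1 a * q2 a) \<le> (ereal L1 - enn2ereal I1) + (ereal L2 - enn2ereal I2)"
    unfolding log_abs_mult using 1 2 by (rule add_mono)
  also have "\<dots> = ereal (L1 + L2) - enn2ereal (I1 + I2)"
    by (cases I1; cases I2) (auto simp flip: ennreal_plus)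
  finally show "log_abs (q1 a * q2 a) \<le> circle_mean (\<lambda>z. log_abs (q1 z * q2 z)) a r" unfolding mean .
qed

text \<open>A solution fixes \<open>cis t\<close> and hence \<open>t\<close> modulo
  \<open>2 * pi\<close>, so the exceptional set is countable.\<close>

lemma AE_circ_nonzero:
  assumes "0 < r" shows "AE t in circ. A + of_real r * cis t \<noteq> 0"
proof -
  have "countable {t. A + of_real r * cis t = 0}"
  proof (cases "{t. A + of_real r * cis t = 0} = {}")
    case False
    then obtain t0 where t0: "A + of_real r * cis t0 = 0" by blast
    have "{t. A + of_real r * cis t = 0} \<subseteq> range (\<lambda>n::int. t0 + 2 * pi * n)"
    proof
      fix t assume "t \<in> {t. A + of_real r * cis t = 0}"
      then have "A + of_real r * cis t = A + of_real r * cis t0" using t0 by simp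
      then have "cis t = cis t0" using assms by simp
      then have "sin t = sin t0 \<and> cos t = cos t0" by (simp add: complex_eq_iff)
      then show "t \<in> range (\<lambda>n::int. t0 + 2 * pi * n)" using sin_cos_eq_iff by blast
    qed
    then show ?thesis by (rule countable_subset) simp
  qed simp
  then have "AE t in lborel. A + of_real r * cis t \<noteq> 0"
    by (intro AE_I'[OF countable_imp_null_set_lborel]) auto
  then show ?thesis
    unfolding circ_density by (subst AE_density) (auto elim: eventually_mono)
qed

text \<open>The critical case is \<open>norm (a - w) = r\<close>, where \<open>w\<close> lies on the circle; it follows from smaller
  circles by Fatou's lemma.\<close>

lemma log_submean_linear: "log_submean (\<lambda>z. z - w)"
  unfolding log_submean_def
proof (intro allI impI)
  fix a and r :: real assume r: "0 < r"
  define A where "A = a - w"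
  have mean: "circle_mean (\<lambda>z. log_abs (z - w)) a r = ereal_integral circ (\<lambda>t. log_abs (A + of_real r * cis t))"
    by (simp add: circle_mean_circ A_def algebra_simps)
  have ne: "B + D * cis t \<noteq> 0" if "norm D < norm B" for B D t
  proof
    assume "B + D * cis t = 0"
    then have "norm B = norm (D * cis t)" by (metis add_eq_0_iff norm_minus_cancel)
    then show False using that by (simp add: norm_mult)
  qed
  have regular: "ereal_integral circ (\<lambda>t. log_abs (B + D * cis t)) = ereal (ln (norm B))" if "norm D < norm B" for B D
    using ereal_integral_real[OF integrable_circ[OF continuous_on_log_circle[OF that]]] log_circle_mean[OF that] ne[OF that]
    by (simp add: log_abs_def)
  consider "r < norm A" | "norm A < r" | "norm A = r" by linarith
  then have "log_abs A \<le> ereal_integral circ (\<lambda>t. log_abs (A + of_real r * cis t))"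
  proof cases
    case 1
    then show ?thesis using regular[of "of_real r" A] r by (auto simp: log_abs_def)
  next
    case 2
    \<comment> \<open>The zero lies inside the circle. Conjugating and multiplying by
      \<open>cis t\<close> exchanges the roles of \<open>A\<close> and the radius without changing
      the modulus, which leads back to a zero outside.\<close>
    have "log_abs (A + of_real r * cis t) = log_abs (of_real r + cnj A * cis t)" for t
    proof -
      have "norm (A + of_real r * cis t) = norm (cnj (A + of_real r * cis t) * cis t)"
        by (simp add: norm_mult del: complex_cnj_add)
      also have "cnj (A + of_real r * cis t) * cis t = of_real r + cnj A * cis t"
        by (simp add: algebra_simps cis_cnj cis_mult)
      finally have "norm (A + of_real r * cis t) = norm (of_real r + cnj A * cis t)" .
      then show ?thesis by (metis log_abs_def norm_eq_zero)
    qed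
    then have "ereal_integral circ (\<lambda>t. log_abs (A + of_real r * cis t)) = ereal (ln r)"
      using regular[of "cnj A" "of_real r"] 2 r by simp
    moreover have "log_abs A \<le> ereal (ln r)" using 2 r by (intro log_abs_le) auto
    ultimately show ?thesis by simp
  next
    case 3
    \<comment> \<open>Since \<open>norm A = r\<close>, this bounds the logarithm on all circles of
      radius at most \<open>r\<close>; \<open>ereal_integral_circ_shift\<close> wants it
      nonnegative.\<close>
    define L where "L = max 0 (ln (2 * r))"
    have L: "0 \<le> L" "ln (2 * r) \<le> L" by (auto simp: L_def)
    define f where "f t = log_abs (A + of_real r * cis t)" for t
    have fm [measurable]: "f \<in> borel_measurable borel"
      unfolding f_def by (intro measurable_compose[OF _ log_abs_measurable] borel_measurable_continuous_onI continuous_intros)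
    have nle: "norm (A + of_real x * cis t) \<le> 2 * r" if "0 \<le> x" "x \<le> r" for x t
      using norm_triangle_ineq[of A "of_real x * cis t"] that 3 by (simp add: norm_mult)
    have fL: "f t \<le> ereal L" for t
      using log_abs_le[OF _ nle[of r t]] r L(2) unfolding f_def by (meson ereal_less_eq(3) less_imp_le mult_pos_pos order_refl order_trans zero_less_numeral)
    \<comment> \<open>Radii from \<open>r / 2\<close> on, strictly below \<open>r\<close> and
      tending to it.\<close>
    define \<rho> where "\<rho> j = r * (1 - 1 / (real j + 2))" for j
    have \<rho>: "0 \<le> \<rho> j" "\<rho> j < r" for j
      using r by (auto simp: \<rho>_def field_simps)
    have \<rho>lim: "\<rho> \<longlonglongrightarrow> r"
    proof -
      have "(\<lambda>j. 1 - 1 / (real j + 2)) \<longlonglongrightarrow> 1" by real_asymp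
      then have "\<rho> \<longlonglongrightarrow> r * 1" unfolding \<rho>_def by (intro tendsto_intros)
      then show ?thesis by simp
    qed
    have nr: "norm (of_real (\<rho> j) :: complex) < norm A" for j using \<rho>[of j] 3 by simp
    define g where "g j t = L - ln (norm (A + of_real (\<rho> j) * cis t))" for j t
    have g0: "0 \<le> g j t" for j t
    proof -
      have "ln (norm (A + of_real (\<rho> j) * cis t)) \<le> ln (2 * r)"
        using ne[OF nr] nle[of "\<rho> j" t] \<rho>[of j] by (intro ln_mono) auto
      then show ?thesis using L(2) by (simp add: g_def)
    qed
    interpret finite_measure circ by (rule finite_measure_circ)
    have gint: "integrable circ (g j)" for j
      unfolding g_def by (intro Bochner_Integration.integrable_diff integrable_circ continuous_on_log_circle nr) simp
    have gI: "(\<integral>\<^sup>+t. ennreal (g j t) \<partial>circ) = ennreal (L - ln r)" for j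
    proof -
      have "(\<integral>\<^sup>+t. ennreal (g j t) \<partial>circ) = ennreal (integral\<^sup>L circ (g j))"
        using gint g0 by (intro nn_integral_eq_integral) auto
      also have "integral\<^sup>L circ (g j) = L - ln r"
        unfolding g_def using integrable_circ[OF continuous_on_log_circle[OF nr]] log_circle_mean[OF nr] 3
        by (simp add: measure_def emeasure_circ)
      finally show ?thesis .
    qed
    have conv: "AE t in circ. e2ennreal (ereal L - f t) \<le> liminf (\<lambda>j. ennreal (g j t))"
      using AE_circ_nonzero[OF r, of A]
    proof eventually_elim
      case (elim t)
      have "(\<lambda>j. ennreal (g j t)) \<longlonglongrightarrow> ennreal (L - ln (norm (A + of_real r * cis t)))"
        unfolding g_def using elim by (intro tendsto_intros tendsto_ennrealI \<rho>lim) auto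
      then have "liminf (\<lambda>j. ennreal (g j t)) = ennreal (L - ln (norm (A + of_real r * cis t)))"
        by (intro lim_imp_Liminf) auto
      then show ?case using elim by (simp add: f_def log_abs_def)
    qed
    \<comment> \<open>Fatou: on each smaller circle the integral is exactly \<open>L - ln r\<close>,
      by the mean value property.\<close>
    have "(\<integral>\<^sup>+t. e2ennreal (ereal L - f t) \<partial>circ) \<le> (\<integral>\<^sup>+t. liminf (\<lambda>j. ennreal (g j t)) \<partial>circ)"
      by (rule nn_integral_mono_AE[OF conv])
    also have "\<dots> \<le> liminf (\<lambda>j. (\<integral>\<^sup>+t. ennreal (g j t) \<partial>circ))"
      using gint by (intro nn_integral_liminf) (auto dest: borel_measurable_integrable)
    also have "\<dots> = ennreal (L - ln r)" unfolding gI by (simp add: Liminf_const)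
    finally have le: "(\<integral>\<^sup>+t. e2ennreal (ereal L - f t) \<partial>circ) \<le> ennreal (L - ln r)" .
    have "ln r \<le> ln (2 * r)" using r by (intro ln_mono) auto
    then have Lr: "0 \<le> L - ln r" using L(2) by simp
    have "enn2ereal (\<integral>\<^sup>+t. e2ennreal (ereal L - f t) \<partial>circ) \<le> ereal (L - ln r)"
      using le Lr by (metis enn2ereal_ennreal less_eq_ennreal.rep_eq)
    then have "ereal L - ereal (L - ln r) \<le> ereal L - enn2ereal (\<integral>\<^sup>+t. e2ennreal (ereal L - f t) \<partial>circ)"
      by (intro ereal_minus_mono) auto
    also have "\<dots> = ereal_integral circ f" by (rule ereal_integral_circ_shift[OF fm L(1) fL, symmetric])
    finally have "ereal (ln r) \<le> ereal_integral circ f" by simp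
    then show ?thesis using 3 r by (auto simp: f_def[abs_def] log_abs_def)
  qed
  then show "log_abs (a - w) \<le> circle_mean (\<lambda>z. log_abs (z - w)) a r"
    unfolding mean by (simp add: A_def)
qed

text \<open>The fundamental theorem of algebra reduces this to constants and linear factors.\<close>

lemma log_submean_poly: "log_submean (poly q)"
proof (cases "q = 0")
  case True
  then show ?thesis using log_submean_const[of 0] by (simp add: poly_0[abs_def])
next
  case False
  obtain A where A: "q = smult (lead_coeff q) (\<Prod>x\<in>#A. [:- x, 1:])"
    using alg_closed_imp_factorization[OF False] by metis
  have "log_submean (poly (\<Prod>x\<in>#A. [:- x, 1:]))"
  proof (induction A)
    case empty
    show ?case using log_submean_const[of 1] by (simp add: poly_1[abs_def])
  next
    case (add x A)
    have "log_submean (\<lambda>z. (z - x) * poly (\<Prod>x\<in>#A. [:- x, 1:]) z)"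
      by (intro log_submean_mult log_submean_linear add continuous_intros)
    moreover have "poly (\<Prod>x\<in>#add_mset x A. [:- x, 1:]) = (\<lambda>z. (z - x) * poly (\<Prod>x\<in>#A. [:- x, 1:]) z)"
      by (simp add: fun_eq_iff algebra_simps)
    ultimately show ?case by simp
  qed
  then have "log_submean (\<lambda>z. lead_coeff q * poly (\<Prod>x\<in>#A. [:- x, 1:]) z)"
    by (intro log_submean_mult log_submean_const continuous_intros)
  moreover have "poly q = (\<lambda>z. lead_coeff q * poly (\<Prod>x\<in>#A. [:- x, 1:]) z)"
    by (subst A) (simp add: fun_eq_iff)
  ultimately show ?thesis by simp
qed

section \<open>Polynomials in several variables: restriction to lines, growth, nonvanishing\<close>

lemma log_abs_poly_eq: "log_abs_poly P z = log_abs (poly_eval P z)"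
  by (simp add: log_abs_poly_def log_abs_def)

text \<open>Reduces plurisubharmonicity to polynomials in one variable; the witness substitutes
  \<open>a $ i + \<zeta> * b $ i\<close> for the variables.\<close>

lemma poly_eval_line:
  fixes P :: "'n::finite cpoly"
  shows "\<exists>q. \<forall>\<zeta>. poly q \<zeta> = poly_eval P (a + \<zeta> *s b)"
proof
  show "\<forall>\<zeta>. poly (\<Sum>\<alpha>\<in>Poly_Mapping.keys P. [:Poly_Mapping.lookup P \<alpha>:] *
      (\<Prod>i\<in>UNIV. [:a $ i, b $ i:] ^ Poly_Mapping.lookup \<alpha> i)) \<zeta> = poly_eval P (a + \<zeta> *s b)"
    by (simp add: poly_eval_def poly_sum poly_prod mult.commute)
qed

lemma continuous_on_poly_eval: "continuous_on S (poly_eval P)"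
  unfolding poly_eval_def[abs_def] by (intro continuous_intros)

lemma psh_log_abs_poly:
  fixes P :: "'n::finite cpoly"
  shows "psh (log_abs_poly P)"
  unfolding psh_def subharmonic_def
proof (intro conjI allI impI)
  have usc: "usc (\<lambda>z. log_abs (poly_eval P z))"
    by (rule usc_compose[OF usc_log_abs continuous_on_poly_eval])
  then show "usc (log_abs_poly P)" by (simp add: log_abs_poly_eq[abs_def])
  show fin: "log_abs_poly P z < \<infinity>" for z by (simp add: log_abs_poly_def)
  then show "log_abs_poly P (a + z *s b) < \<infinity>" for a b z .
  show "usc (\<lambda>\<zeta>. log_abs_poly P (a + \<zeta> *s b))" for a b
    unfolding log_abs_poly_eq
    by (rule usc_compose[OF usc]) (intro continuous_intros continuous_on_scalar_mult)
  show "log_abs_poly P (a + z *s b) \<le> circle_mean (\<lambda>\<zeta>. log_abs_poly P (a + \<zeta> *s b)) z r" if "0 < r" for a b z r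
  proof -
    obtain q where q: "\<And>\<zeta>. poly_eval P (a + \<zeta> *s b) = poly q \<zeta>" using poly_eval_line[of P a b] by metis
    show ?thesis using log_submean_poly[of q] that unfolding log_submean_def log_abs_poly_eq q by blast
  qed
qed

lemma log_abs_poly_growth:
  fixes P :: "'n::finite cpoly"
  shows "\<exists>C. \<forall>z. log_abs_poly P z \<le> ereal (C + real (total_degree P) * ln (max 1 (norm z)))"
proof (intro exI allI)
  fix z :: "complex ^ 'n"
  define m where "m = max 1 (norm z)"
  \<comment> \<open>The summand 1 keeps \<open>B\<close> positive for the zero polynomial
    too.\<close>
  define B where "B = 1 + (\<Sum>\<alpha>\<in>Poly_Mapping.keys P. norm (Poly_Mapping.lookup P \<alpha>))"
  have m: "1 \<le> m" by (simp add: m_def)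
  have B: "1 \<le> B" by (simp add: B_def sum_nonneg)
  have mono: "norm (\<Prod>i\<in>UNIV. (z $ i) ^ Poly_Mapping.lookup \<alpha> i) \<le> m ^ total_degree P" if "\<alpha> \<in> Poly_Mapping.keys P" for \<alpha>
  proof -
    have "norm (\<Prod>i\<in>UNIV. (z $ i) ^ Poly_Mapping.lookup \<alpha> i) = (\<Prod>i\<in>UNIV. norm (z $ i) ^ Poly_Mapping.lookup \<alpha> i)"
      by (simp add: prod_norm[symmetric] norm_power)
    also have "\<dots> \<le> (\<Prod>i\<in>UNIV. m ^ Poly_Mapping.lookup \<alpha> i)"
      using Finite_Cartesian_Product.norm_nth_le[of z] by (intro prod_mono conjI power_mono) (auto simp: m_def le_max_iff_disj)
    also have "\<dots> = m ^ (\<Sum>i\<in>UNIV. Poly_Mapping.lookup \<alpha> i)" by (simp add: power_sum)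
    also have "\<dots> \<le> m ^ total_degree P"
      unfolding total_degree_def using that m by (intro power_increasing Max_ge) auto
    finally show ?thesis .
  qed
  have "norm (poly_eval P z) \<le> (\<Sum>\<alpha>\<in>Poly_Mapping.keys P. norm (Poly_Mapping.lookup P \<alpha>) * m ^ total_degree P)"
    unfolding poly_eval_def using mono by (intro sum_norm_le) (auto simp: norm_mult intro: mult_left_mono)
  also have "\<dots> \<le> B * m ^ total_degree P"
    using m by (simp add: B_def distrib_right sum_distrib_right)
  finally have "log_abs_poly P z \<le> ereal (ln (B * m ^ total_degree P))"
    unfolding log_abs_poly_eq using B m by (intro log_abs_le) auto
  also have "ln (B * m ^ total_degree P) = ln B + real (total_degree P) * ln m"
    using B m by (simp add: ln_mult_pos ln_realpow)
  finally show "log_abs_poly P z \<le> ereal (ln (1 + (\<Sum>\<alpha>\<in>Poly_Mapping.keys P. norm (Poly_Mapping.lookup P \<alpha>)))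
      + real (total_degree P) * ln (max 1 (norm z)))"
    by (simp add: B_def m_def)
qed

text \<open>The monomials are multiplicative, so Dedekind's argument for the independence of characters
  applies.\<close>

lemma monomials_independent:
  fixes c :: "('n::finite \<Rightarrow>\<^sub>0 nat) \<Rightarrow> complex"
  assumes "finite A" and "\<And>z :: complex ^ 'n. (\<Sum>\<alpha>\<in>A. c \<alpha> * (\<Prod>i\<in>UNIV. (z $ i) ^ Poly_Mapping.lookup \<alpha> i)) = 0"
  shows "\<forall>\<alpha>\<in>A. c \<alpha> = 0"
  using assms
proof (induction A arbitrary: c rule: finite_induct)
  case (insert \<beta> A)
  define e where "e \<alpha> z = (\<Prod>i\<in>UNIV. (z $ i) ^ Poly_Mapping.lookup \<alpha> i)" for \<alpha> and z :: "complex ^ 'n"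
  have e_mult: "e \<alpha> (\<chi> i. x $ i * z $ i) = e \<alpha> x * e \<alpha> z" for \<alpha> x z
    by (simp add: e_def power_mult_distrib prod.distrib)
  have zero: "c \<beta> * e \<beta> z + (\<Sum>\<alpha>\<in>A. c \<alpha> * e \<alpha> z) = 0" for z
    using insert.prems[of z] insert.hyps by (simp add: e_def)
  have cA: "c \<alpha> = 0" if \<alpha>: "\<alpha> \<in> A" for \<alpha>
  proof -
    have "\<alpha> \<noteq> \<beta>" using \<alpha> insert.hyps by auto
    then obtain i where i: "Poly_Mapping.lookup \<alpha> i \<noteq> Poly_Mapping.lookup \<beta> i"
      by (metis poly_mapping_eqI)
    \<comment> \<open>A 2 in a coordinate where the exponents differ makes \<open>e \<alpha>\<close>
      and \<open>e \<beta>\<close> take different values at \<open>x\<close>.\<close>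
    define x :: "complex ^ 'n" where "x = (\<chi> j. if j = i then 2 else 1)"
    have ex: "e \<gamma> x = 2 ^ Poly_Mapping.lookup \<gamma> i" for \<gamma>
    proof -
      have "e \<gamma> x = (\<Prod>j\<in>UNIV. if j = i then 2 ^ Poly_Mapping.lookup \<gamma> i else 1)"
        unfolding e_def by (intro prod.cong) (auto simp: x_def)
      then show ?thesis by simp
    qed
    \<comment> \<open>The relation at the coordinatewise product of \<open>x\<close> and
      \<open>z\<close>, minus \<open>e \<beta> x\<close> times the relation at \<open>z\<close>: the
      term of \<open>\<beta>\<close> cancels, and the induction hypothesis applies to what
      remains.\<close>
    have "(\<Sum>\<gamma>\<in>A. (c \<gamma> * (e \<gamma> x - e \<beta> x)) * e \<gamma> z) = 0" for z
    proof -
      have "(\<Sum>\<gamma>\<in>A. (c \<gamma> * (e \<gamma> x - e \<beta> x)) * e \<gamma> z)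
        = (\<Sum>\<gamma>\<in>A. c \<gamma> * e \<gamma> (\<chi> i. x $ i * z $ i)) - e \<beta> x * (\<Sum>\<gamma>\<in>A. c \<gamma> * e \<gamma> z)"
        unfolding e_mult by (simp add: sum_distrib_left sum_subtractf[symmetric] algebra_simps)
      also have "(\<Sum>\<gamma>\<in>A. c \<gamma> * e \<gamma> (\<chi> i. x $ i * z $ i)) = - (c \<beta> * e \<beta> (\<chi> i. x $ i * z $ i))"
        using zero[of "\<chi> i. x $ i * z $ i"] by (simp add: add_eq_0_iff)
      also have "(\<Sum>\<gamma>\<in>A. c \<gamma> * e \<gamma> z) = - (c \<beta> * e \<beta> z)"
        using zero[of z] by (simp add: add_eq_0_iff)
      finally show ?thesis unfolding e_mult by simp
    qed
    then have "c \<alpha> * (e \<alpha> x - e \<beta> x) = 0"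
      using insert.IH[of "\<lambda>\<gamma>. c \<gamma> * (e \<gamma> x - e \<beta> x)"] \<alpha> by (simp add: e_def)
    moreover have "(2::complex) ^ Poly_Mapping.lookup \<alpha> i \<noteq> 2 ^ Poly_Mapping.lookup \<beta> i"
    proof
      assume "(2::complex) ^ Poly_Mapping.lookup \<alpha> i = 2 ^ Poly_Mapping.lookup \<beta> i"
      then have "norm ((2::complex) ^ Poly_Mapping.lookup \<alpha> i) = norm ((2::complex) ^ Poly_Mapping.lookup \<beta> i)" by simp
      then have "(2::real) ^ Poly_Mapping.lookup \<alpha> i = 2 ^ Poly_Mapping.lookup \<beta> i" by (simp add: norm_power)
      then show False using i by simp
    qed
    ultimately show ?thesis by (simp add: ex)
  qed
  \<comment> \<open>Every monomial has the value 1 at the vector of ones.\<close>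
  have "c \<beta> * e \<beta> (\<chi> i. 1) = 0" using zero[of "\<chi> i. 1"] cA by simp
  then show ?case using cA by (simp add: e_def)
qed simp

text \<open>Positive degree provides a nonzero coefficient, and the independence of the monomials
  turns it into a point where \<open>P\<close> does not vanish.\<close>

lemma log_abs_poly_not_MInf:
  fixes P :: "'n::finite cpoly"
  assumes "1 \<le> total_degree P"
  shows "\<exists>z. log_abs_poly P z \<noteq> -\<infinity>"
proof (rule ccontr)
  assume "\<not> ?thesis"
  then have "\<And>z. poly_eval P z = 0" by (auto simp: log_abs_poly_def split: if_splits)
  then have "\<forall>\<alpha>\<in>Poly_Mapping.keys P. Poly_Mapping.lookup P \<alpha> = 0"
    by (intro monomials_independent) (auto simp: poly_eval_def)
  then have "Poly_Mapping.keys P = {}" by (metis all_not_in_conv in_keys_iff)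
  then show False using assms by (simp add: total_degree_def)
qed

lemma log_growth_log_abs_poly:
  fixes P :: "'n::finite cpoly"
  assumes "1 \<le> total_degree P"
  shows "\<exists>C. log_growth (log_abs_poly P) C (real (total_degree P))"
proof -
  obtain C where "\<And>z. log_abs_poly P z \<le> ereal (C + real (total_degree P) * ln (max 1 (norm z)))"
    using log_abs_poly_growth[of P] by blast
  then have "log_growth (log_abs_poly P) C (real (total_degree P))"
    using psh_log_abs_poly assms by unfold_locales auto
  then show ?thesis ..
qed


lemma lelong_log_growth:
  assumes "u \<in> lelong"
  shows "\<exists>C. log_growth u C 1"
proof -
  define S where "S = (SUP z. u z - ereal (ln (max 1 (norm z))))"
  have u: "psh u" "S < \<infinity>"
    using assms[unfolded lelong_def, THEN CollectD] unfolding S_def by (rule conjunct1, elim conjE)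
  from u(2) obtain C where C: "S \<le> ereal C" by (cases S) auto
  have "u z \<le> ereal (C + 1 * ln (max 1 (norm z)))" for z
  proof -
    have "u z - ereal (ln (max 1 (norm z))) \<le> ereal C"
      using SUP_upper[of z UNIV "\<lambda>z. u z - ereal (ln (max 1 (norm z)))"] C unfolding S_def
      by (auto intro: order_trans)
    then show ?thesis by (cases "u z") auto
  qed
  then have "log_growth u C 1" using u(1) by unfold_locales auto
  then show ?thesis ..
qed

subsection \<open>The main theorem\<close>

theorem corollary5p5:
  fixes G :: "(complex ^ 'n) set" and n m :: nat
  assumes "generic_subspace G"
    and "n = CARD('n)" and "m = complex_dim G"
  shows "(\<forall>u\<in>lelong. u \<in> bmo G \<and> bmo_norm G u \<le> ennreal (sigma n m)) \<and>
    (\<forall>(P :: 'n cpoly) d. total_degree P = d \<and> d \<ge> 1 \<longrightarrow>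
       log_abs_poly P \<in> bmo G \<and> bmo_norm G (log_abs_poly P) \<le> ennreal (sigma n m * real d))"
proof (intro conjI ballI allI impI)
  have bmo_le: "u \<in> bmo G \<and> bmo_norm G u \<le> ennreal (sigma n m * d)"
    if "log_growth u C d" "\<exists>z. u z \<noteq> -\<infinity>" for u :: "complex ^ 'n \<Rightarrow> ereal" and C d
    using log_growth.bmo[OF that(1) assms(1)] that(2) assms(2,3) by blast
  fix u :: "complex ^ 'n \<Rightarrow> ereal" assume u: "u \<in> lelong"
  obtain C where "log_growth u C 1" using lelong_log_growth[OF u] by blast
  moreover have "\<exists>z. u z \<noteq> -\<infinity>" using u unfolding lelong_def by blast
  ultimately show "u \<in> bmo G" "bmo_norm G u \<le> ennreal (sigma n m)"
    using bmo_le[of u C 1] by simp_all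
next
  fix P :: "'n cpoly" and d :: nat
  assume P: "total_degree P = d \<and> d \<ge> 1"
  then have d: "1 \<le> total_degree P" by simp
  obtain C where C: "log_growth (log_abs_poly P) C (real (total_degree P))"
    using log_growth_log_abs_poly[OF d] by blast
  obtain z where "log_abs_poly P z \<noteq> -\<infinity>" using log_abs_poly_not_MInf[OF d] by blast
  from log_growth.bmo[OF C assms(1) this]
  show "log_abs_poly P \<in> bmo G" "bmo_norm G (log_abs_poly P) \<le> ennreal (sigma n m * real d)"
    using P assms(2,3) by simp_all
qed

end
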